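(* Let $\alpha>1$, $\omega>0$, $p\ge0$. The linearised integral equation \[ l(x)=-2p+\int_\omega^{+\infty}K_\alpha\!\left(\tfrac{x}{y}\right)l(y)\frac{dy}{y},\qquad x\in[\omega,+\infty), \] admits a unique solution $l=l(\cdot;\omega,p):[\omega,+\infty)\to\mathbb{R}$ normalised so that $\lim_{x\to+\infty}x^{-\frac{1+\alpha}{2\alpha}}l(x)=1$. It is given by $l(x;\omega,p)=\bar l(\frac{x}{\omega};\omega,p)$ with \[ \bar l(\xi;\omega,p)=p\,\tau(\xi)-\frac{2\alpha}{1+\alpha}\left[p-\left(\frac{\omega}{A}\right)^{\frac{1+\alpha}{2\alpha}}\right]D_\xi\tau(\xi),\qquad \xi\ge1, \] and moreover $\bar l(1;\omega,p)=\sqrt{2(1+\alpha)}\left[\left(\frac{\omega}{A}\right)^{\frac{1+\alpha}{2\alpha}}-p\right]$ (understood as the limit $\xi\to1^+$ where derivatives are involved).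
   Context: $K_\alpha(x)=\frac{\sin(\frac{2\pi}{1+\alpha})}{\pi}\frac{x}{1+x^2-2x\cos(\frac{2\pi}{1+\alpha})}$; $D_\xi=\xi\frac{d}{d\xi}$. Let $\rho=\frac{\alpha+1}{\alpha}\alpha^{\frac{1}{\alpha+1}}$, $V(u;x)=xu^2-u^{2\alpha+2}-1$; for $x>\rho$ let $0<u_1(x)<u_2(x)$ be the two positive zeros of $V(\cdot;x)$, $S(x)=\frac1\pi\int_{u_1(x)}^{u_2(x)}\sqrt{V(u;x)}\frac{du}{u}$, and $S(x)=0$ for $0\le x\le\rho$. Let $\tau(\xi)=2(1+\alpha)S(\rho\xi)$ and $A=(1+\alpha)\left(\frac{1}{\sqrt{\pi\alpha}}\frac{\Gamma(\frac{1}{2\alpha})}{\Gamma(\frac{1+\alpha}{2\alpha})}\right)^{\frac{2\alpha}{\alpha+1}}$. *)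

theory Defs
  imports "HOL-Analysis.Analysis"
begin

definition Kalpha :: "real \<Rightarrow> real \<Rightarrow> real" where
  "Kalpha \<alpha> x = sin (2 * pi / (1 + \<alpha>)) / pi *
     (x / (1 + x\<^sup>2 - 2 * x * cos (2 * pi / (1 + \<alpha>))))"

definition rho :: "real \<Rightarrow> real" where
  "rho \<alpha> = (\<alpha> + 1) / \<alpha> * \<alpha> powr (1 / (\<alpha> + 1))"

definition Vpot :: "real \<Rightarrow> real \<Rightarrow> real \<Rightarrow> real" where
  "Vpot \<alpha> u x = x * u\<^sup>2 - u powr (2 * \<alpha> + 2) - 1"

text \<open>The positive zeros of V(.;x); for x > rho there are exactly two, u1 < u2.\<close>
definition u1 :: "real \<Rightarrow> real \<Rightarrow> real" where
  "u1 \<alpha> x = Inf {u. 0 < u \<and> Vpot \<alpha> u x = 0}"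

definition u2 :: "real \<Rightarrow> real \<Rightarrow> real" where
  "u2 \<alpha> x = Sup {u. 0 < u \<and> Vpot \<alpha> u x = 0}"

definition Sact :: "real \<Rightarrow> real \<Rightarrow> real" where
  "Sact \<alpha> x = (if x > rho \<alpha>
     then 1 / pi * integral {u1 \<alpha> x..u2 \<alpha> x} (\<lambda>u. sqrt (Vpot \<alpha> u x) / u)
     else 0)"

definition tau :: "real \<Rightarrow> real \<Rightarrow> real" where
  "tau \<alpha> \<xi> = 2 * (1 + \<alpha>) * Sact \<alpha> (rho \<alpha> * \<xi>)"

definition Aconst :: "real \<Rightarrow> real" where
  "Aconst \<alpha> = (1 + \<alpha>) * ((1 / sqrt (pi * \<alpha>)) * Gamma (1 / (2 * \<alpha>))
      / Gamma ((1 + \<alpha>) / (2 * \<alpha>))) powr (2 * \<alpha> / (\<alpha> + 1))"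

definition solves_lin :: "real \<Rightarrow> real \<Rightarrow> real \<Rightarrow> (real \<Rightarrow> real) \<Rightarrow> bool" where
  "solves_lin \<alpha> \<omega> p l \<longleftrightarrow>
     (\<forall>x\<ge>\<omega>. set_integrable lborel {\<omega>..} (\<lambda>y. Kalpha \<alpha> (x / y) * l y / y) \<and>
        l x = - 2 * p + (\<integral>y\<in>{\<omega>..}. Kalpha \<alpha> (x / y) * l y / y \<partial>lborel)) \<and>
     ((\<lambda>x. x powr (- (1 + \<alpha>) / (2 * \<alpha>)) * l x) \<longlongrightarrow> 1) at_top"

text \<open>D_xi tau = xi * tau'.\<close>
definition lbar :: "real \<Rightarrow> real \<Rightarrow> real \<Rightarrow> real \<Rightarrow> real" where
  "lbar \<alpha> \<omega> p \<xi> = p * tau \<alpha> \<xi> - 2 * \<alpha> / (1 + \<alpha>) *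
      (p - (\<omega> / Aconst \<alpha>) powr ((1 + \<alpha>) / (2 * \<alpha>))) * (\<xi> * deriv (tau \<alpha>) \<xi>)"

end

theory Submission
  imports Defs "HOL-Complex_Analysis.Complex_Analysis"
begin

text \<open>
  Substituting u = exp (t/2) turns the action into
  S(x) = 1/(2 pi) \<integral> exp (t/2) sqrt (x - b(t)) dt over the region b(t) < x, where b(t) = exp (\<alpha> t) + exp (-t)
  has minimum rho. Put f(x) = x S'(x) and h(x) = 1/(4 pi) \<integral> exp (-t/2) / sqrt (x - b(t)) dt.
  Integrating the derivative of exp (t/2) sqrt (x - b(t)) between the turning points gives Euler's relation
  S = 2\<alpha>/(1+\<alpha>) f - 2h.

  Since K(x/y)/y is the imaginary part of 1/(\<pi>(y - x exp (i\<theta>))) with \<theta> = 2\<pi>/(1+\<alpha>), Tonelli and the Abel integral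
  \<integral> dy / ((y - z) sqrt (y - a)) = \<pi> / sqrt (a - z) turn the integral operator applied to f or h into
  \<integral> Im (exp (nz) / sqrt (Q(z))) along Im z = \<theta>, where n is 1 or 0 and Q(z) = 1 + exp ((1+\<alpha>)z) - x exp z. Because
  Q(t + i\<theta>) is Q with x replaced by x exp (i\<theta>), pushing the line down to the real axis recovers f and h
  themselves: in the strip 0 < Im z \<le> \<theta> the function Q avoids [0, \<infinity>) when x > rho, and the imaginary part of the
  limit lives on b(t) < x. For n = 0 the left end of the strip contributes \<theta>. Hence f solves the homogeneous
  equation, h solves it up to the constant 1/(2(1+\<alpha>)), and S is obtained from Euler's relation.

  The asymptotics of f follow from those of S, a Beta integral, because h is bounded. For uniqueness, f + h is
  a strict supersolution of the homogeneous equation growing like x^((1+\<alpha>)/(2\<alpha>)), so a difference of two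
  solutions is zero by a maximum principle.
\<close>

section \<open>The potential and its turning points\<close>

text \<open>The turning points lie on the edge of the strip, so the collapse onto the real axis
  needs a majorant uniform in the height of the line. It comes from the simplicity of the zeros of
  \<open>Q\<close> there, which bounds |Q| below by a multiple of the two distances. For n = 0 the
  integrand tends to the real constant 1 at the left end, so integrability holds only for its
  imaginary part; this constant, integrated up the strip, is the source of the inhomogeneous term.
  The contour argument requires x > rho. The endpoint is reached through continuity of the integral
  operator, which rests on a Harnack bound for the kernel. Such care is needed because
  \<open>mom 1\<close> jumps at rho: it vanishes up to rho but has a positive right limit. Hence the
  solution and the comparison function are defined by the right-hand side of an integral equation,
  which gives the correct value at the endpoint, and not by the explicit formula. The size of the
  jump comes from the harmonic approximation of b at its minimum together with l'Hopital's
  rule.\<close>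

lemma sin_scale_ge:
  fixes a \<phi> :: real
  assumes "0 \<le> a" "a \<le> 1" "0 \<le> \<phi>" "\<phi> \<le> pi"
  shows "a * sin \<phi> \<le> sin (a * \<phi>)"
proof -
  have "sin (a * 0) - a * sin 0 \<le> sin (a * \<phi>) - a * sin \<phi>"
  proof (rule DERIV_nonneg_imp_nondecreasing[OF assms(3)])
    fix x assume x: "0 \<le> x" "x \<le> \<phi>"
    have "cos x \<le> cos (a * x)"
      by (rule cos_monotone_0_pi_le) (use assms x in \<open>auto intro: mult_left_le_one_le\<close>)
    hence "0 \<le> a * cos (a * x) - a * cos x" using assms by (simp add: mult_left_mono)
    moreover have "((\<lambda>\<phi>. sin (a * \<phi>) - a * sin \<phi>) has_real_derivative a * cos (a * x) - a * cos x) (at x)"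
      by (auto intro!: derivative_eq_intros)
    ultimately show "\<exists>y. ((\<lambda>\<phi>. sin (a * \<phi>) - a * sin \<phi>) has_real_derivative y) (at x) \<and> 0 \<le> y"
      by blast
  qed
  thus ?thesis by simp
qed

locale anharmonic =
  fixes \<alpha> :: real
  assumes alpha_gt_1: "\<alpha> > 1"
begin

abbreviation \<rho> :: real where "\<rho> \<equiv> rho \<alpha>"

definition \<theta> :: real where "\<theta> = 2 * pi / (1 + \<alpha>)"

definition b :: "real \<Rightarrow> real" where "b t = exp (\<alpha> * t) + exp (- t)"

text \<open>The critical point of \<open>b\<close>, i.e. the solution of \<alpha> exp (\<alpha> t) =
  exp (-t).\<close>

definition t0 :: real where "t0 = - ln \<alpha> / (1 + \<alpha>)"

text \<open>The entire extension of exp t * (b t - x). The factor exp t removes the negative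
  exponential and absorbs the exp (-t/2) of the moments into the square root.\<close>

definition Q :: "real \<Rightarrow> complex \<Rightarrow> complex" where
  "Q x z = 1 + exp (of_real (1 + \<alpha>) * z) - of_real x * exp z"

lemma theta_bounds: "0 < \<theta>" "\<theta> < pi" and alpha_theta: "(1 + \<alpha>) * \<theta> = 2 * pi"
  using alpha_gt_1 by (auto simp: \<theta>_def field_simps)

lemma exp_t0: "exp (\<alpha> * t0) = exp (- t0) / \<alpha>"
proof -
  have "\<alpha> * t0 = - t0 - ln \<alpha>" using alpha_gt_1 by (simp add: t0_def field_simps)
  hence "exp (\<alpha> * t0) = exp (- t0) / exp (ln \<alpha>)" by (simp add: exp_diff)
  thus ?thesis using alpha_gt_1 by simp
qed

lemma rho_eq: "\<rho> = (\<alpha> + 1) / \<alpha> * exp (- t0)"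
  using alpha_gt_1 by (simp add: rho_def t0_def powr_def add.commute)

lemma rho_eq2: "\<rho> = (1 + \<alpha>) * exp (\<alpha> * t0)"
  using alpha_gt_1 by (simp add: rho_eq exp_t0 field_simps)

lemma rho_pos: "0 < \<rho>"
  using alpha_gt_1 by (simp add: rho_eq)

lemma b_t0: "b t0 = \<rho>"
  using alpha_gt_1 by (simp add: b_def rho_eq exp_t0 field_simps)

lemma b_pos: "0 < b t" by (simp add: b_def add_pos_pos)

lemma b_deriv: "(b has_real_derivative \<alpha> * exp (\<alpha> * t) - exp (- t)) (at t within A)"
  unfolding b_def [abs_def] by (auto intro!: derivative_eq_intros)

lemma b_deriv2: "((\<lambda>t. \<alpha> * exp (\<alpha> * t) - exp (- t)) has_real_derivative \<alpha>\<^sup>2 * exp (\<alpha> * t) + exp (- t)) (at t)"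
  by (auto intro!: derivative_eq_intros simp: power2_eq_square)

lemma b_cont [continuous_intros]: "continuous_on A f \<Longrightarrow> continuous_on A (\<lambda>x. b (f x))"
  unfolding b_def by (intro continuous_intros)

lemma b_measurable [measurable]: "b \<in> borel_measurable borel"
  by (intro borel_measurable_continuous_onI continuous_intros)

lemma b'_t0: "\<alpha> * exp (\<alpha> * t0) - exp (- t0) = 0"
  using alpha_gt_1 by (simp add: exp_t0)

text \<open>For t \<ge> 0 the first term alone reaches 1, for t < 0 the second. The expression is
  the second derivative of \<open>b\<close>, so the resulting quadratic bound has a constant
  independent of \<alpha>.\<close>

lemma b_convexity: "1 \<le> \<alpha>\<^sup>2 * exp (\<alpha> * t) + exp (- t)"
proof (cases "t \<ge> 0")
  case True
  have "1 * 1 \<le> \<alpha>\<^sup>2 * exp (\<alpha> * t)"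
    using alpha_gt_1 True by (intro mult_mono) auto
  moreover have "0 < exp (- t)" by simp
  ultimately show ?thesis by linarith
next
  case False
  hence "1 \<le> exp (- t)" by simp
  moreover have "0 \<le> \<alpha>\<^sup>2 * exp (\<alpha> * t)" by simp
  ultimately show ?thesis by linarith
qed

lemma b'_mono: "s < t \<Longrightarrow> \<alpha> * exp (\<alpha> * s) - exp (- s) < \<alpha> * exp (\<alpha> * t) - exp (- t)"
  using alpha_gt_1 by (intro diff_strict_mono) (simp_all add: mult_strict_left_mono)

lemma b'_eq_0_iff: "\<alpha> * exp (\<alpha> * t) - exp (- t) = 0 \<longleftrightarrow> t = t0"
  using b'_mono[of t t0] b'_mono[of t0 t] b'_t0 by (metis less_irrefl linorder_neqE_linordered_idom)

text \<open>Second-order Taylor expansion at the critical point, with second derivative at least 1.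
  It yields the turning points, and later the majorant for x near rho.\<close>

lemma b_lower: "\<rho> + (t - t0)\<^sup>2 / 2 \<le> b t"
proof (cases "t = t0")
  case False
  define diff where "diff = (\<lambda>n::nat. if n = 0 then b else if n = 1 then (\<lambda>t. \<alpha> * exp (\<alpha> * t) - exp (- t))
      else (\<lambda>t. \<alpha>\<^sup>2 * exp (\<alpha> * t) + exp (- t)))"
  have "\<exists>s. (if t < t0 then t < s \<and> s < t0 else t0 < s \<and> s < t) \<and>
     b t = (\<Sum>m<2. (diff m t0 / fact m) * (t - t0)^m) + (diff 2 s / fact 2) * (t - t0)^2"
  proof (rule Taylor[of 2 diff b "min t t0" "max t t0"])
    show "\<forall>m s. m < 2 \<and> min t t0 \<le> s \<and> s \<le> max t t0 \<longrightarrow> (diff m has_real_derivative diff (Suc m) s) (at s)"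
    proof safe
      fix m :: nat and s :: real assume "m < 2"
      hence "m = 0 \<or> m = 1" by auto
      thus "(diff m has_real_derivative diff (Suc m) s) (at s)"
        using b_deriv b_deriv2 by (auto simp: diff_def)
    qed
  qed (use False in \<open>auto simp: diff_def\<close>)
  then obtain s where "b t = (\<Sum>m<2. (diff m t0 / fact m) * (t - t0)^m) + (diff 2 s / fact 2) * (t - t0)^2" by blast
  hence "b t = \<rho> + ((\<alpha>\<^sup>2 * exp (\<alpha> * s) + exp (- s)) / 2) * (t - t0)\<^sup>2"
    by (simp add: diff_def numeral_2_eq_2 b_t0 b'_t0)
  moreover have "1/2 * (t - t0)\<^sup>2 \<le> ((\<alpha>\<^sup>2 * exp (\<alpha> * s) + exp (- s)) / 2) * (t - t0)\<^sup>2"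
    by (rule mult_right_mono) (use b_convexity[of s] in auto)
  ultimately show ?thesis by simp
qed (simp add: b_t0)

lemma b_ge_rho: "\<rho> \<le> b t"
  using b_lower[of t] zero_le_power2[of "t - t0"] by linarith

lemma b_strict_mono: "t0 \<le> s \<Longrightarrow> s < t \<Longrightarrow> b s < b t"
proof (rule DERIV_pos_imp_increasing_open[of s t b])
  fix x assume "t0 \<le> s" "s < x"
  hence "0 < \<alpha> * exp (\<alpha> * x) - exp (- x)" using b'_mono[of t0 x] b'_t0 by simp
  thus "\<exists>y. (b has_real_derivative y) (at x) \<and> y > 0" using b_deriv by blast
qed (auto intro!: continuous_intros)

lemma b_strict_antimono: "t \<le> t0 \<Longrightarrow> s < t \<Longrightarrow> b t < b s"
proof (rule DERIV_neg_imp_decreasing_open[of s t b])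
  fix x assume "t \<le> t0" "x < t"
  hence "\<alpha> * exp (\<alpha> * x) - exp (- x) < 0" using b'_mono[of x t0] b'_t0 by simp
  thus "\<exists>y. (b has_real_derivative y) (at x) \<and> y < 0" using b_deriv by blast
qed (auto intro!: continuous_intros)

lemma turning_points:
  assumes "x > \<rho>"
  obtains t1 t2 where "t1 < t0" "t0 < t2" "b t1 = x" "b t2 = x" "\<forall>t. b t < x \<longleftrightarrow> t1 < t \<and> t < t2"
    "\<forall>t. b t = x \<longleftrightarrow> t = t1 \<or> t = t2"
proof -
  \<comment> \<open>Chosen because (1 + x)^2 / 2 \<ge> x, so \<open>b_lower\<close> puts b above x
    at distance R on either side of \<open>t0\<close>.\<close>
  define R where "R = 1 + x"
  have R: "R > 1" using rho_pos assms by (simp add: R_def)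
  have big: "x \<le> b (t0 + R)" "x \<le> b (t0 - R)"
  proof -
    have "x \<le> R\<^sup>2 / 2"
      using zero_le_power2[of x] by (simp add: power2_eq_square algebra_simps R_def)
    thus "x \<le> b (t0 + R)" "x \<le> b (t0 - R)"
      using b_lower[of "t0 + R"] b_lower[of "t0 - R"] rho_pos by simp_all
  qed
  have "\<exists>t\<ge>t0 - R. t \<le> t0 \<and> b t = x"
    by (rule IVT2'[of b]) (use big assms b_t0 R in \<open>auto intro!: continuous_intros\<close>)
  then obtain t1 where t1: "t1 \<le> t0" "b t1 = x" by blast
  have "\<exists>t\<ge>t0. t \<le> t0 + R \<and> b t = x"
    by (rule IVT'[of b]) (use big assms b_t0 R in \<open>auto intro!: continuous_intros\<close>)
  then obtain t2 where t2: "t0 \<le> t2" "b t2 = x" by blast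
  have lt: "t1 < t0" "t0 < t2" using t1 t2 b_t0 assms by (force simp: less_le)+
  have outer: "b t > x" if "t < t1 \<or> t2 < t" for t
    using that b_strict_mono[of t2 t] b_strict_antimono[of t1 t] t1 t2 lt by auto
  have inner: "b t < x" if "t1 < t" "t < t2" for t
    using that b_strict_mono[of t t2] b_strict_antimono[of t t1] t1 t2 lt by (cases "t \<ge> t0") auto
  have "b t < x \<longleftrightarrow> t1 < t \<and> t < t2" "b t = x \<longleftrightarrow> t = t1 \<or> t = t2" for t
    using outer[of t] inner[of t] t1 t2 by (metis less_irrefl linorder_neqE_linordered_idom less_asym)+
  thus ?thesis by (intro that[OF lt t1(2) t2(2)] allI)
qed

section \<open>The complex continuation and the values it avoids\<close>

lemma Re_Q: "Re (Q x z) = 1 + exp ((1 + \<alpha>) * Re z) * cos ((1 + \<alpha>) * Im z) - x * exp (Re z) * cos (Im z)"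
  and Im_Q: "Im (Q x z) = exp ((1 + \<alpha>) * Re z) * sin ((1 + \<alpha>) * Im z) - x * exp (Re z) * sin (Im z)"
  by (simp_all add: Q_def Re_exp Im_exp)

lemma Q_real: "Q x (of_real t) = of_real (exp t * (b t - x))"
  by (simp add: complex_eq_iff Re_Q Im_Q b_def algebra_simps flip: exp_add)

text \<open>Up to the angle pi this is \<open>sin_scale_ge\<close> with factor 1/(1+\<alpha>);
  beyond pi the angle is still at most 2 pi, so the left side is nonpositive.\<close>

lemma sin_mult_le:
  assumes "0 < \<psi>" "\<psi> \<le> \<theta>"
  shows "sin ((1 + \<alpha>) * \<psi>) \<le> (1 + \<alpha>) * sin \<psi>"
proof (cases "(1 + \<alpha>) * \<psi> \<le> pi")
  case True
  show ?thesis
    using sin_scale_ge[of "1 / (1 + \<alpha>)" "(1 + \<alpha>) * \<psi>"] True alpha_gt_1 assms by (simp add: pos_divide_le_eq mult.commute)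
next
  case False
  have "(1 + \<alpha>) * \<psi> \<le> 2 * pi" using assms alpha_gt_1 alpha_theta by (metis add_pos_pos less_trans mult_left_mono order_less_imp_le zero_less_one)
  hence "sin ((1 + \<alpha>) * \<psi>) \<le> 0"
    using False sin_ge_zero[of "2 * pi - (1 + \<alpha>) * \<psi>"] by (simp add: sin_diff)
  moreover have "0 \<le> (1 + \<alpha>) * sin \<psi>" using assms theta_bounds alpha_gt_1 by (simp add: sin_ge_zero)
  ultimately show ?thesis by linarith
qed

text \<open>If Q were real and nonnegative, Im Q = 0 would express x through the two sines and
  confine (1+\<alpha>) Im z to (0, pi]. The two sine inequalities and the two forms of rho then make
  Re Q negative after elimination of x.\<close>

lemma Q_avoids:
  assumes x: "x > \<rho>" and z: "0 < Im z" "Im z \<le> \<theta>"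
  shows "- Q x z \<notin> \<real>\<^sub>\<le>\<^sub>0"
proof
  define t where "t = Re z"
  define \<psi> where "\<psi> = Im z"
  define \<phi> where "\<phi> = (1 + \<alpha>) * \<psi>"
  assume "- Q x z \<in> \<real>\<^sub>\<le>\<^sub>0"
  hence re: "0 \<le> 1 + exp ((1 + \<alpha>) * t) * cos \<phi> - x * exp t * cos \<psi>"
    and im: "exp ((1 + \<alpha>) * t) * sin \<phi> = x * exp t * sin \<psi>"
    by (auto simp: complex_nonpos_Reals_iff Re_Q Im_Q t_def \<psi>_def \<phi>_def)
  have xp: "x > 0" using x rho_pos by simp
  have sp: "sin \<psi> > 0" using z theta_bounds by (simp add: \<psi>_def sin_gt_zero)
  have "0 < exp ((1 + \<alpha>) * t) * sin \<phi>" unfolding im using xp sp by simp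
  hence sphi: "sin \<phi> > 0" by (simp add: zero_less_mult_iff)
  have "\<phi> \<le> 2 * pi" "0 < \<phi>" unfolding \<phi>_def \<psi>_def using z alpha_gt_1 alpha_theta
    by (metis add_pos_pos less_trans mult_left_mono order_less_imp_le zero_less_one, simp)
  hence phi: "\<phi> \<le> pi" using sphi sin_ge_zero[of "2 * pi - \<phi>"] by (force simp: sin_diff)
  have s1: "sin \<phi> \<le> (1 + \<alpha>) * sin \<psi>" unfolding \<phi>_def using sin_mult_le z by (simp add: \<psi>_def)
  have s2: "\<alpha> / (1 + \<alpha>) * sin \<phi> \<le> sin (\<alpha> * \<psi>)"
    using sin_scale_ge[of "\<alpha> / (1 + \<alpha>)" \<phi>] alpha_gt_1 phi \<open>0 < \<phi>\<close> by (simp add: \<phi>_def)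
  have split: "exp ((1 + \<alpha>) * t) = exp t * exp (\<alpha> * t)" by (simp add: algebra_simps flip: exp_add)
  have im': "exp (\<alpha> * t) * sin \<phi> = x * sin \<psi>" using im by (simp add: split)
  \<comment> \<open>With rho written as (1+\<alpha>) exp (\<alpha> t0), the inequality
    \<open>s1\<close> forces t to the right of the minimum.\<close>
  have "(1 + \<alpha>) * exp (\<alpha> * t0) * sin \<phi> < x * sin \<phi>"
    using x sphi by (simp add: rho_eq2)
  also have "\<dots> \<le> x * ((1 + \<alpha>) * sin \<psi>)" using s1 xp by simp
  also have "\<dots> = (1 + \<alpha>) * exp (\<alpha> * t) * sin \<phi>" using im' by (simp add: algebra_simps)
  finally have "exp (\<alpha> * t0) < exp (\<alpha> * t)" using sphi alpha_gt_1 by simp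
  hence t: "t0 < t" using alpha_gt_1 by simp
  \<comment> \<open>The other form of rho. Increasing \<open>t0\<close> to t and rho to x turns it
    into a strict inequality, which \<open>s2\<close> converts to a bound on sin (\<alpha>
    \<psi>).\<close>
  have "1 = exp t0 * (\<alpha> / (1 + \<alpha>)) * \<rho>"
    using alpha_gt_1 by (simp add: rho_eq exp_minus add.commute)
  also have "\<dots> < exp t * (\<alpha> / (1 + \<alpha>)) * x"
    using t alpha_gt_1 x rho_pos
    by (intro mult_strict_mono[of "exp t0 * (\<alpha> / (1 + \<alpha>))"] mult_strict_right_mono[of "exp t0"]) auto
  finally have "sin \<psi> < exp t * (\<alpha> / (1 + \<alpha>)) * x * sin \<psi>"
    using mult_strict_right_mono[OF _ sp] by fastforce
  also have "\<dots> = exp t * exp (\<alpha> * t) * (\<alpha> / (1 + \<alpha>) * sin \<phi>)" using im' by (simp add: algebra_simps)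
  also have "\<dots> \<le> exp t * exp (\<alpha> * t) * sin (\<alpha> * \<psi>)" by (rule mult_left_mono[OF s2]) simp
  finally have 1: "sin \<psi> < exp ((1 + \<alpha>) * t) * sin (\<alpha> * \<psi>)" by (simp add: split)
  have "\<alpha> * \<psi> = \<phi> - \<psi>" by (simp add: \<phi>_def algebra_simps)
  hence 2: "sin (\<alpha> * \<psi>) = sin \<phi> * cos \<psi> - cos \<phi> * sin \<psi>" by (simp add: sin_diff)
  \<comment> \<open>Multiplying Re Q by sin \<psi> lets \<open>im\<close> eliminate x; the remaining
    terms combine to sin (\<phi> - \<psi>) = sin (\<alpha> \<psi>).\<close>
  have "0 \<le> (1 + exp ((1 + \<alpha>) * t) * cos \<phi> - x * exp t * cos \<psi>) * sin \<psi>" using re sp by simp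
  also have "\<dots> = sin \<psi> + exp ((1 + \<alpha>) * t) * cos \<phi> * sin \<psi> - (x * exp t * sin \<psi>) * cos \<psi>" by (simp add: algebra_simps)
  also have "\<dots> = sin \<psi> - exp ((1 + \<alpha>) * t) * sin (\<alpha> * \<psi>)" unfolding im[symmetric] 2 by (simp add: algebra_simps)
  finally show False using 1 by simp
qed

end

section \<open>The integrand in the strip\<close>

lemma integrable_exp_neg_abs:
  fixes c :: real assumes "c > 0"
  shows "integrable lborel (\<lambda>t. exp (- c * \<bar>t\<bar>))"
proof -
  have *: "integrable lborel (\<lambda>t. indicator {0..} t * exp (- c * t))"
  proof (rule integrableI_nonneg)
    have "(\<integral>\<^sup>+ t. ennreal (exp (- c * t)) * indicator {0..} t \<partial>lborel) = 0 - (- exp (- c * 0) / c)"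
    proof (rule nn_integral_FTC_atLeast)
      show "((\<lambda>t. - exp (- c * t) / c) \<longlongrightarrow> 0) at_top"
        using assms by real_asymp
      show "((\<lambda>t. - exp (- c * t) / c) has_real_derivative exp (- c * x)) (at x)" for x
        using assms by (auto intro!: derivative_eq_intros)
    qed auto
    also have "\<dots> < \<infinity>" by simp
    finally show "(\<integral>\<^sup>+ t. ennreal (indicator {0..} t * exp (- c * t)) \<partial>lborel) < \<infinity>"
      by (simp add: mult.commute ennreal_mult' ennreal_indicator)
  qed auto
  have "integrable lborel (\<lambda>t. indicator {0..} (0 + (-1) * t) * exp (- c * (0 + (-1) * t)))"
    by (rule lborel_integrable_real_affine[OF *]) simp
  from Bochner_Integration.integrable_add[OF * this]
  show ?thesis
    by (rule Bochner_Integration.integrable_bound) (auto simp: indicator_def)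
qed

lemma
  fixes a R :: real assumes R: "a < R"
  shows integrable_inverse_sqrt: "integrable lborel (\<lambda>t. indicator {a<..<R} t / sqrt (t - a))"
    and integral_inverse_sqrt: "(LBINT t. indicator {a<..<R} t / sqrt (t - a)) = 2 * sqrt (R - a)"
proof -
  have d: "((\<lambda>t. 2 * sqrt (t - a)) has_real_derivative 1 / sqrt (t - a)) (at t)" if t: "ereal a < ereal t" for t
  proof -
    have "((\<lambda>t. sqrt (t - a)) has_real_derivative inverse (sqrt (t - a)) / 2 * (1 - 0)) (at t)"
      by (rule DERIV_chain2[OF DERIV_real_sqrt DERIV_diff[OF DERIV_ident DERIV_const]]) (use t in simp)
    from DERIV_cmult[OF this, of 2] show ?thesis by (simp only: inverse_eq_divide) simp
  qed
  have c: "isCont (\<lambda>t. 1 / sqrt (t - a)) t" if "ereal a < ereal t" for t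
    by (intro continuous_intros) (use that in simp)
  have l: "(((\<lambda>t. 2 * sqrt (t - a)) \<circ> real_of_ereal) \<longlongrightarrow> 2 * sqrt (a - a)) (at_right (ereal a))"
    unfolding ereal_tendsto_simps by (intro tendsto_intros)
  have r: "(((\<lambda>t. 2 * sqrt (t - a)) \<circ> real_of_ereal) \<longlongrightarrow> 2 * sqrt (R - a)) (at_left (ereal R))"
    unfolding ereal_tendsto_simps by (intro tendsto_intros)
  have n: "AE t in lborel. ereal a < ereal t \<longrightarrow> ereal t < ereal R \<longrightarrow> 0 \<le> 1 / sqrt (t - a)"
    by (rule AE_I2) auto
  have R': "ereal a < ereal R" using R by simp
  note ftc = interval_integral_FTC_nonneg[OF R' d c n l r]
  show "integrable lborel (\<lambda>t. indicator {a<..<R} t / sqrt (t - a))"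
    using ftc(1) by (simp add: set_integrable_def)
  show "(LBINT t. indicator {a<..<R} t / sqrt (t - a)) = 2 * sqrt (R - a)"
    using ftc(2) R by (simp add: interval_lebesgue_integral_def set_lebesgue_integral_def)
qed

lemma integrable_inverse_sqrt_abs:
  fixes a T :: real
  shows "integrable lborel (\<lambda>t. indicator {-T..T} t / sqrt \<bar>t - a\<bar>)"
proof -
  \<comment> \<open>Exceeds |t - a| for all |t| \<le> T, so a translated and a reflected one-sided
    singularity together cover the interval.\<close>
  define R where "R = \<bar>T\<bar> + \<bar>a\<bar> + 1"
  have R: "0 < R" unfolding R_def by linarith
  note * = integrable_inverse_sqrt[OF R]
  have 1: "integrable lborel (\<lambda>t. indicator {0<..<R} (- a + 1 * t) / sqrt (- a + 1 * t - 0))"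
    by (rule lborel_integrable_real_affine[OF *]) simp
  have 2: "integrable lborel (\<lambda>t. indicator {0<..<R} (a + (-1) * t) / sqrt (a + (-1) * t - 0))"
    by (rule lborel_integrable_real_affine[OF *]) simp
  have "norm (indicator {-T..T} t / sqrt \<bar>t - a\<bar>) \<le>
      norm (indicator {0<..<R} (- a + 1 * t) / sqrt (- a + 1 * t - 0) +
            indicator {0<..<R} (a + (-1) * t) / sqrt (a + (-1) * t - 0))" for t
  proof (cases "t \<in> {-T..T}")
    case True
    hence "\<bar>t - a\<bar> < R" by (auto simp: R_def)
    thus ?thesis using True by (cases "t < a"; cases "t = a") (auto simp: indicator_def abs_if)
  next
    case False
    thus ?thesis by simp
  qed
  thus ?thesis
    by (intro Bochner_Integration.integrable_bound[OF Bochner_Integration.integrable_add[OF 1 2]]) auto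
qed

text \<open>Two applications of the removable singularity theorem to difference quotients. The
  cofactor is used to measure \<open>Q\<close> near its zeros at the turning points.\<close>

lemma holomorphic_factor_two_zeros:
  fixes f :: "complex \<Rightarrow> complex"
  assumes f: "f holomorphic_on UNIV" and z: "f a = 0" "f c = 0" "a \<noteq> c"
  obtains g where "g holomorphic_on UNIV" "\<And>z. f z = (z - a) * (z - c) * g z"
proof -
  define g1 where "g1 = (\<lambda>z. if z = a then deriv f a else (f z - f a) / (z - a))"
  define g where "g = (\<lambda>z. if z = c then deriv g1 c else (g1 z - g1 c) / (z - c))"
  have g1: "g1 holomorphic_on UNIV" unfolding g1_def by (rule pole_lemma_open[OF f]) simp
  have g: "g holomorphic_on UNIV" unfolding g_def by (rule pole_lemma_open[OF g1]) simp
  have 1: "f z = (z - a) * g1 z" for z using z by (auto simp: g1_def)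
  have "g1 c = 0" using z by (auto simp: g1_def)
  hence 2: "g1 z = (z - c) * g z" for z by (auto simp: g_def)
  show ?thesis by (rule that[OF g]) (use 1 2 in simp)
qed

context anharmonic
begin

definition strip :: "complex set" where "strip = {z. 0 < Im z \<and> Im z \<le> \<theta>}"

text \<open>The branch of 1 / sqrt Q whose cut is [0, infinity) in the Q-plane, the half-line
  avoided on the strip. Its imaginary part is never negative.\<close>

definition phi :: "real \<Rightarrow> complex \<Rightarrow> complex" where "phi x z = \<i> / csqrt (- Q x z)"

definition F :: "nat \<Rightarrow> real \<Rightarrow> complex \<Rightarrow> complex" where "F n x z = exp (of_nat n * z) * phi x z"

text \<open>The boundary value of \<open>Im (F n x z)\<close> on the real axis away from the turning
  points: exp (n t) / sqrt (- Q) where Q < 0, and zero where Q > 0.\<close>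

definition wt :: "nat \<Rightarrow> real \<Rightarrow> real \<Rightarrow> real" where
  "wt n x t = (if b t < x then exp (n * t - t / 2) / sqrt (x - b t) else 0)"

lemma convex_strip: "convex strip"
proof -
  have "strip = {z. Im z > 0} \<inter> {z. Im z \<le> \<theta>}" by (auto simp: strip_def)
  thus ?thesis by (simp add: convex_Int convex_halfspace_Im_gt convex_halfspace_Im_le)
qed

lemma Q_holomorphic: "Q x holomorphic_on A"
  unfolding Q_def [abs_def] by (intro holomorphic_intros)

lemma F_holomorphic: "x > \<rho> \<Longrightarrow> F n x holomorphic_on strip"
  unfolding F_def [abs_def] phi_def
  by (intro holomorphic_intros Q_holomorphic holomorphic_on_csqrt') (use Q_avoids in \<open>force simp: strip_def\<close>)+

lemma Q_nonzero: "x > \<rho> \<Longrightarrow> z \<in> strip \<Longrightarrow> Q x z \<noteq> 0"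
  using Q_avoids[of x z] by (auto simp: strip_def)

lemma norm_phi: "cmod (phi x z) = 1 / sqrt (cmod (Q x z))"
  by (simp add: phi_def norm_divide del: csqrt.simps)

lemma norm_F: "cmod (F n x z) = exp (n * Re z) / sqrt (cmod (Q x z))"
  by (simp add: F_def norm_mult norm_phi)

lemma phi_squared: "(phi x z)\<^sup>2 = 1 / Q x z"
  by (simp add: phi_def power_divide del: csqrt.simps)

text \<open>Half-angle formula for the real part of \<open>csqrt\<close>. In this form the imaginary
  part is continuous in Q \<noteq> 0, even across the positive axis where \<open>phi\<close> itself
  jumps.\<close>

lemma Im_phi: "Im (phi x z) = sqrt ((cmod (Q x z) - Re (Q x z)) / 2) / cmod (Q x z)"
proof -
  have "Im (phi x z) = Re (csqrt (- Q x z)) / (cmod (csqrt (- Q x z)))\<^sup>2"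
    by (simp add: phi_def Im_divide cmod_power2 del: csqrt.simps norm_csqrt)
  thus ?thesis by (simp add: norm_csqrt)
qed

text \<open>In the lower half-plane the branch of \<open>phi\<close> agrees with the principal one.
  This is the situation on the top line of the strip and at its left end.\<close>

lemma phi_eq_inverse_csqrt:
  assumes "Im (Q x z) < 0" shows "phi x z = 1 / csqrt (Q x z)"
  unfolding phi_def using assms by (subst csqrt_minus) (auto simp del: csqrt.simps)

text \<open>On the right exp ((1+\<alpha>) z) dominates \<open>Q\<close>, and \<alpha> > 1 makes the
  quotient decay even for n = 1. On the left Q tends to 1, so \<open>phi\<close> squared tends to 1;
  the branch must be identified to see that \<open>phi\<close> tends to +1, the limit subtracted
  when n = 0.\<close>

lemma F_tails:
  assumes x: "x > \<rho>" and n: "n \<le> 1"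
  obtains T c C where "0 < T" "0 < c" "0 < C"
    "\<forall>z\<in>strip. T \<le> Re z \<longrightarrow> cmod (F n x z) \<le> C * exp (- c * \<bar>Re z\<bar>)"
    "\<forall>z\<in>strip. Re z \<le> - T \<longrightarrow> cmod (F n x z - (if n = 0 then 1 else 0)) \<le> C * exp (- c * \<bar>Re z\<bar>)"
proof -
  have xp: "x > 0" using x rho_pos by simp
  \<comment> \<open>Beyond |t0| the left tail lies left of the minimum, where the sign of Im Q is
    known. With exp T \<ge> 2 (1 + x) the leading term wins on the right, and |Q - 1| \<le> 1/2 on
    the left.\<close>
  define T where "T = max \<bar>t0\<bar> (ln (2 * (1 + x)))"
  define C where "C = 2 * (1 + x)"
  \<comment> \<open>The decay rate is 1 on the left and (\<alpha> - 1) / 2 on the right in the worst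
    case n = 1.\<close>
  define c where "c = min 1 ((\<alpha> - 1) / 2)"
  have lnp: "0 < ln (2 * (1 + x))" using xp by simp
  have Tp: "0 < T" using lnp by (simp add: T_def)
  have c: "0 < c" "c \<le> 1" "c \<le> (\<alpha> - 1) / 2"
    using alpha_gt_1 unfolding c_def min_def by auto
  have C: "2 \<le> C" using xp by (simp add: C_def)
  have expT: "2 * (1 + x) \<le> exp T"
    using xp by (metis T_def exp_le_cancel_iff exp_ln max.cobounded2 mult_pos_pos zero_less_numeral add_pos_pos zero_less_one)
  have right: "cmod (F n x z) \<le> C * exp (- c * \<bar>Re z\<bar>)" if z: "z \<in> strip" "T \<le> Re z" for z
  proof -
    define t where "t = Re z"
    have t: "t \<ge> T" "t > 0" using z Tp by (auto simp: t_def)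
    have e1: "exp ((1 + \<alpha>) * t) = exp t * exp (\<alpha> * t)" by (simp add: algebra_simps flip: exp_add)
    have "2 * (1 + x) \<le> exp t" using expT t by (meson exp_le_cancel_iff order_trans)
    also have "exp t \<le> exp (\<alpha> * t)" using t alpha_gt_1 by simp
    finally have "exp t * (2 * (1 + x)) \<le> exp t * exp (\<alpha> * t)" by simp
    moreover have "1 \<le> exp t" using t by simp
    ultimately have e2: "x * exp t + 1 \<le> exp ((1 + \<alpha>) * t) / 2"
      unfolding e1 by (simp add: algebra_simps del: one_le_exp_iff)
    have "cmod (exp (of_real (1 + \<alpha>) * z)) \<le> cmod (Q x z) + cmod (of_real x * exp z) + cmod 1"
    proof -
      have "exp (of_real (1 + \<alpha>) * z) = Q x z + of_real x * exp z - 1" by (simp add: Q_def)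
      also have "cmod \<dots> \<le> cmod (Q x z) + cmod (of_real x * exp z) + cmod 1"
        by (meson add_mono norm_triangle_ineq norm_triangle_ineq4 order_refl order_trans)
      finally show ?thesis .
    qed
    hence "exp ((1 + \<alpha>) * t) \<le> cmod (Q x z) + x * exp t + 1"
      using xp by (simp add: norm_mult t_def)
    hence "exp ((1 + \<alpha>) * t) / 2 \<le> cmod (Q x z)" using e2 by simp
    hence "exp ((1 + \<alpha>) * t) / 4 \<le> cmod (Q x z)" by (simp add: field_simps) (smt (verit) exp_gt_zero)
    hence "sqrt (exp ((1 + \<alpha>) * t) / 4) \<le> sqrt (cmod (Q x z))" by simp
    moreover have "sqrt (exp ((1 + \<alpha>) * t) / 4) = exp ((1 + \<alpha>) * t / 2) / 2"
      by (rule real_sqrt_unique) (simp_all add: power_divide flip: exp_double)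
    ultimately have s: "exp ((1 + \<alpha>) * t / 2) / 2 \<le> sqrt (cmod (Q x z))" by simp
    have "cmod (F n x z) \<le> exp (n * t) / (exp ((1 + \<alpha>) * t / 2) / 2)"
      unfolding norm_F t_def[symmetric] by (rule divide_left_mono[OF s]) (use s in \<open>auto intro!: mult_pos_pos intro: less_le_trans[OF _ s]\<close>)
    also have "\<dots> = 2 * exp (n * t - (1 + \<alpha>) * t / 2)" by (simp add: exp_diff)
    also have "n * t - (1 + \<alpha>) * t / 2 \<le> - c * t"
    proof -
      have "n * t \<le> 1 * t" using n t by (intro mult_right_mono) auto
      moreover have "c * t \<le> (\<alpha> - 1) / 2 * t" using c t by (intro mult_right_mono) auto
      ultimately show ?thesis by (simp add: field_simps)
    qed
    finally have "cmod (F n x z) \<le> 2 * exp (- c * t)" by simp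
    also have "\<dots> \<le> C * exp (- c * t)" using C by simp
    finally show ?thesis using t by (simp add: t_def)
  qed
  have left: "cmod (F n x z - (if n = 0 then 1 else 0)) \<le> C * exp (- c * \<bar>Re z\<bar>)"
    if z: "z \<in> strip" "Re z \<le> - T" for z
  proof -
    define t where "t = Re z"
    have t: "t \<le> - T" "t < 0" using z Tp by (auto simp: t_def)
    have "t \<le> t0" using t by (simp add: T_def)
    have "exp t \<le> exp (- T)" using t by simp
    hence "exp t * (2 * (1 + x)) \<le> exp (- T) * exp T" using expT xp by (intro mult_mono) auto
    hence small: "(1 + x) * exp t \<le> 1 / 2" by (simp add: algebra_simps flip: exp_add)
    have "cmod (Q x z - 1) \<le> exp ((1 + \<alpha>) * t) + x * exp t"
      using norm_triangle_ineq4[of "exp (of_real (1 + \<alpha>) * z)" "of_real x * exp z"] xp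
      by (simp add: Q_def norm_mult t_def)
    also have "exp ((1 + \<alpha>) * t) \<le> exp t"
      using t alpha_gt_1 by (simp add: algebra_simps mult_nonneg_nonpos)
    finally have Q1: "cmod (Q x z - 1) \<le> (1 + x) * exp t" by (simp add: algebra_simps)
    have Qh: "1 / 2 \<le> cmod (Q x z)"
      using Q1 small norm_triangle_ineq2[of 1 "1 - Q x z"] by (simp add: norm_minus_commute)
    have ect: "exp t \<le> exp (- c * \<bar>t\<bar>)" using t c mult_right_mono_neg[of c 1 t] by simp
    have "cmod (F n x z - (if n = 0 then 1 else 0)) \<le> C * exp t"
    proof (cases "n = 0")
      case False
      hence "n = 1" using n by simp
      have "sqrt (1 / 4) \<le> sqrt (cmod (Q x z))" using Qh by (intro real_sqrt_le_mono) simp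
      hence "1 / 2 \<le> sqrt (cmod (Q x z))" by (simp add: real_sqrt_divide)
      hence "exp t / sqrt (cmod (Q x z)) \<le> exp t / (1 / 2)" by (intro divide_left_mono) auto
      also have "\<dots> \<le> C * exp t" using C by simp
      finally show ?thesis using \<open>n = 1\<close> by (simp add: norm_F t_def)
    next
      case True
      have psi: "0 < Im z" "Im z \<le> \<theta>" using z by (auto simp: strip_def)
      have sp: "0 < sin (Im z)" using psi theta_bounds by (simp add: sin_gt_zero)
      have e1: "exp ((1 + \<alpha>) * t) = exp t * exp (\<alpha> * t)" by (simp add: algebra_simps flip: exp_add)
      have "exp (\<alpha> * t) * sin ((1 + \<alpha>) * Im z) \<le> exp (\<alpha> * t) * ((1 + \<alpha>) * sin (Im z))"
        by (intro mult_left_mono sin_mult_le psi) simp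
      also have "\<dots> \<le> exp (\<alpha> * t0) * ((1 + \<alpha>) * sin (Im z))"
        using \<open>t \<le> t0\<close> alpha_gt_1 sp by (intro mult_right_mono) auto
      also have "\<dots> = \<rho> * sin (Im z)" by (simp add: rho_eq2 algebra_simps)
      also have "\<dots> < x * sin (Im z)" using x sp by simp
      finally have "exp t * (exp (\<alpha> * t) * sin ((1 + \<alpha>) * Im z)) < exp t * (x * sin (Im z))" by simp
      moreover have "Im (Q x z) = exp t * (exp (\<alpha> * t) * sin ((1 + \<alpha>) * Im z)) - exp t * (x * sin (Im z))"
        unfolding Im_Q t_def[symmetric] e1 by simp
      ultimately have "Im (Q x z) < 0" by linarith
      \<comment> \<open>A nonnegative real part keeps \<open>phi\<close> at distance at least 1 from
        -1, so |phi - 1| is bounded by |phi^2 - 1| = |Q - 1| / |Q|.\<close>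
      hence "Re (phi x z) \<ge> 0"
        by (simp add: phi_eq_inverse_csqrt Re_divide Re_csqrt sum_power2_ge_zero del: csqrt.simps)
      hence p1: "1 \<le> cmod (phi x z + 1)" using complex_Re_le_cmod[of "phi x z + 1"] by simp
      have "cmod (phi x z - 1) * 1 \<le> cmod (phi x z - 1) * cmod (phi x z + 1)"
        using p1 by (intro mult_left_mono) auto
      also have "\<dots> = cmod ((phi x z)\<^sup>2 - 1)" by (simp add: power2_eq_square algebra_simps flip: norm_mult)
      also have "\<dots> = cmod (Q x z - 1) / cmod (Q x z)"
        using Q_nonzero[OF x z(1)] by (simp add: phi_squared field_simps norm_minus_commute flip: norm_divide)
      also have "\<dots> \<le> (1 + x) * exp t / (1 / 2)"
        using Q1 Qh xp by (intro frac_le) auto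
      finally show ?thesis using True by (simp add: F_def C_def algebra_simps)
    qed
    also have "\<dots> \<le> C * exp (- c * \<bar>t\<bar>)" using C by (intro mult_left_mono[OF ect]) auto
    finally show ?thesis by (simp add: t_def)
  qed
  show ?thesis using Tp c C right left by (intro that[of T c C]) auto
qed

end

section \<open>Collapsing the contour\<close>

context anharmonic
begin

text \<open>At a turning point the derivative is exp t times that of \<open>b\<close>, which
  vanishes only at \<open>t0\<close>; so the real zeros of \<open>Q\<close> are simple when x >
  rho.\<close>

lemma Q_deriv_turning:
  assumes "b t = x"
  shows "(Q x has_field_derivative of_real (exp t * (\<alpha> * exp (\<alpha> * t) - exp (- t)))) (at (of_real t))"
proof -
  have "(Q x has_field_derivative (of_real (1 + \<alpha>) * exp (of_real (1 + \<alpha>) * of_real t) - of_real x * exp (of_real t)))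
      (at (of_real t))"
    unfolding Q_def [abs_def] by (auto intro!: derivative_eq_intros)
  moreover have "of_real (1 + \<alpha>) * exp (of_real (1 + \<alpha>) * of_real t) - of_real x * exp (of_real t :: complex)
      = of_real ((1 + \<alpha>) * exp ((1 + \<alpha>) * t) - x * exp t)"
    by (simp flip: exp_of_real)
  moreover have "(1 + \<alpha>) * exp ((1 + \<alpha>) * t) - x * exp t = exp t * (\<alpha> * exp (\<alpha> * t) - exp (- t))"
    by (simp add: assms[symmetric] b_def algebra_simps flip: exp_add)
  ultimately show ?thesis by simp
qed

text \<open>Divide out the two real zeros. The cofactor vanishes nowhere on a closed rectangle: not
  at the turning points because they are simple, not elsewhere on the real axis because b \<noteq> x
  there, not above it by \<open>Q_avoids\<close>. Its minimum modulus serves as the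
  constant.\<close>

lemma Q_lower_bound:
  assumes x: "x > \<rho>" and t12: "t1 < t0" "t0 < t2" "b t1 = x" "b t2 = x"
    "\<forall>t. b t = x \<longleftrightarrow> t = t1 \<or> t = t2"
  obtains \<kappa> where "\<kappa> > 0"
    "\<forall>z\<in>strip. \<bar>Re z\<bar> \<le> T \<longrightarrow> \<kappa> * \<bar>Re z - t1\<bar> * \<bar>Re z - t2\<bar> \<le> cmod (Q x z)"
proof -
  have "t1 \<noteq> t2" using t12 by simp
  obtain g where g: "g holomorphic_on UNIV"
    and Qg: "\<And>z. Q x z = (z - of_real t1) * (z - of_real t2) * g z"
    by (rule holomorphic_factor_two_zeros[OF Q_holomorphic, of x "of_real t1" "of_real t2"])
       (use t12 \<open>t1 \<noteq> t2\<close> in \<open>auto simp: Q_real\<close>)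
  \<comment> \<open>Unlike \<open>strip\<close>, this set contains its real edge and is bounded,
    hence compact.\<close>
  define K where "K = {z. \<bar>Re z\<bar> \<le> T \<and> 0 \<le> Im z \<and> Im z \<le> \<theta>}"
  have K: "compact K"
  proof -
    have "K = cbox (Complex (-T) 0) (Complex T \<theta>)"
      by (auto simp: K_def cbox_def Basis_complex_def)
    thus ?thesis by simp
  qed
  have gt: "g (of_real t) \<noteq> 0" if t: "t = t1 \<or> t = t2" for t
  proof
    assume 0: "g (of_real t) = 0"
    obtain g' where g': "(g has_field_derivative g') (at (of_real t))"
      using holomorphic_derivI[OF g] by auto
    have "((\<lambda>z. (z - of_real t1) * (z - of_real t2) * g z) has_field_derivative
        (1 * (of_real t - of_real t2) + 1 * (of_real t - of_real t1)) * g (of_real t)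
        + g' * ((of_real t - of_real t1) * (of_real t - of_real t2))) (at (of_real t))"
      using g' by (auto intro!: derivative_eq_intros simp: algebra_simps)
    moreover have "(1 * (of_real t - of_real t2) + 1 * (of_real t - of_real t1)) * g (of_real t)
        + g' * ((of_real t - of_real t1) * (of_real t - of_real t2)) = 0" using t 0 by auto
    moreover have "Q x = (\<lambda>z. (z - of_real t1) * (z - of_real t2) * g z)" using Qg by auto
    ultimately have "(Q x has_field_derivative 0) (at (of_real t))" by metis
    moreover have "b t = x" using t t12 by auto
    ultimately have "of_real (exp t * (\<alpha> * exp (\<alpha> * t) - exp (- t))) = (0 :: complex)"
      using Q_deriv_turning DERIV_unique by metis
    hence "t = t0" using b'_eq_0_iff[of t] by (simp del: of_real_mult of_real_diff)
    thus False using t t12 by auto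
  qed
  have gnz: "g z \<noteq> 0" if z: "z \<in> K" for z
  proof (cases "Im z = 0")
    case True
    hence zr: "z = of_real (Re z)" by (simp add: complex_eq_iff)
    show ?thesis
    proof (cases "Re z = t1 \<or> Re z = t2")
      case True thus ?thesis using gt zr by metis
    next
      case False
      hence "Q x (of_real (Re z)) \<noteq> 0" using t12(5) by (simp add: Q_real)
      thus ?thesis using Qg[of z] zr by auto
    qed
  next
    case False
    hence "z \<in> strip" using z by (auto simp: K_def strip_def)
    from Q_nonzero[OF x this] show ?thesis by (auto simp: Qg)
  qed
  show ?thesis
  proof (cases "K = {}")
    case True
    show ?thesis by (rule that[of 1]) (use True in \<open>auto simp: K_def strip_def\<close>)
  next
    case False
    have "continuous_on K (\<lambda>z. cmod (g z))"
      using holomorphic_on_imp_continuous_on[OF g] by (intro continuous_intros) (auto intro: continuous_on_subset)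
    from continuous_attains_inf[OF K False this] obtain w where w: "w \<in> K" "\<And>z. z \<in> K \<Longrightarrow> cmod (g w) \<le> cmod (g z)" by blast
    show ?thesis
    proof (rule that[of "cmod (g w)"])
      show "cmod (g w) > 0" using gnz w by simp
      show "\<forall>z\<in>strip. \<bar>Re z\<bar> \<le> T \<longrightarrow> cmod (g w) * \<bar>Re z - t1\<bar> * \<bar>Re z - t2\<bar> \<le> cmod (Q x z)"
      proof (intro ballI impI)
        fix z assume z: "z \<in> strip" "\<bar>Re z\<bar> \<le> T"
        hence "cmod (g w) \<le> cmod (g z)" using w by (auto simp: K_def strip_def)
        moreover have "\<bar>Re z - t1\<bar> \<le> cmod (z - of_real t1)" "\<bar>Re z - t2\<bar> \<le> cmod (z - of_real t2)"
          using abs_Re_le_cmod[of "z - of_real t1"] abs_Re_le_cmod[of "z - of_real t2"] by simp_all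
        ultimately have "cmod (g w) * \<bar>Re z - t1\<bar> * \<bar>Re z - t2\<bar> \<le> cmod (g z) * cmod (z - of_real t1) * cmod (z - of_real t2)"
          by (intro mult_mono) auto
        thus "cmod (g w) * \<bar>Re z - t1\<bar> * \<bar>Re z - t2\<bar> \<le> cmod (Q x z)"
          by (simp add: Qg norm_mult mult_ac)
      qed
    qed
  qed
qed

text \<open>The majorant is the sum of an exponential tail and one inverse square root singularity
  at each turning point. Taking imaginary parts removes the limit 1 at the left end when n =
  0.\<close>

lemma Im_F_dominated:
  assumes x: "x > \<rho>" and n: "n \<le> 1"
  obtains D where "integrable lborel D"
    "AE t in lborel. \<forall>\<psi>. 0 < \<psi> \<and> \<psi> \<le> \<theta> \<longrightarrow> \<bar>Im (F n x (Complex t \<psi>))\<bar> \<le> D t"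
proof -
  obtain t1 t2 where t12: "t1 < t0" "t0 < t2" "b t1 = x" "b t2 = x"
    "\<forall>t. b t = x \<longleftrightarrow> t = t1 \<or> t = t2" by (rule turning_points[OF x]) (rule that)
  obtain T c C where T: "0 < T" "0 < c" "0 < C"
    "\<forall>z\<in>strip. T \<le> Re z \<longrightarrow> cmod (F n x z) \<le> C * exp (- c * \<bar>Re z\<bar>)"
    "\<forall>z\<in>strip. Re z \<le> - T \<longrightarrow> cmod (F n x z - (if n = 0 then 1 else 0)) \<le> C * exp (- c * \<bar>Re z\<bar>)"
    by (rule F_tails[OF x n]) (rule that)
  obtain \<kappa> where k: "\<kappa> > 0"
    "\<forall>z\<in>strip. \<bar>Re z\<bar> \<le> T \<longrightarrow> \<kappa> * \<bar>Re z - t1\<bar> * \<bar>Re z - t2\<bar> \<le> cmod (Q x z)"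
    by (rule Q_lower_bound[OF x t12]) (rule that)
  define d where "d = (t2 - t1) / 2"
  have d: "d > 0" using t12 by (simp add: d_def)
  define B where "B = exp T / sqrt (\<kappa> * d)"
  define D where "D = (\<lambda>t. C * exp (- c * \<bar>t\<bar>) + B * (indicator {-T..T} t / sqrt \<bar>t - t1\<bar>)
      + B * (indicator {-T..T} t / sqrt \<bar>t - t2\<bar>))"
  have "integrable lborel D" unfolding D_def
    by (rule Bochner_Integration.integrable_add[OF Bochner_Integration.integrable_add
          [OF integrable_mult_right[OF integrable_exp_neg_abs[OF T(2)]]
              integrable_mult_right[OF integrable_inverse_sqrt_abs]]
          integrable_mult_right[OF integrable_inverse_sqrt_abs]])
  moreover have bound: "\<bar>Im (F n x (Complex t \<psi>))\<bar> \<le> D t" if ps: "0 < \<psi>" "\<psi> \<le> \<theta>" and ne: "t \<noteq> t1" "t \<noteq> t2" for t \<psi>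
  proof -
    define z where "z = Complex t \<psi>"
    have z: "z \<in> strip" "Re z = t" using ps by (auto simp: z_def strip_def)
    have B: "0 \<le> B" using k d by (simp add: B_def)
    consider "T \<le> t" | "t \<le> - T" | "\<bar>t\<bar> \<le> T" by linarith
    hence "\<bar>Im (F n x z)\<bar> \<le> D t"
    proof cases
      case 1
      have "\<bar>Im (F n x z)\<bar> \<le> C * exp (- c * \<bar>t\<bar>)"
        using bspec[OF T(4) z(1)] 1 z abs_Im_le_cmod[of "F n x z"] by simp
      also have "\<dots> \<le> D t" using B by (simp add: D_def)
      finally show ?thesis .
    next
      case 2
      have "\<bar>Im (F n x z)\<bar> = \<bar>Im (F n x z - (if n = 0 then 1 else 0))\<bar>" by simp
      also have "\<dots> \<le> C * exp (- c * \<bar>t\<bar>)"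
        by (rule order_trans[OF abs_Im_le_cmod mp[OF bspec[OF T(5) z(1), unfolded z(2)] 2]])
      also have "\<dots> \<le> D t" using B by (simp add: D_def)
      finally show ?thesis .
    next
      case 3
      define u where "u = \<bar>t - t1\<bar>"
      define v where "v = \<bar>t - t2\<bar>"
      have uv: "u > 0" "v > 0" using ne by (simp_all add: u_def v_def)
      have duv: "d \<le> u \<or> d \<le> v"
        using abs_ge_self[of "t - t1"] abs_ge_minus_self[of "t - t2"] unfolding u_def v_def d_def by (smt (verit) field_sum_of_halves)
      have lb: "\<kappa> * u * v \<le> cmod (Q x z)" using bspec[OF k(2) z(1)] 3 z by (simp add: u_def v_def)
      \<comment> \<open>Here \<open>w\<close> is the distance to one turning point. The distance to
        the other is at least \<open>d\<close>, half the gap between them, and goes into the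
        constant.\<close>
      have half: "1 / sqrt (cmod (Q x z)) \<le> 1 / sqrt (\<kappa> * d) / sqrt w" if w: "0 < w" "\<kappa> * d * w \<le> cmod (Q x z)" for w
      proof -
        have "1 / sqrt (cmod (Q x z)) \<le> 1 / sqrt (\<kappa> * d * w)"
        proof (rule divide_left_mono)
          show "sqrt (\<kappa> * d * w) \<le> sqrt (cmod (Q x z))" using w by simp
          have "0 < \<kappa> * d * w" using w k d by simp
          thus "0 < sqrt (cmod (Q x z)) * sqrt (\<kappa> * d * w)" using w(2)
            by (intro mult_pos_pos) (simp_all only: real_sqrt_gt_0_iff)
        qed simp
        thus ?thesis by (simp add: real_sqrt_mult)
      qed
      have "\<kappa> * d * v \<le> \<kappa> * u * v \<or> \<kappa> * d * u \<le> \<kappa> * u * v"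
        using duv uv k by (auto simp: mult_ac)
      hence "\<kappa> * d * v \<le> cmod (Q x z) \<or> \<kappa> * d * u \<le> cmod (Q x z)" using lb by linarith
      hence "1 / sqrt (cmod (Q x z)) \<le> 1 / sqrt (\<kappa> * d) / sqrt u + 1 / sqrt (\<kappa> * d) / sqrt v"
      proof
        assume "\<kappa> * d * v \<le> cmod (Q x z)"
        from half[OF uv(2) this] show ?thesis using uv k d by (simp add: add_increasing)
      next
        assume "\<kappa> * d * u \<le> cmod (Q x z)"
        from half[OF uv(1) this] show ?thesis using uv k d by (simp add: add_increasing2)
      qed
      moreover have "exp (n * t) \<le> exp T"
      proof -
        have "n * t \<le> T"
        proof -
          have "n = 0 \<or> n = 1" using n by auto
          thus ?thesis using 3 T(1) by auto
        qed
        thus ?thesis by simp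
      qed
      ultimately have "exp (n * t) * (1 / sqrt (cmod (Q x z))) \<le> exp T * (1 / sqrt (\<kappa> * d) / sqrt u + 1 / sqrt (\<kappa> * d) / sqrt v)"
        by (intro mult_mono) auto
      hence "cmod (F n x z) \<le> B / sqrt u + B / sqrt v"
        using z by (simp add: norm_F B_def distrib_left)
      also have "\<dots> \<le> D t" using 3 T by (simp add: D_def u_def v_def abs_le_iff)
      finally show ?thesis using abs_Im_le_cmod[of "F n x z"] by linarith
    qed
    thus ?thesis by (simp add: z_def)
  qed
  moreover have "AE t in lborel. t \<noteq> t1" "AE t in lborel. t \<noteq> t2" by (simp_all add: AE_lborel_singleton)
  hence "AE t in lborel. t \<noteq> t1 \<and> t \<noteq> t2" by simp
  hence "AE t in lborel. \<forall>\<psi>. 0 < \<psi> \<and> \<psi> \<le> \<theta> \<longrightarrow> \<bar>Im (F n x (Complex t \<psi>))\<bar> \<le> D t"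
    by (rule eventually_mono) (use bound in blast)
  ultimately show ?thesis by (intro that[of D])
qed

lemma Complex_in_strip: "0 < \<psi> \<Longrightarrow> \<psi> \<le> \<theta> \<Longrightarrow> Complex t \<psi> \<in> strip"
  by (simp add: strip_def)

lemma continuous_on_Complex_line [continuous_intros]:
  "continuous_on A f \<Longrightarrow> continuous_on A g \<Longrightarrow> continuous_on A (\<lambda>t. Complex (f t) (g t))"
  by (simp add: Complex_eq continuous_intros)

lemma F_line_continuous:
  assumes x: "x > \<rho>" and ps: "0 < \<psi>" "\<psi> \<le> \<theta>"
  shows "continuous_on A (\<lambda>t. F n x (Complex t \<psi>))"
proof -
  have "continuous_on strip (F n x)" using F_holomorphic[OF x] by (rule holomorphic_on_imp_continuous_on)
  thus ?thesis
    by (rule continuous_on_compose2) (auto intro!: continuous_intros Complex_in_strip ps)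
qed

lemma integrable_Im_F:
  assumes x: "x > \<rho>" and n: "n \<le> 1" and ps: "0 < \<psi>" "\<psi> \<le> \<theta>"
  shows "integrable lborel (\<lambda>t. Im (F n x (Complex t \<psi>)))"
proof -
  obtain D where D: "integrable lborel D"
    "AE t in lborel. \<forall>\<psi>. 0 < \<psi> \<and> \<psi> \<le> \<theta> \<longrightarrow> \<bar>Im (F n x (Complex t \<psi>))\<bar> \<le> D t"
    by (rule Im_F_dominated[OF x n]) (rule that)
  have "(\<lambda>t. Im (F n x (Complex t \<psi>))) \<in> borel_measurable borel"
    using F_line_continuous[OF x ps, of UNIV] by (intro borel_measurable_continuous_onI continuous_intros)
  hence m: "(\<lambda>t. Im (F n x (Complex t \<psi>))) \<in> borel_measurable lborel" by simp
  show ?thesis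
    by (rule Bochner_Integration.integrable_bound[OF D(1) m]) (rule eventually_mono[OF D(2)], use ps in force)
qed

text \<open>Cauchy's theorem for a long rectangle, phrased with a primitive on the convex strip:
  horizontal integrals are differences of primitive values. The right side vanishes in the limit,
  and the left side tends to i (\<theta> - \<psi>) when n = 0.\<close>

lemma contour_shift:
  assumes x: "x > \<rho>" and n: "n \<le> 1" and ps: "0 < \<psi>" "\<psi> \<le> \<theta>"
  shows "(LBINT t. Im (F n x (Complex t \<theta>))) =
         (LBINT t. Im (F n x (Complex t \<psi>))) - (if n = 0 then \<theta> - \<psi> else 0)"
proof -
  let ?J = "\<lambda>\<phi>. (LBINT t. Im (F n x (Complex t \<phi>)))"
  define \<delta> :: complex where "\<delta> = (if n = 0 then 1 else 0)"
  have hol: "F n x holomorphic_on strip" by (rule F_holomorphic[OF x])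
  obtain \<Phi> where \<Phi>: "\<And>z. z \<in> strip \<Longrightarrow> (\<Phi> has_field_derivative F n x z) (at z within strip)"
  proof (rule holomorphic_convex_primitive[OF convex_strip finite.emptyI])
    show "continuous_on strip (F n x)" by (rule holomorphic_on_imp_continuous_on[OF hol])
    show "F n x field_differentiable at z" if "z \<in> interior strip - {}" for z
      using that hol by (metis Diff_empty at_within_interior holomorphic_on_def interior_subset subsetD)
  qed blast
  let ?P = "\<lambda>r \<phi>. \<Phi> (Complex r \<phi>)"
  obtain T c C where T: "0 < T" "0 < c" "0 < C"
    "\<forall>z\<in>strip. T \<le> Re z \<longrightarrow> cmod (F n x z) \<le> C * exp (- c * \<bar>Re z\<bar>)"
    "\<forall>z\<in>strip. Re z \<le> - T \<longrightarrow> cmod (F n x z - (if n = 0 then 1 else 0)) \<le> C * exp (- c * \<bar>Re z\<bar>)"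
    by (rule F_tails[OF x n]) (rule that)
  have line: "(LBINT t. indicator {- real k..real k} t * Im (F n x (Complex t \<phi>)))
      = Im (?P (real k) \<phi>) - Im (?P (- real k) \<phi>)"
    if ph: "0 < \<phi>" "\<phi> \<le> \<theta>" for \<phi> and k :: nat
  proof -
    have "(LBINT t. indicator {- real k..real k} t *\<^sub>R Im (F n x (Complex t \<phi>)))
      = Im (?P (real k) \<phi>) - Im (?P (- real k) \<phi>)"
    proof (rule integral_FTC_atLeastAtMost)
      fix t assume "- real k \<le> t" "t \<le> real k"
      have "((\<lambda>t. Complex t \<phi>) has_vector_derivative 1) (at t within {- real k..real k})"
        unfolding Complex_eq by (auto intro!: derivative_eq_intros)
      moreover have "(\<Phi> has_field_derivative F n x (Complex t \<phi>)) (at (Complex t \<phi>) within (\<lambda>t. Complex t \<phi>) ` {- real k..real k})"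
        by (rule has_field_derivative_subset[OF \<Phi>[OF Complex_in_strip[OF ph]]]) (auto simp: strip_def ph)
      ultimately have "(\<Phi> \<circ> (\<lambda>t. Complex t \<phi>) has_vector_derivative 1 * F n x (Complex t \<phi>)) (at t within {- real k..real k})"
        by (rule field_vector_diff_chain_within)
      hence "((\<lambda>t. \<Phi> (Complex t \<phi>)) has_vector_derivative F n x (Complex t \<phi>)) (at t within {- real k..real k})"
        by (simp add: o_def)
      thus "((\<lambda>t. Im (\<Phi> (Complex t \<phi>))) has_vector_derivative Im (F n x (Complex t \<phi>))) (at t within {- real k..real k})"
        by (rule bounded_linear.has_vector_derivative[OF bounded_linear_Im])
    qed (auto intro!: continuous_intros F_line_continuous x ph)
    thus ?thesis by simp
  qed
  have lim: "(\<lambda>k::nat. Im (?P (real k) \<phi>) - Im (?P (- real k) \<phi>)) \<longlonglongrightarrow> ?J \<phi>"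
    if ph: "0 < \<phi>" "\<phi> \<le> \<theta>" for \<phi>
  proof -
    have I: "integrable lborel (\<lambda>t. Im (F n x (Complex t \<phi>)))" by (rule integrable_Im_F[OF x n ph])
    have "(\<lambda>k. \<integral>t. indicator {- real k..real k} t * Im (F n x (Complex t \<phi>)) \<partial>lborel) \<longlonglongrightarrow> ?J \<phi>"
    proof (rule integral_dominated_convergence[where w = "\<lambda>t. \<bar>Im (F n x (Complex t \<phi>))\<bar>"])
      show "AE t in lborel. (\<lambda>k. indicator {- real k..real k} t * Im (F n x (Complex t \<phi>))) \<longlonglongrightarrow> Im (F n x (Complex t \<phi>))"
      proof (rule AE_I2)
        fix t :: real
        obtain N :: nat where "\<bar>t\<bar> \<le> real N" using real_arch_simple by blast
        hence "eventually (\<lambda>k. indicator {- real k..real k} t * Im (F n x (Complex t \<phi>)) = Im (F n x (Complex t \<phi>))) sequentially"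
          by (intro eventually_sequentiallyI[of N]) (auto simp: indicator_def)
        thus "(\<lambda>k. indicator {- real k..real k} t * Im (F n x (Complex t \<phi>))) \<longlonglongrightarrow> Im (F n x (Complex t \<phi>))"
          by (rule tendsto_eventually)
      qed
    qed (use I in \<open>auto simp: indicator_def intro!: AE_I2\<close>)
    thus ?thesis by (simp add: line[OF ph])
  qed
  \<comment> \<open>Mean value inequality on a vertical side for the primitive minus e z, whose
    derivative F - e is small when e is the limit of F at that end.\<close>
  have side: "cmod (?P r \<theta> - ?P r \<psi> - e * \<i> * of_real (\<theta> - \<psi>)) \<le> B * \<theta>"
    if B: "\<And>z. z \<in> strip \<Longrightarrow> Re z = r \<Longrightarrow> cmod (F n x z - e) \<le> B" "0 \<le> B" for r B e
  proof -
    define S where "S = closed_segment (Complex r \<psi>) (Complex r \<theta>)"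
    have S: "z \<in> strip \<and> Re z = r" if "z \<in> S" for z
    proof -
      have "S \<subseteq> strip \<inter> ({z. Re z \<le> r} \<inter> {z. Re z \<ge> r})" unfolding S_def
        by (intro closed_segment_subset convex_Int convex_strip convex_halfspace_Re_le convex_halfspace_Re_ge)
           (use ps theta_bounds in \<open>auto simp: strip_def\<close>)
      thus ?thesis using that by force
    qed
    have "cmod ((?P r \<theta> - e * Complex r \<theta>) - (?P r \<psi> - e * Complex r \<psi>)) \<le> B * cmod (Complex r \<theta> - Complex r \<psi>)"
    proof (rule field_differentiable_bound[of S _ "\<lambda>z. F n x z - e"])
      fix z assume z: "z \<in> S"
      have "(\<Phi> has_field_derivative F n x z) (at z within S)"
        by (rule has_field_derivative_subset[OF \<Phi>]) (use S z in auto)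
      thus "((\<lambda>z. \<Phi> z - e * z) has_field_derivative F n x z - e) (at z within S)"
        by (auto intro!: derivative_eq_intros)
      show "cmod (F n x z - e) \<le> B" using B S[OF z] by auto
    qed (auto simp: S_def)
    also have "Complex r \<theta> - Complex r \<psi> = \<i> * of_real (\<theta> - \<psi>)" by (simp add: complex_eq_iff)
    also have "cmod (\<i> * of_real (\<theta> - \<psi>)) = \<theta> - \<psi>"
      using ps by (simp only: norm_mult norm_ii norm_of_real) simp
    also have "B * (\<theta> - \<psi>) \<le> B * \<theta>" using B(2) ps by (intro mult_left_mono) auto
    also have "(?P r \<theta> - e * Complex r \<theta>) - (?P r \<psi> - e * Complex r \<psi>)
       = ?P r \<theta> - ?P r \<psi> - e * (Complex r \<theta> - Complex r \<psi>)" by (simp add: algebra_simps)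
    also have "Complex r \<theta> - Complex r \<psi> = \<i> * of_real (\<theta> - \<psi>)" by (simp add: complex_eq_iff)
    finally show ?thesis by (simp add: mult.assoc)
  qed
  have e0: "(\<lambda>k::nat. C * exp (- c * real k) * \<theta>) \<longlonglongrightarrow> 0" using T(2) by real_asymp
  have R: "(\<lambda>k::nat. ?P (real k) \<theta> - ?P (real k) \<psi>) \<longlonglongrightarrow> 0"
  proof (rule Lim_null_comparison[OF _ e0])
    obtain N :: nat where N: "T \<le> real N" using real_arch_simple by blast
    show "\<forall>\<^sub>F k in sequentially. cmod (?P (real k) \<theta> - ?P (real k) \<psi>) \<le> C * exp (- c * real k) * \<theta>"
    proof (rule eventually_sequentiallyI[of N])
      fix k assume "N \<le> k"
      hence k: "T \<le> real k" using N by linarith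
      show "cmod (?P (real k) \<theta> - ?P (real k) \<psi>) \<le> C * exp (- c * real k) * \<theta>"
        using side[of "real k" 0 "C * exp (- c * real k)"] T k by force
    qed
  qed
  have L: "(\<lambda>k::nat. ?P (- real k) \<theta> - ?P (- real k) \<psi> - \<delta> * \<i> * of_real (\<theta> - \<psi>)) \<longlonglongrightarrow> 0"
  proof (rule Lim_null_comparison[OF _ e0])
    obtain N :: nat where N: "T \<le> real N" using real_arch_simple by blast
    show "\<forall>\<^sub>F k in sequentially. cmod (?P (- real k) \<theta> - ?P (- real k) \<psi> - \<delta> * \<i> * of_real (\<theta> - \<psi>)) \<le> C * exp (- c * real k) * \<theta>"
    proof (rule eventually_sequentiallyI[of N])
      fix k assume "N \<le> k"
      hence k: "T \<le> real k" using N by linarith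
      have "cmod (F n x z - \<delta>) \<le> C * exp (- c * real k)" if "z \<in> strip" "Re z = - real k" for z
        using bspec[OF T(5) that(1)] that(2) k unfolding \<delta>_def by simp
      thus "cmod (?P (- real k) \<theta> - ?P (- real k) \<psi> - \<delta> * \<i> * of_real (\<theta> - \<psi>)) \<le> C * exp (- c * real k) * \<theta>"
        using T by (intro side) auto
    qed
  qed
  have "(\<lambda>k::nat. (Im (?P (real k) \<theta>) - Im (?P (- real k) \<theta>))
         - (Im (?P (real k) \<psi>) - Im (?P (- real k) \<psi>))) \<longlonglongrightarrow> 0 - 0 - (if n = 0 then \<theta> - \<psi> else 0)"
  proof -
    have "(\<lambda>k::nat. Im (?P (real k) \<theta> - ?P (real k) \<psi>)
      - Im (?P (- real k) \<theta> - ?P (- real k) \<psi> - \<delta> * \<i> * of_real (\<theta> - \<psi>))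
      - (if n = 0 then \<theta> - \<psi> else 0)) \<longlonglongrightarrow> Im 0 - Im 0 - (if n = 0 then \<theta> - \<psi> else 0)"
      by (intro tendsto_intros R L)
    moreover have "Im (?P (real k) \<theta> - ?P (real k) \<psi>)
      - Im (?P (- real k) \<theta> - ?P (- real k) \<psi> - \<delta> * \<i> * of_real (\<theta> - \<psi>))
      - (if n = 0 then \<theta> - \<psi> else 0) = (Im (?P (real k) \<theta>) - Im (?P (- real k) \<theta>))
         - (Im (?P (real k) \<psi>) - Im (?P (- real k) \<psi>))" for k :: nat
      by (simp add: \<delta>_def)
    ultimately show ?thesis by (simp only: zero_complex.sel)
  qed
  moreover have "(\<lambda>k::nat. (Im (?P (real k) \<theta>) - Im (?P (- real k) \<theta>))
         - (Im (?P (real k) \<psi>) - Im (?P (- real k) \<psi>))) \<longlonglongrightarrow>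
       ?J \<theta> - ?J \<psi>"
    by (intro tendsto_diff lim ps) (use theta_bounds in auto)
  ultimately have "?J \<theta> - ?J \<psi> = 0 - 0 - (if n = 0 then \<theta> - \<psi> else 0)"
    using LIMSEQ_unique by blast
  thus ?thesis by simp
qed

text \<open>Letting the contour collapse onto the real axis: only the classically allowed region
  contributes to the imaginary part.\<close>

lemma Im_F_tendsto_wt:
  assumes x: "x > \<rho>" and t: "b t \<noteq> x" and s: "s \<longlonglongrightarrow> 0" and n: "n \<le> 1"
  shows "(\<lambda>k. Im (F n x (Complex t (s k)))) \<longlonglongrightarrow> wt n x t"
proof -
  define q where "q = exp t * (b t - x)"
  have q: "q \<noteq> 0" using t by (simp add: q_def)
  have "isCont (Q x) (Complex t 0)"
    using Q_holomorphic[of x UNIV] by (simp add: holomorphic_on_def field_differentiable_imp_continuous_at)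
  moreover have "(\<lambda>k. Complex t (s k)) \<longlonglongrightarrow> Complex t 0"
    by (intro tendsto_Complex tendsto_const s)
  ultimately have "(\<lambda>k. Q x (Complex t (s k))) \<longlonglongrightarrow> Q x (Complex t 0)"
    by (rule isCont_tendsto_compose)
  moreover have "Q x (Complex t 0) = of_real q" using Q_real[of x t] by (simp add: q_def complex_of_real_def)
  ultimately have Ql: "(\<lambda>k. Q x (Complex t (s k))) \<longlonglongrightarrow> of_real q" by simp
  \<comment> \<open>For q > 0 the argument of \<open>csqrt\<close> approaches its cut; the formula
    \<open>Im_phi\<close> passes to the limit regardless.\<close>
  have im: "(\<lambda>k. Im (phi x (Complex t (s k)))) \<longlonglongrightarrow> sqrt ((cmod (of_real q) - Re (of_real q)) / 2) / cmod (of_real q)"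
    unfolding Im_phi by (intro tendsto_intros Ql) (use q in auto)
  \<comment> \<open>No limit of the real part is needed: it is bounded, and its factor sin (n s)
    tends to 0.\<close>
  have re: "(\<lambda>k. sin (real n * s k) * Re (phi x (Complex t (s k)))) \<longlonglongrightarrow> 0"
  proof (rule Lim_null_comparison)
    show "\<forall>\<^sub>F k in sequentially. norm (sin (real n * s k) * Re (phi x (Complex t (s k)))) \<le>
       \<bar>sin (real n * s k)\<bar> * (1 / sqrt (cmod (Q x (Complex t (s k)))))"
      by (rule always_eventually) (auto simp: abs_mult norm_phi[symmetric] intro!: mult_left_mono abs_Re_le_cmod)
    have "(\<lambda>k. \<bar>sin (real n * s k)\<bar> * (1 / sqrt (cmod (Q x (Complex t (s k)))))) \<longlonglongrightarrow>
       \<bar>sin (real n * 0)\<bar> * (1 / sqrt (cmod (of_real q)))"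
      by (intro tendsto_intros Ql s) (use q in auto)
    thus "(\<lambda>k. \<bar>sin (real n * s k)\<bar> * (1 / sqrt (cmod (Q x (Complex t (s k)))))) \<longlonglongrightarrow> 0" by simp
  qed
  have "(\<lambda>k. exp (real n * t) * (cos (real n * s k) * Im (phi x (Complex t (s k))) + sin (real n * s k) * Re (phi x (Complex t (s k)))))
     \<longlonglongrightarrow> exp (real n * t) * (cos (real n * 0) * (sqrt ((cmod (of_real q) - Re (of_real q)) / 2) / cmod (of_real q)) + 0)"
    by (intro tendsto_intros im re s)
  moreover have "Im (F n x (Complex t \<psi>)) = exp (real n * t) * (cos (real n * \<psi>) * Im (phi x (Complex t \<psi>)) + sin (real n * \<psi>) * Re (phi x (Complex t \<psi>)))" for \<psi>
    by (simp add: F_def Re_exp Im_exp algebra_simps)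
  moreover have "exp (real n * t) * (cos (real n * 0) * (sqrt ((cmod (of_real q) - Re (of_real q)) / 2) / cmod (of_real q)) + 0) = wt n x t"
  proof (cases "b t < x")
    case True
    hence q0: "q < 0" by (simp add: q_def mult_pos_neg)
    have "sqrt ((cmod (of_real q) - Re (of_real q)) / 2) / cmod (of_real q) = sqrt (- q) / (- q)" using q0 by simp
    also have "\<dots> = 1 / sqrt (- q)" using sqrt_divide_self_eq[of "- q"] q0 by (simp only: inverse_eq_divide)
    also have "- q = (exp (t / 2))\<^sup>2 * (x - b t)" by (simp add: q_def algebra_simps flip: exp_double)
    also have "1 / sqrt \<dots> = 1 / exp (t / 2) / sqrt (x - b t)" by (simp add: real_sqrt_mult)
    finally show ?thesis using True by (simp add: wt_def exp_diff)
  next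
    case False
    hence "q > 0" using t by (simp add: q_def)
    thus ?thesis using False by (simp add: wt_def)
  qed
  ultimately show ?thesis by simp
qed

text \<open>Shift from the top line to heights \<open>s k\<close> tending to 0 and apply dominated
  convergence. Integrability of the limit weight comes from the same majorant.\<close>

lemma
  assumes x: "x > \<rho>" and n: "n \<le> 1"
  shows integrable_wt: "integrable lborel (wt n x)"
    and integral_F_theta: "(LBINT t. Im (F n x (Complex t \<theta>))) = (LBINT t. wt n x t) - (if n = 0 then \<theta> else 0)"
proof -
  obtain D where D: "integrable lborel D"
    "AE t in lborel. \<forall>\<psi>. 0 < \<psi> \<and> \<psi> \<le> \<theta> \<longrightarrow> \<bar>Im (F n x (Complex t \<psi>))\<bar> \<le> D t"
    by (rule Im_F_dominated[OF x n]) (rule that)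
  define s where "s = (\<lambda>k. \<theta> / real (Suc k))"
  have s: "0 < s k" "s k \<le> \<theta>" for k
    using theta_bounds by (auto simp: s_def field_simps)
  have s0: "s \<longlonglongrightarrow> 0" unfolding s_def by real_asymp
  obtain t1 t2 where t12: "\<forall>t. b t = x \<longleftrightarrow> t = t1 \<or> t = t2" by (rule turning_points[OF x]) (rule that)
  have meas: "(\<lambda>t. Im (F n x (Complex t (s k)))) \<in> borel_measurable lborel" for k
    using integrable_Im_F[OF x n s] by (rule borel_measurable_integrable)
  have wtm: "wt n x \<in> borel_measurable lborel"
    unfolding wt_def [abs_def] by measurable
  have lim: "AE t in lborel. (\<lambda>k. Im (F n x (Complex t (s k)))) \<longlonglongrightarrow> wt n x t"
  proof -
    have "AE t in lborel. t \<noteq> t1" "AE t in lborel. t \<noteq> t2" by (simp_all add: AE_lborel_singleton)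
    hence "AE t in lborel. b t \<noteq> x" by (auto simp: t12)
    thus ?thesis by (rule eventually_mono) (rule Im_F_tendsto_wt[OF x _ s0 n])
  qed
  have bd: "AE t in lborel. norm (Im (F n x (Complex t (s k)))) \<le> D t" for k
    using D(2) by (rule eventually_mono) (use s in auto)
  show "integrable lborel (wt n x)"
    by (rule integrable_dominated_convergence[OF wtm meas D(1) lim bd])
  have "(\<lambda>k. \<integral>t. Im (F n x (Complex t (s k))) \<partial>lborel) \<longlonglongrightarrow> (LBINT t. wt n x t)"
    by (rule integral_dominated_convergence[OF wtm meas D(1) lim bd])
  hence "(\<lambda>k. (LBINT t. Im (F n x (Complex t (s k)))) - (if n = 0 then \<theta> - s k else 0)) \<longlonglongrightarrow>
     (LBINT t. wt n x t) - (if n = 0 then \<theta> - 0 else 0)"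
    using tendsto_diff[OF tendsto_const s0, of \<theta>] by (cases "n = 0") (auto intro: tendsto_diff)
  hence "(\<lambda>k. \<integral>t. Im (F n x (Complex t \<theta>)) \<partial>lborel) \<longlonglongrightarrow> (LBINT t. wt n x t) - (if n = 0 then \<theta> - 0 else 0)"
    by (subst (asm) contour_shift[OF x n s, symmetric])
  thus "(LBINT t. Im (F n x (Complex t \<theta>))) = (LBINT t. wt n x t) - (if n = 0 then \<theta> else 0)"
    using LIMSEQ_unique[OF tendsto_const] by fastforce
qed

end

section \<open>Abel integrals of the kernel\<close>

lemma Im_of_real_mult: "Im (of_real r * z) = r * Im z"
  by simp

context anharmonic
begin

definition \<zeta> :: "real \<Rightarrow> complex" where "\<zeta> x = of_real x * cis \<theta>"

lemma Re_zeta: "Re (\<zeta> x) = x * cos \<theta>" and Im_zeta: "Im (\<zeta> x) = x * sin \<theta>"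
  by (simp_all add: \<zeta>_def)

lemma sin_theta_pos: "0 < sin \<theta>"
  using theta_bounds by (simp add: sin_gt_zero)

lemma cos_theta_sq: "(cos \<theta>)\<^sup>2 < 1"
proof -
  have "0 < (sin \<theta>)\<^sup>2" using sin_theta_pos by simp
  thus ?thesis using sin_cos_squared_add[of \<theta>] by linarith
qed

lemma zeta_dist_pos: "0 < x \<Longrightarrow> 0 < (y - x * cos \<theta>)\<^sup>2 + (x * sin \<theta>)\<^sup>2"
  using sin_theta_pos by (intro add_nonneg_pos) auto

text \<open>The denominator of the kernel is |y - \<zeta>|^2 up to y^2. For n = 1 the numerator y
  may be exchanged for \<zeta>, since y / (y - \<zeta>) and \<zeta> / (y - \<zeta>) differ by the
  real number 1.\<close>

lemma kernel_eq_Im: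
  assumes "0 < x" "0 < y" "n \<le> 1"
  shows "Kalpha \<alpha> (x / y) * y ^ n / y = Im (\<zeta> x ^ n / (of_real y - \<zeta> x)) / pi"
proof -
  define d where "d = (y - x * cos \<theta>)\<^sup>2 + (x * sin \<theta>)\<^sup>2"
  have d: "d > 0" unfolding d_def by (rule zeta_dist_pos[OF assms(1)])
  have d': "d = y\<^sup>2 + x\<^sup>2 - 2 * x * y * cos \<theta>"
    unfolding d_def using sin_cos_squared_add[of \<theta>] by (simp add: power2_eq_square algebra_simps) (simp add: algebra_simps flip: distrib_left)
  have "1 + (x / y)\<^sup>2 - 2 * (x / y) * cos \<theta> = d / y\<^sup>2" using assms by (simp add: d' field_simps power2_eq_square)
  hence K: "Kalpha \<alpha> (x / y) = sin \<theta> / pi * (x * y / d)"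
    using assms d by (simp add: Kalpha_def \<theta>_def[symmetric] power2_eq_square)
  have I: "Im (1 / (of_real y - \<zeta> x)) = x * sin \<theta> / d"
    by (simp add: Im_divide Re_zeta Im_zeta d_def)
  consider "n = 0" | "n = 1" using assms by linarith
  thus ?thesis
  proof cases
    case 1
    thus ?thesis using K I assms by (simp add: mult_ac)
  next
    case 2
    have "of_real y - \<zeta> x \<noteq> 0" using d by (auto simp: d_def complex_eq_iff Re_zeta Im_zeta)
    hence "\<zeta> x / (of_real y - \<zeta> x) = of_real y * (1 / (of_real y - \<zeta> x)) - 1" by (simp add: field_simps)
    hence "Im (\<zeta> x / (of_real y - \<zeta> x)) = y * Im (1 / (of_real y - \<zeta> x))"
      by (simp only: minus_complex.sel Im_of_real_mult) simp
    thus ?thesis using K I assms 2 by (simp add: mult_ac)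
  qed
qed

lemma kernel_nonneg: "0 \<le> x \<Longrightarrow> 0 \<le> Kalpha \<alpha> x"
proof -
  assume x: "0 \<le> x"
  have "0 < (1 - x * cos \<theta>)\<^sup>2 + (x * sin \<theta>)\<^sup>2 \<or> x = 0" using zeta_dist_pos[of x 1] x by force
  moreover have "(1 - x * cos \<theta>)\<^sup>2 + (x * sin \<theta>)\<^sup>2 = 1 + x\<^sup>2 - 2 * x * cos \<theta>"
    using sin_cos_squared_add[of \<theta>] by (simp add: power2_eq_square algebra_simps) (simp add: algebra_simps flip: distrib_left)
  ultimately have "0 \<le> 1 + x\<^sup>2 - 2 * x * cos \<theta>" by auto
  thus ?thesis using sin_theta_pos x by (simp add: Kalpha_def \<theta>_def[symmetric])
qed

text \<open>With s = sqrt (y - a) the integrand becomes rational with an explicit logarithmic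
  antiderivative, and the value is the difference of its boundary limits. Since the kernel is
  nonnegative, the same argument yields integrability.\<close>

lemma
  assumes x: "0 < x" and a: "0 < a" and n: "n \<le> 1"
  shows integrable_Abel: "integrable lborel (\<lambda>y. indicator {a<..} y * (Kalpha \<alpha> (x / y) * y ^ n / y / sqrt (y - a)))"
    and integral_Abel: "(LBINT y. indicator {a<..} y * (Kalpha \<alpha> (x / y) * y ^ n / y / sqrt (y - a)))
      = Im (\<zeta> x ^ n / csqrt (of_real a - \<zeta> x))"
proof -
  define \<beta> where "\<beta> = csqrt (of_real a - \<zeta> x)"
  define k where "k = \<zeta> x ^ n"
  \<comment> \<open>An antiderivative of 2 / (s^2 + \<beta>^2), an arctangent written with
    logarithms. Re \<beta> > 0 keeps both arguments off the cut for every real s.\<close>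
  define L where "L = (\<lambda>w. (Ln (w - \<i> * \<beta>) - Ln (w + \<i> * \<beta>)) / (\<i> * \<beta>))"
  define G where "G = (\<lambda>y. Im (k * L (of_real (sqrt (y - a)))) / pi)"
  define g where "g = (\<lambda>y. Im (k / (of_real y - \<zeta> x)) / pi / sqrt (y - a))"
  have Imz: "0 < Im (\<zeta> x)" using x sin_theta_pos by (simp add: Im_zeta)
  have b2: "\<beta>\<^sup>2 = of_real a - \<zeta> x" by (simp add: \<beta>_def del: csqrt.simps)
  have Reb: "0 < Re \<beta>"
  proof -
    have "Re \<beta> \<noteq> 0"
    proof
      assume "Re \<beta> = 0"
      hence "Im (\<beta>\<^sup>2) = 0" by (simp add: power2_eq_square)
      thus False using Imz b2 by simp
    qed
    moreover have "0 \<le> Re \<beta>" unfolding \<beta>_def by (rule Re_csqrt)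
    ultimately show ?thesis by simp
  qed
  have bnz: "\<beta> \<noteq> 0" using Reb by auto
  have nonpos: "of_real s - \<i> * \<beta> \<notin> \<real>\<^sub>\<le>\<^sub>0" "of_real s + \<i> * \<beta> \<notin> \<real>\<^sub>\<le>\<^sub>0" for s :: real
    using Reb by (auto simp: complex_nonpos_Reals_iff)
  have nz: "of_real s - \<i> * \<beta> \<noteq> 0" "of_real s + \<i> * \<beta> \<noteq> 0" for s :: real
    using Reb by (auto simp: complex_eq_iff)
  have yz: "of_real y - \<zeta> x \<noteq> 0" for y :: real using Imz by (auto simp: complex_eq_iff)
  have dL: "(L has_field_derivative 2 / ((of_real s)\<^sup>2 + \<beta>\<^sup>2)) (at (of_real s))" for s :: real
  proof -
    have "(L has_field_derivative (1 / (of_real s - \<i> * \<beta>) - 1 / (of_real s + \<i> * \<beta>)) / (\<i> * \<beta>)) (at (of_real s))"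
    proof -
      have "((\<lambda>w. Ln (w - \<i> * \<beta>)) has_field_derivative inverse (of_real s - \<i> * \<beta>) * (1 - 0)) (at (of_real s))"
        by (rule DERIV_chain2[OF has_field_derivative_Ln[OF nonpos(1)] DERIV_diff[OF DERIV_ident DERIV_const]])
      moreover have "((\<lambda>w. Ln (w + \<i> * \<beta>)) has_field_derivative inverse (of_real s + \<i> * \<beta>) * (1 + 0)) (at (of_real s))"
        by (rule DERIV_chain2[OF has_field_derivative_Ln[OF nonpos(2)] DERIV_add[OF DERIV_ident DERIV_const]])
      ultimately have "((\<lambda>w. (Ln (w - \<i> * \<beta>) - Ln (w + \<i> * \<beta>)) / (\<i> * \<beta>)) has_field_derivative
          (inverse (of_real s - \<i> * \<beta>) * (1 - 0) - inverse (of_real s + \<i> * \<beta>) * (1 + 0)) / (\<i> * \<beta>)) (at (of_real s))"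
        by (intro DERIV_cdivide DERIV_diff)
      thus ?thesis unfolding L_def by (simp only: inverse_eq_divide diff_zero add_0_right mult_1_right)
    qed
    moreover have "(1 / (of_real s - \<i> * \<beta>) - 1 / (of_real s + \<i> * \<beta>)) / (\<i> * \<beta>) = 2 / ((of_real s)\<^sup>2 + \<beta>\<^sup>2)"
    proof -
      have p: "(of_real s - \<i> * \<beta>) * (of_real s + \<i> * \<beta>) = (of_real s)\<^sup>2 + \<beta>\<^sup>2"
        by (simp add: algebra_simps power2_eq_square)
      have "1 / (of_real s - \<i> * \<beta>) - 1 / (of_real s + \<i> * \<beta>) = (2 * (\<i> * \<beta>)) / ((of_real s)\<^sup>2 + \<beta>\<^sup>2)"
        unfolding p[symmetric] using nz[of s] by (simp add: diff_frac_eq)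
      thus ?thesis using bnz by simp
    qed
    ultimately show ?thesis by simp
  qed
  have Gd: "(G has_real_derivative g y) (at y)" if y: "ereal a < ereal y" for y
  proof -
    define s where "s = sqrt (y - a)"
    have s: "s > 0" "s\<^sup>2 = y - a" using y by (auto simp: s_def)
    have "((\<lambda>t. sqrt (t - a)) has_real_derivative inverse (sqrt (y - a)) / 2 * (1 - 0)) (at y)"
      by (rule DERIV_chain2[OF DERIV_real_sqrt DERIV_diff[OF DERIV_ident DERIV_const]]) (use y in simp)
    hence "((\<lambda>y. of_real (sqrt (y - a)) :: complex) has_vector_derivative of_real (inverse s / 2)) (at y)"
      by (intro has_vector_derivative_of_real) (simp add: s_def has_real_derivative_iff_has_vector_derivative)
    moreover have "(L has_field_derivative 2 / ((of_real s)\<^sup>2 + \<beta>\<^sup>2)) (at (of_real (sqrt (y - a))))"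
      using dL[of s] by (simp add: s_def)
    ultimately have "(L \<circ> (\<lambda>y. of_real (sqrt (y - a))) has_vector_derivative of_real (inverse s / 2) * (2 / ((of_real s)\<^sup>2 + \<beta>\<^sup>2))) (at y)"
      by (rule field_vector_diff_chain_at)
    moreover have "(of_real s)\<^sup>2 + \<beta>\<^sup>2 = of_real y - \<zeta> x"
      unfolding b2 using s by (simp flip: of_real_power)
    moreover have "of_real (inverse s / 2) * (2 / (of_real y - \<zeta> x)) = of_real (1 / s) * (1 / (of_real y - \<zeta> x))"
      using s yz[of y] by (simp add: field_simps)
    ultimately have "((\<lambda>y. L (of_real (sqrt (y - a)))) has_vector_derivative of_real (1 / s) * (1 / (of_real y - \<zeta> x))) (at y)"
      by (simp add: o_def)
    from bounded_linear.has_vector_derivative[OF bounded_linear_compose[OF bounded_linear_Im bounded_linear_mult_right[of k]] this]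
    have "((\<lambda>y. Im (k * L (of_real (sqrt (y - a))))) has_real_derivative Im (k * (of_real (1 / s) * (1 / (of_real y - \<zeta> x))))) (at y)"
      by (simp add: has_real_derivative_iff_has_vector_derivative)
    from DERIV_cdivide[OF this, of pi]
    have "(G has_real_derivative Im (k * (of_real (1 / s) * (1 / (of_real y - \<zeta> x)))) / pi) (at y)"
      by (simp add: G_def)
    moreover have "k * (of_real (1 / s) * (1 / (of_real y - \<zeta> x))) = of_real (1 / s) * (k / (of_real y - \<zeta> x))" by simp
    ultimately show ?thesis by (simp only: Im_of_real_mult) (simp add: g_def s_def mult.commute)
  qed
  have gk: "g y = Kalpha \<alpha> (x / y) * y ^ n / y / sqrt (y - a)" if "a < y" for y
    using kernel_eq_Im[of x y n] that x a n by (simp add: g_def k_def)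
  have gc: "isCont g y" if "ereal a < ereal y" for y
    unfolding g_def by (intro continuous_intros) (use that yz in auto)
  have gn: "AE y in lborel. ereal a < ereal y \<longrightarrow> ereal y < \<infinity> \<longrightarrow> 0 \<le> g y"
  proof (rule AE_I2, intro impI)
    fix y :: real assume "ereal a < ereal y"
    thus "0 \<le> g y" using gk[of y] kernel_nonneg[of "x / y"] x a by simp
  qed
  have Ll: "((G \<circ> real_of_ereal) \<longlongrightarrow> - Im (k / \<beta>)) (at_right (ereal a))"
  proof -
    have c: "isCont L (of_real 0)" using dL[of 0] DERIV_isCont by blast
    have "((\<lambda>y. of_real (sqrt (y - a)) :: complex) \<longlongrightarrow> of_real (sqrt (a - a))) (at_right a)"
      by (intro tendsto_intros)
    hence "((\<lambda>y. L (of_real (sqrt (y - a)))) \<longlongrightarrow> L (of_real 0)) (at_right a)"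
      using isCont_tendsto_compose[OF c] by simp
    hence "(G \<longlongrightarrow> Im (k * L (of_real 0)) / pi) (at_right a)"
      unfolding G_def by (intro tendsto_intros) auto
    moreover have "L (of_real 0) = - of_real pi / \<beta>"
    proof -
      \<comment> \<open>The number i \<beta> lies in the upper half-plane because Re \<beta> > 0,
        which fixes the sign of the jump.\<close>
      have "Ln (- (\<i> * \<beta>)) = Ln (\<i> * \<beta>) - \<i> * pi"
        using Reb bnz by (subst Ln_minus) auto
      hence "L (of_real 0) = - (\<i> * of_real pi) / (\<i> * \<beta>)" by (simp add: L_def)
      thus ?thesis using bnz by simp
    qed
    moreover have "Im (k * (- of_real pi / \<beta>)) / pi = - Im (k / \<beta>)"
    proof -
      have "k * (- of_real pi / \<beta>) = of_real (- pi) * (k / \<beta>)" by simp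
      thus ?thesis by (simp only: Im_of_real_mult) simp
    qed
    ultimately show ?thesis unfolding ereal_tendsto_simps by (simp only:)
  qed
  have Lr: "((G \<circ> real_of_ereal) \<longlongrightarrow> 0) (at_left \<infinity>)"
  proof -
    have s: "filterlim (\<lambda>y. sqrt (y - a)) at_top at_top" by real_asymp
    have 1: "((\<lambda>s::real. (Ln (1 - \<i> * \<beta> * of_real (inverse s)) - Ln (1 + \<i> * \<beta> * of_real (inverse s))) / (\<i> * \<beta>)) \<longlongrightarrow>
        (Ln (1 - \<i> * \<beta> * of_real 0) - Ln (1 + \<i> * \<beta> * of_real 0)) / (\<i> * \<beta>)) at_top"
      by (intro tendsto_intros tendsto_inverse_0_at_top filterlim_ident) (auto simp: bnz)
    have "eventually (\<lambda>s. (Ln (1 - \<i> * \<beta> * of_real (inverse s)) - Ln (1 + \<i> * \<beta> * of_real (inverse s))) / (\<i> * \<beta>) = L (of_real s)) at_top"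
      using eventually_gt_at_top[of "0::real"]
    proof eventually_elim
      case (elim s)
      \<comment> \<open>Pulling the positive factor s out of both logarithms cancels Ln s and leaves
        two terms tending to Ln 1.\<close>
      have "of_real s - \<i> * \<beta> = of_real s * (1 - \<i> * \<beta> * of_real (inverse s))"
        "of_real s + \<i> * \<beta> = of_real s * (1 + \<i> * \<beta> * of_real (inverse s))" using elim by (simp_all add: field_simps)
      moreover from this have n1: "1 - \<i> * \<beta> * of_real (inverse s) \<noteq> 0" and n2: "1 + \<i> * \<beta> * of_real (inverse s) \<noteq> 0"
        using nz[of s] by (metis mult_zero_right)+
      ultimately have "Ln (of_real s - \<i> * \<beta>) = Ln (of_real s) + Ln (1 - \<i> * \<beta> * of_real (inverse s))"
        "Ln (of_real s + \<i> * \<beta>) = Ln (of_real s) + Ln (1 + \<i> * \<beta> * of_real (inverse s))"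
        using Ln_times_of_real[OF elim n1] Ln_times_of_real[OF elim n2] by (simp_all only:)
      thus ?case unfolding L_def by simp
    qed
    from tendsto_cong[THEN iffD1, OF this 1] have "((\<lambda>s. L (of_real s)) \<longlongrightarrow> 0) at_top" by simp
    from filterlim_compose[OF this s] have "((\<lambda>y. L (of_real (sqrt (y - a)))) \<longlongrightarrow> 0) at_top" .
    hence "(G \<longlongrightarrow> Im (k * 0) / pi) at_top" unfolding G_def by (intro tendsto_intros) auto
    thus ?thesis unfolding ereal_tendsto_simps by simp
  qed
  have ainf: "ereal a < \<infinity>" by simp
  note ftc = interval_integral_FTC_nonneg[OF ainf Gd gc gn Ll Lr]
  have eq: "indicator {a<..} y * (Kalpha \<alpha> (x / y) * y ^ n / y / sqrt (y - a)) = indicator {a<..} y *\<^sub>R g y" for y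
    using gk[of y] by (simp add: indicator_def)
  show "integrable lborel (\<lambda>y. indicator {a<..} y * (Kalpha \<alpha> (x / y) * y ^ n / y / sqrt (y - a)))"
    unfolding eq using ftc(1) by (simp add: set_integrable_def)
  show "(LBINT y. indicator {a<..} y * (Kalpha \<alpha> (x / y) * y ^ n / y / sqrt (y - a))) = Im (\<zeta> x ^ n / csqrt (of_real a - \<zeta> x))"
    unfolding eq using ftc(2) by (simp add: interval_lebesgue_integral_def set_lebesgue_integral_def k_def \<beta>_def del: csqrt.simps)
qed

lemma csqrt_scale:
  assumes "0 < r" shows "csqrt (of_real (r\<^sup>2) * w) = of_real r * csqrt w"
  using assms csqrt_principal[of w]
  by (intro csqrt_unique) (auto simp: power_mult_distrib simp del: csqrt.simps)

text \<open>Since (1+\<alpha>) \<theta> = 2 pi, \<open>Q\<close> on the top line equals exp t * (b t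
  - \<zeta> x), with negative imaginary part; so the value of the Abel integral at a = b t is the
  integrand on that line.\<close>

lemma F_theta:
  assumes x: "0 < x"
  shows "exp (real n * t - t / 2) * Im (\<zeta> x ^ n / csqrt (of_real (b t) - \<zeta> x)) = x ^ n * Im (F n x (Complex t \<theta>))"
proof -
  define c where "c = csqrt (of_real (b t) - \<zeta> x)"
  have at: "(1 + \<alpha>) * \<theta> = 2 * pi" by (rule alpha_theta)
  hence at': "\<theta> + \<alpha> * \<theta> = 2 * pi" by (simp add: algebra_simps)
  have Qeq: "Q x (Complex t \<theta>) = of_real ((exp (t / 2))\<^sup>2) * (of_real (b t) - \<zeta> x)"
    by (simp add: complex_eq_iff Re_Q Im_Q at at' b_def Re_zeta Im_zeta algebra_simps flip: exp_double exp_add)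
  have "Im (Q x (Complex t \<theta>)) < 0" using x sin_theta_pos by (simp add: Im_Q at)
  hence "phi x (Complex t \<theta>) = 1 / csqrt (Q x (Complex t \<theta>))" by (rule phi_eq_inverse_csqrt)
  also have "csqrt (Q x (Complex t \<theta>)) = of_real (exp (t / 2)) * c"
    unfolding Qeq c_def by (rule csqrt_scale) simp
  finally have ph: "phi x (Complex t \<theta>) = 1 / (of_real (exp (t / 2)) * c)" .
  have "exp (Complex t \<theta>) = of_real (exp t) * cis \<theta>"
    by (simp add: complex_eq_iff Re_exp Im_exp)
  hence "exp (of_nat n * Complex t \<theta>) = of_real (exp (n * t)) * cis \<theta> ^ n"
    by (simp only: exp_of_nat_mult power_mult_distrib of_real_power)
  hence "of_real (x ^ n) * F n x (Complex t \<theta>) = of_real (exp (real n * t) / exp (t / 2)) * (\<zeta> x ^ n / c)"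
    by (simp add: F_def ph \<zeta>_def power_mult_distrib)
  hence "Im (of_real (x ^ n) * F n x (Complex t \<theta>)) = Im (of_real (exp (real n * t) / exp (t / 2)) * (\<zeta> x ^ n / c))" by simp
  thus ?thesis by (simp only: Im_of_real_mult exp_diff c_def)
qed

end

section \<open>The integral equations for the moments\<close>

context anharmonic
begin

text \<open>\<open>mom 1\<close> and \<open>mom 0\<close> are the functions f and h of the
  overview.\<close>

definition mom :: "nat \<Rightarrow> real \<Rightarrow> real" where
  "mom n x = x ^ n / (4 * pi) * (LBINT t. wt n x t)"

text \<open>The contribution \<theta> of the left end of the strip, times the prefactor 1/(4 pi);
  for n = 0 it equals 1/(2(1+\<alpha>)).\<close>

definition mshift :: "nat \<Rightarrow> real" where
  "mshift n = (if n = 0 then \<theta> / (4 * pi) else 0)"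

text \<open>Extension by zero gives an integrand on the whole line, suited to scaling. The lower
  limit of the equation is imposed separately, by letting u vanish below it.\<close>

definition ker :: "real \<Rightarrow> (real \<Rightarrow> real) \<Rightarrow> real \<Rightarrow> real" where
  "ker x u y = indicator {0<..} y * (Kalpha \<alpha> (x / y) * u y / y)"

lemma wt_nonneg: "0 \<le> wt n x t"
  by (simp add: wt_def)

lemma wt_zero: "x \<le> \<rho> \<Longrightarrow> wt n x t = 0"
  using b_ge_rho[of t] by (simp add: wt_def)

lemma mom_zero: "x \<le> \<rho> \<Longrightarrow> mom n x = 0"
  by (simp add: mom_def wt_zero)

lemma mom_nonneg: "0 \<le> x \<Longrightarrow> 0 \<le> mom n x"
  by (simp add: mom_def wt_nonneg)

lemma wt_measurable_pair [measurable]: "(\<lambda>p. wt n (fst p) (snd p)) \<in> borel_measurable (borel \<Otimes>\<^sub>M borel)"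
  unfolding wt_def by measurable

lemma mom_measurable [measurable]: "mom n \<in> borel_measurable borel"
proof -
  have [measurable]: "(\<lambda>p. wt n (fst p) (snd p)) \<in> borel_measurable (borel \<Otimes>\<^sub>M lborel)"
    by (simp cong: measurable_cong_sets sets_pair_measure_cong)
  have "(\<lambda>x. \<integral>t. wt n (fst (x, t)) (snd (x, t)) \<partial>lborel) \<in> borel_measurable borel"
    by (rule lborel.borel_measurable_lebesgue_integral) (simp add: case_prod_beta)
  thus ?thesis unfolding mom_def [abs_def] by simp
qed

lemma Kalpha_measurable [measurable]: "Kalpha \<alpha> \<in> borel_measurable borel"
  unfolding Kalpha_def [abs_def] by measurable

lemma ker_nonneg: "0 < x \<Longrightarrow> (\<And>y. 0 < y \<Longrightarrow> 0 \<le> u y) \<Longrightarrow> 0 \<le> ker x u y"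
  by (auto simp: ker_def indicator_def intro!: divide_nonneg_nonneg mult_nonneg_nonneg kernel_nonneg)

lemma ennreal_integral_wt:
  assumes "n \<le> 1" shows "ennreal (LBINT t. wt n y t) = (\<integral>\<^sup>+t. ennreal (wt n y t) \<partial>lborel)"
proof (cases "y > \<rho>")
  case True
  show ?thesis using integrable_wt[OF True assms] by (subst nn_integral_eq_integral) (auto simp: wt_nonneg)
qed (simp add: wt_zero)

text \<open>Working with nonnegative extended reals lets Tonelli exchange the integrals before
  anything is known to be integrable. The inner integral is the Abel integral, the outer one the
  integral along the top line.\<close>

lemma nn_integral_ker_mom:
  assumes x: "x > \<rho>" and n: "n \<le> 1"
  shows "(\<integral>\<^sup>+y. ennreal (ker x (mom n) y) \<partial>lborel) = ennreal (mom n x - mshift n)"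
    and "0 \<le> mom n x - mshift n"
proof -
  have xp: "x > 0" using x rho_pos by simp
  define c where "c = (\<lambda>y. indicator {0<..} y * (Kalpha \<alpha> (x / y) * y ^ n / y / (4 * pi)))"
  have c0: "0 \<le> c y" for y using xp
    by (auto simp: c_def indicator_def intro!: divide_nonneg_nonneg mult_nonneg_nonneg kernel_nonneg)
  have [measurable]: "c \<in> borel_measurable borel" unfolding c_def [abs_def] by measurable
  have m: "(\<lambda>(t, y). ennreal (c y * wt n y t)) \<in> borel_measurable (lborel \<Otimes>\<^sub>M lborel)"
  proof -
    have "(\<lambda>p. ennreal (c (snd p) * wt n (snd p) (fst p))) \<in> borel_measurable (borel \<Otimes>\<^sub>M borel)"
      unfolding wt_def by measurable
    thus ?thesis by (simp add: case_prod_beta cong: measurable_cong_sets sets_pair_measure_cong)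
  qed
  have "ennreal (ker x (mom n) y) = (\<integral>\<^sup>+t. ennreal (c y * wt n y t) \<partial>lborel)" for y
  proof -
    have "ker x (mom n) y = c y * (LBINT t. wt n y t)"
      by (simp add: ker_def c_def mom_def mult_ac)
    hence "ennreal (ker x (mom n) y) = ennreal (c y) * ennreal (LBINT t. wt n y t)"
      using c0[of y] by (simp add: ennreal_mult')
    also have "\<dots> = (\<integral>\<^sup>+t. ennreal (c y) * ennreal (wt n y t) \<partial>lborel)"
      unfolding ennreal_integral_wt[OF n] by (subst nn_integral_cmult) (auto simp: wt_def [abs_def])
    finally show ?thesis using c0[of y] by (simp add: ennreal_mult')
  qed
  hence "(\<integral>\<^sup>+y. ennreal (ker x (mom n) y) \<partial>lborel) = (\<integral>\<^sup>+y. \<integral>\<^sup>+t. ennreal (c y * wt n y t) \<partial>lborel \<partial>lborel)" by simp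
  also have "\<dots> = (\<integral>\<^sup>+t. \<integral>\<^sup>+y. ennreal (c y * wt n y t) \<partial>lborel \<partial>lborel)"
    by (rule lborel_pair.Fubini'[OF m])
  also have "\<dots> = (\<integral>\<^sup>+t. ennreal (x ^ n / (4 * pi) * Im (F n x (Complex t \<theta>))) \<partial>lborel)"
  proof (rule nn_integral_cong)
    fix t
    define e where "e = exp (real n * t - t / 2) / (4 * pi)"
    have e: "0 \<le> e" by (simp add: e_def)
    define A where "A = (\<lambda>y. indicator {b t<..} y * (Kalpha \<alpha> (x / y) * y ^ n / y / sqrt (y - b t)))"
    have IA: "integrable lborel A" unfolding A_def by (rule integrable_Abel[OF xp b_pos n])
    have IA2: "integral\<^sup>L lborel A = Im (\<zeta> x ^ n / csqrt (of_real (b t) - \<zeta> x))"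
      unfolding A_def by (rule integral_Abel[OF xp b_pos n])
    have A0: "0 \<le> A y" for y using xp b_pos[of t]
      by (auto simp: A_def indicator_def intro!: divide_nonneg_nonneg mult_nonneg_nonneg kernel_nonneg)
    have "c y * wt n y t = e * A y" for y
      using b_pos[of t] by (auto simp: c_def wt_def A_def e_def indicator_def mult_ac)
    hence "(\<integral>\<^sup>+y. ennreal (c y * wt n y t) \<partial>lborel) = (\<integral>\<^sup>+y. ennreal (e * A y) \<partial>lborel)" by simp
    also have "\<dots> = ennreal (LBINT y. e * A y)"
      by (rule nn_integral_eq_integral[OF integrable_mult_right[OF IA]]) (use e A0 in auto)
    also have "(LBINT y. e * A y) = e * Im (\<zeta> x ^ n / csqrt (of_real (b t) - \<zeta> x))"
      unfolding integral_mult_right_zero IA2 ..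
    also have "\<dots> = x ^ n / (4 * pi) * Im (F n x (Complex t \<theta>))"
      using F_theta[OF xp, of n t] by (simp add: e_def del: csqrt.simps)
    finally show "(\<integral>\<^sup>+y. ennreal (c y * wt n y t) \<partial>lborel) = ennreal (x ^ n / (4 * pi) * Im (F n x (Complex t \<theta>)))" .
  qed
  finally have 1: "(\<integral>\<^sup>+y. ennreal (ker x (mom n) y) \<partial>lborel) = (\<integral>\<^sup>+t. ennreal (x ^ n / (4 * pi) * Im (F n x (Complex t \<theta>))) \<partial>lborel)" .
  \<comment> \<open>The factor exp (n z) rotates \<open>phi\<close>, so the sign is read off from
    the Abel integral of a nonnegative integrand.\<close>
  have nn: "0 \<le> x ^ n / (4 * pi) * Im (F n x (Complex t \<theta>))" for t
  proof -
    have "0 \<le> (LBINT y. indicator {b t<..} y * (Kalpha \<alpha> (x / y) * y ^ n / y / sqrt (y - b t)))"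
      using xp b_pos[of t]
      by (intro integral_nonneg_AE AE_I2) (auto simp: indicator_def intro!: divide_nonneg_nonneg mult_nonneg_nonneg kernel_nonneg)
    hence "0 \<le> exp (real n * t - t / 2) * Im (\<zeta> x ^ n / csqrt (of_real (b t) - \<zeta> x))"
      unfolding integral_Abel[OF xp b_pos n] by simp
    hence "0 \<le> x ^ n * Im (F n x (Complex t \<theta>))" by (simp only: F_theta[OF xp])
    thus ?thesis by simp
  qed
  have I: "integrable lborel (\<lambda>t. x ^ n / (4 * pi) * Im (F n x (Complex t \<theta>)))"
    using integrable_Im_F[OF x n, of \<theta>] theta_bounds by simp
  have 2: "(LBINT t. x ^ n / (4 * pi) * Im (F n x (Complex t \<theta>))) = mom n x - mshift n"
    using integral_F_theta[OF x n] by (auto simp: mom_def mshift_def right_diff_distrib diff_divide_distrib)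
  show "(\<integral>\<^sup>+y. ennreal (ker x (mom n) y) \<partial>lborel) = ennreal (mom n x - mshift n)"
    unfolding 1 2[symmetric] by (rule nn_integral_eq_integral[OF I]) (use nn in auto)
  show "0 \<le> mom n x - mshift n"
    unfolding 2[symmetric] by (rule integral_nonneg_AE) (use nn in auto)
qed

lemma
  assumes x: "x > \<rho>" and n: "n \<le> 1"
  shows integrable_ker_mom: "integrable lborel (ker x (mom n))"
    and integral_ker_mom: "(LBINT y. ker x (mom n) y) = mom n x - mshift n"
proof -
  have xp: "x > 0" using x rho_pos by simp
  have nn: "0 \<le> ker x (mom n) y" for y by (rule ker_nonneg[OF xp mom_nonneg]) simp
  have m: "ker x (mom n) \<in> borel_measurable lborel" unfolding ker_def [abs_def] by measurable
  show I: "integrable lborel (ker x (mom n))"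
    by (rule integrableI_nonneg[OF m]) (use nn nn_integral_ker_mom(1)[OF x n] in auto)
  show "(LBINT y. ker x (mom n) y) = mom n x - mshift n"
    using nn_integral_eq_integral[OF I] nn nn_integral_ker_mom[OF x n]
    by (simp add: integral_nonneg_AE)
qed

end

section \<open>Harnack bounds for the kernel\<close>

context anharmonic
begin

text \<open>The denominator lies between (1 - |cos \<theta>|) (x^2 + y^2) and 2 (x^2 + y^2), so the
  kernel is comparable to one without an angle.\<close>

lemma Kalpha_bounds:
  obtains C where "0 < C"
    "\<forall>x>0. \<forall>y>0. Kalpha \<alpha> (x / y) \<le> C * (x * y / (x\<^sup>2 + y\<^sup>2))"
    "\<forall>x>0. \<forall>y>0. x * y / (x\<^sup>2 + y\<^sup>2) \<le> C * Kalpha \<alpha> (x / y)"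
proof -
  define \<gamma> where "\<gamma> = 1 - \<bar>cos \<theta>\<bar>"
  have g: "\<gamma> > 0" using cos_theta_sq abs_square_less_1[of "cos \<theta>"] by (simp add: \<gamma>_def)
  define C where "C = max (sin \<theta> / (pi * \<gamma>)) (2 * pi / sin \<theta>)"
  have C: "sin \<theta> / (pi * \<gamma>) \<le> C" "2 * pi / sin \<theta> \<le> C" unfolding C_def by (rule max.cobounded1, rule max.cobounded2)
  have "0 < 2 * pi / sin \<theta>" using sin_theta_pos by simp
  hence Cp: "0 < C" using C by linarith
  have main: "Kalpha \<alpha> (x / y) \<le> C * (x * y / (x\<^sup>2 + y\<^sup>2)) \<and> x * y / (x\<^sup>2 + y\<^sup>2) \<le> C * Kalpha \<alpha> (x / y)"
    if xy: "0 < x" "0 < y" for x y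
  proof -
    define s where "s = x\<^sup>2 + y\<^sup>2"
    define d where "d = y\<^sup>2 + x\<^sup>2 - 2 * x * y * cos \<theta>"
    have s: "s > 0" using xy by (simp add: s_def add_pos_pos)
    have xy2: "2 * x * y \<le> s" using sum_squares_bound[of x y] by (simp add: s_def)
    have ab: "\<bar>2 * x * y * cos \<theta>\<bar> \<le> s * \<bar>cos \<theta>\<bar>"
      using mult_right_mono[OF xy2, of "\<bar>cos \<theta>\<bar>"] xy by (simp add: abs_mult)
    have dl: "\<gamma> * s \<le> d" using ab unfolding d_def \<gamma>_def s_def by (simp add: algebra_simps abs_le_iff)
    have "s * \<bar>cos \<theta>\<bar> \<le> s * 1" using s by (intro mult_left_mono) auto
    moreover have "d = s - 2 * x * y * cos \<theta>" by (simp add: d_def s_def)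
    ultimately have du: "d \<le> 2 * s" using ab by linarith
    have dp: "d > 0" using dl g s by (smt (verit) mult_pos_pos)
    have "1 + (x / y)\<^sup>2 - 2 * (x / y) * cos \<theta> = d / y\<^sup>2" using xy by (simp add: d_def field_simps power2_eq_square)
    hence K: "Kalpha \<alpha> (x / y) = sin \<theta> / pi * (x * y / d)"
      using xy dp by (simp add: Kalpha_def \<theta>_def[symmetric] power2_eq_square)
    have p: "0 < x * y" using xy by simp
    have "x * y / d \<le> x * y / (\<gamma> * s)" using dl dp g s p by (intro divide_left_mono) auto
    hence "Kalpha \<alpha> (x / y) \<le> sin \<theta> / pi * (x * y / (\<gamma> * s))"
      unfolding K using sin_theta_pos by (intro mult_left_mono) auto
    also have "\<dots> = sin \<theta> / (pi * \<gamma>) * (x * y / s)" by simp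
    also have "\<dots> \<le> C * (x * y / s)" using C(1) p s by (intro mult_right_mono) auto
    finally have 1: "Kalpha \<alpha> (x / y) \<le> C * (x * y / s)" .
    have "x * y / (2 * s) \<le> x * y / d" using du dp s p by (intro divide_left_mono) auto
    hence "sin \<theta> / pi * (x * y / (2 * s)) \<le> Kalpha \<alpha> (x / y)"
      unfolding K using sin_theta_pos by (intro mult_left_mono) auto
    hence "2 * pi / sin \<theta> * (sin \<theta> / pi * (x * y / (2 * s))) \<le> C * Kalpha \<alpha> (x / y)"
      using C(2) Cp sin_theta_pos p s by (intro mult_mono) auto
    moreover have "2 * pi / sin \<theta> * (sin \<theta> / pi * (x * y / (2 * s))) = x * y / s" using sin_theta_pos by simp
    ultimately show ?thesis using 1 by (simp add: s_def)
  qed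
  show ?thesis by (rule that[OF Cp]) (use main in blast)+
qed

text \<open>For x in a compact interval the model kernels differ by the factor x / x0 and a ratio of
  quadratics, both bounded uniformly in y. Integrability at one point thereby gives a locally
  uniform majorant.\<close>

lemma kernel_Harnack:
  assumes "0 < m" "0 < x0"
  obtains C where "0 < C" "\<forall>x. \<forall>y>0. m \<le> x \<and> x \<le> M \<longrightarrow> Kalpha \<alpha> (x / y) \<le> C * Kalpha \<alpha> (x0 / y)"
proof -
  obtain B where B: "0 < B"
    "\<forall>x>0. \<forall>y>0. Kalpha \<alpha> (x / y) \<le> B * (x * y / (x\<^sup>2 + y\<^sup>2))"
    "\<forall>x>0. \<forall>y>0. x * y / (x\<^sup>2 + y\<^sup>2) \<le> B * Kalpha \<alpha> (x / y)"
    by (rule Kalpha_bounds) (rule that)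
  define R where "R = (\<bar>M\<bar> / x0) * (1 + x0\<^sup>2 / m\<^sup>2)"
  \<comment> \<open>The added 1 keeps the constant positive when M = 0.\<close>
  define C where "C = B * (R + 1) * B"
  have R0: "0 \<le> R" using assms by (simp add: R_def)
  have C0: "0 < C" using B R0 by (simp add: C_def)
  have "Kalpha \<alpha> (x / y) \<le> C * Kalpha \<alpha> (x0 / y)" if x: "m \<le> x" "x \<le> M" and y: "0 < y" for x y
  proof -
    have xp: "x > 0" using x assms by simp
    have s: "0 < x\<^sup>2 + y\<^sup>2" "0 < x0\<^sup>2 + y\<^sup>2" using y by (auto intro: add_nonneg_pos)
    have "x0\<^sup>2 * m\<^sup>2 \<le> x0\<^sup>2 * x\<^sup>2" using x assms by (intro mult_left_mono power_mono) auto
    hence 2: "x0\<^sup>2 \<le> x0\<^sup>2 / m\<^sup>2 * x\<^sup>2" using assms by (simp add: field_simps)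
    define q where "q = x0\<^sup>2 / m\<^sup>2"
    have "0 \<le> q * y\<^sup>2" "0 \<le> x\<^sup>2" by (auto simp: q_def)
    moreover have "(1 + q) * (x\<^sup>2 + y\<^sup>2) = x\<^sup>2 + y\<^sup>2 + q * x\<^sup>2 + q * y\<^sup>2" by (simp add: algebra_simps)
    ultimately have "x0\<^sup>2 + y\<^sup>2 \<le> (1 + q) * (x\<^sup>2 + y\<^sup>2)" using 2[folded q_def] by linarith
    hence 1: "x0\<^sup>2 + y\<^sup>2 \<le> (1 + x0\<^sup>2 / m\<^sup>2) * (x\<^sup>2 + y\<^sup>2)" by (simp add: q_def)
    have "x * y / (x\<^sup>2 + y\<^sup>2) = (x / x0) * ((x0\<^sup>2 + y\<^sup>2) / (x\<^sup>2 + y\<^sup>2)) * (x0 * y / (x0\<^sup>2 + y\<^sup>2))"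
      using s assms by simp
    also have "\<dots> \<le> (\<bar>M\<bar> / x0) * (1 + x0\<^sup>2 / m\<^sup>2) * (x0 * y / (x0\<^sup>2 + y\<^sup>2))"
    proof (intro mult_right_mono mult_mono)
      show "(x0\<^sup>2 + y\<^sup>2) / (x\<^sup>2 + y\<^sup>2) \<le> 1 + x0\<^sup>2 / m\<^sup>2" using 1 s by (simp add: pos_divide_le_eq)
      show "x / x0 \<le> \<bar>M\<bar> / x0" using x assms by (intro divide_right_mono) auto
    qed (use assms xp y s in auto)
    also have "\<dots> \<le> (R + 1) * (x0 * y / (x0\<^sup>2 + y\<^sup>2))"
      using assms y s by (intro mult_right_mono) (auto simp: R_def)
    also have "\<dots> \<le> (R + 1) * (B * Kalpha \<alpha> (x0 / y))"
      using B(3) assms y R0 by (intro mult_left_mono) auto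
    finally have "B * (x * y / (x\<^sup>2 + y\<^sup>2)) \<le> B * ((R + 1) * (B * Kalpha \<alpha> (x0 / y)))"
      using B(1) by (intro mult_left_mono) auto
    moreover have "Kalpha \<alpha> (x / y) \<le> B * (x * y / (x\<^sup>2 + y\<^sup>2))" using B(2) xp y by blast
    ultimately show ?thesis unfolding C_def by (simp only: mult.assoc)
  qed
  thus ?thesis by (intro that[OF C0]) blast
qed

lemma kernel_pos: "0 < x \<Longrightarrow> 0 < y \<Longrightarrow> 0 < Kalpha \<alpha> (x / y)"
proof -
  assume xy: "0 < x" "0 < y"
  have "Kalpha \<alpha> (x / y) / y = Im (1 / (of_real y - \<zeta> x)) / pi" using kernel_eq_Im[OF xy, of 0] by simp
  also have "\<dots> = x * sin \<theta> / ((y - x * cos \<theta>)\<^sup>2 + (x * sin \<theta>)\<^sup>2) / pi" by (simp add: Im_divide Re_zeta Im_zeta)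
  also have "\<dots> > 0" using xy sin_theta_pos zeta_dist_pos[OF xy(1), of y] by simp
  finally show ?thesis using xy by (simp add: zero_less_divide_iff)
qed

section \<open>Passing from one evaluation point of the operator to another\<close>

lemma ker_rescale:
  "0 < x0 \<Longrightarrow> ker x u y = indicator {0<..} y * (Kalpha \<alpha> (x / y) / Kalpha \<alpha> (x0 / y)) * ker x0 u y"
  using kernel_pos[of x0 y] by (auto simp: ker_def indicator_def)

text \<open>Measurability of u itself is not assumed: one integrand is turned into another by
  multiplying with a measurable ratio of kernels.\<close>

lemma ker_measurable:
  assumes "ker x0 u \<in> borel_measurable lborel" "0 < x0"
  shows "ker x u \<in> borel_measurable lborel"
proof -
  have [measurable]: "ker x0 u \<in> borel_measurable borel" using assms by simp
  have "(\<lambda>y. indicator {0<..} y * (Kalpha \<alpha> (x / y) / Kalpha \<alpha> (x0 / y)) * ker x0 u y) \<in> borel_measurable borel"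
    by measurable
  thus ?thesis using ker_rescale[OF assms(2), of x u] by (simp cong: measurable_cong)
qed

lemma ker_dominated:
  assumes "0 < m" "0 < x0"
  obtains C where "0 < C" "\<forall>x u y. m \<le> x \<and> x \<le> M \<longrightarrow> \<bar>ker x u y\<bar> \<le> C * \<bar>ker x0 u y\<bar>"
proof -
  obtain C where C: "0 < C" "\<forall>x. \<forall>y>0. m \<le> x \<and> x \<le> M \<longrightarrow> Kalpha \<alpha> (x / y) \<le> C * Kalpha \<alpha> (x0 / y)"
    by (rule kernel_Harnack[OF assms]) (rule that)
  have "\<bar>ker x u y\<bar> \<le> C * \<bar>ker x0 u y\<bar>" if x: "m \<le> x" "x \<le> M" for x u y
  proof (cases "0 < y")
    case True
    have "Kalpha \<alpha> (x / y) * (\<bar>u y\<bar> / y) \<le> (C * Kalpha \<alpha> (x0 / y)) * (\<bar>u y\<bar> / y)"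
      using C True x by (intro mult_right_mono) auto
    moreover have "0 < Kalpha \<alpha> (x / y)" "0 < Kalpha \<alpha> (x0 / y)" using kernel_pos True assms x by auto
    ultimately show ?thesis using True by (simp add: ker_def abs_mult)
  qed (simp add: ker_def)
  thus ?thesis by (intro that[OF C(1)]) blast
qed

lemma ker_integrable_transfer:
  assumes I: "integrable lborel (ker x0 u)" and x: "0 < x0" "0 < x"
  shows "integrable lborel (ker x u)"
proof -
  obtain C where C: "0 < C" "\<forall>x' u y. x \<le> x' \<and> x' \<le> x \<longrightarrow> \<bar>ker x' u y\<bar> \<le> C * \<bar>ker x0 u y\<bar>"
    by (rule ker_dominated[OF x(2,1)]) (rule that)
  show ?thesis
    by (rule Bochner_Integration.integrable_bound[OF _ ker_measurable[OF borel_measurable_integrable[OF I] x(1)],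
          of "\<lambda>y. C * \<bar>ker x0 u y\<bar>"]) (use I C in auto)
qed

text \<open>Dominated convergence with the Harnack majorant. It carries identities proved for x >
  rho to the endpoint and makes the moments continuous.\<close>

lemma ker_integral_continuous:
  assumes I: "integrable lborel (ker x0 u)" and x: "0 < x0" "0 < x"
  shows "isCont (\<lambda>x. \<integral>y. ker x u y \<partial>lborel) x"
proof (rule continuous_at_sequentiallyI)
  fix X :: "nat \<Rightarrow> real" assume X: "X \<longlonglongrightarrow> x"
  \<comment> \<open>Clamping to [x/2, 2x] puts every term in the range of one Harnack constant; the
    clamped sequence eventually coincides with X.\<close>
  define Y where "Y = (\<lambda>k. max (x / 2) (min (2 * x) (X k)))"
  have Yl: "Y \<longlonglongrightarrow> max (x / 2) (min (2 * x) x)" unfolding Y_def by (intro tendsto_intros X)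
  moreover have "max (x / 2) (min (2 * x) x) = x" using x by auto
  ultimately have Yl: "Y \<longlonglongrightarrow> x" by simp
  have Yb: "x / 2 \<le> Y k" "Y k \<le> 2 * x" for k using x by (auto simp: Y_def)
  have x2: "0 < x / 2" using x by simp
  obtain C where C: "0 < C" "\<forall>x' u y. x / 2 \<le> x' \<and> x' \<le> 2 * x \<longrightarrow> \<bar>ker x' u y\<bar> \<le> C * \<bar>ker x0 u y\<bar>"
    by (rule ker_dominated[OF x2 x(1)]) (rule that)
  have "(\<lambda>k. \<integral>y. ker (Y k) u y \<partial>lborel) \<longlonglongrightarrow> (LBINT y. ker x u y)"
  proof (rule integral_dominated_convergence[where w = "\<lambda>y. C * \<bar>ker x0 u y\<bar>"])
    show "AE y in lborel. (\<lambda>k. ker (Y k) u y) \<longlonglongrightarrow> ker x u y"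
    proof (rule AE_I2)
      fix y :: real
      show "(\<lambda>k. ker (Y k) u y) \<longlonglongrightarrow> ker x u y"
      proof (cases "0 < y")
        case True
        have "1 + (x / y)\<^sup>2 - 2 * (x / y) * cos (2 * pi / (1 + \<alpha>)) \<noteq> 0"
          using kernel_pos[OF x(2) True] by (auto simp: Kalpha_def)
        hence "(\<lambda>k. Kalpha \<alpha> (Y k / y)) \<longlonglongrightarrow> Kalpha \<alpha> (x / y)"
          unfolding Kalpha_def using True by (intro tendsto_intros Yl) auto
        thus ?thesis unfolding ker_def using True by (intro tendsto_intros) auto
      qed (simp add: ker_def)
    qed
    show "AE y in lborel. norm (ker (Y k) u y) \<le> C * \<bar>ker x0 u y\<bar>" for k
      by (rule AE_I2) (use C Yb in auto)
  qed (use I ker_measurable[OF borel_measurable_integrable[OF I] x(1)] in auto)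
  moreover have "eventually (\<lambda>k. Y k = X k) sequentially"
  proof -
    have "eventually (\<lambda>k. x / 2 < X k) sequentially" "eventually (\<lambda>k. X k < 2 * x) sequentially"
      by (rule order_tendstoD[OF X], use x in simp)+
    thus ?thesis by eventually_elim (auto simp: Y_def)
  qed
  hence "eventually (\<lambda>k. (LBINT y. ker (Y k) u y) = (LBINT y. ker (X k) u y)) sequentially"
    by eventually_elim simp
  ultimately show "(\<lambda>k. \<integral>y. ker (X k) u y \<partial>lborel) \<longlonglongrightarrow> (LBINT y. ker x u y)"
    by (rule Lim_transform_eventually)
qed

end

section \<open>The action\<close>

context anharmonic
begin

definition sq :: "real \<Rightarrow> real \<Rightarrow> real" where
  "sq x t = (if b t < x then exp (t / 2) * sqrt (x - b t) else 0)"

lemma sq_nonneg: "0 \<le> sq x t"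
  by (simp add: sq_def)

lemma sq_zero: "x \<le> \<rho> \<Longrightarrow> sq x t = 0"
  using b_ge_rho[of t] by (simp add: sq_def)

lemma sq_measurable [measurable]: "sq x \<in> borel_measurable borel"
  unfolding sq_def [abs_def] by measurable

lemma sq_alt: "sq x t = exp (t / 2) * sqrt (max 0 (x - b t))"
  by (simp add: sq_def max_def)

lemma sq_supp: "x > \<rho> \<Longrightarrow> \<forall>t. b t < x \<longleftrightarrow> t1 < t \<and> t < t2 \<Longrightarrow> sq x t = indicator {t1..t2} t *\<^sub>R sq x t"
  by (auto simp: sq_def indicator_def)

lemma integrable_sq: "integrable lborel (sq x)"
proof (cases "x > \<rho>")
  case True
  obtain t1 t2 where t: "\<forall>t. b t < x \<longleftrightarrow> t1 < t \<and> t < t2"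
    by (rule turning_points[OF True]) (rule that)
  have "continuous_on {t1..t2} (sq x)"
    unfolding sq_alt [abs_def] by (intro continuous_intros) auto
  hence "integrable lborel (\<lambda>t. indicator {t1..t2} t *\<^sub>R sq x t)"
    using borel_integrable_compact[of "{t1..t2}" "sq x"] by (simp add: indicator_def if_distrib cong: if_cong)
  moreover have "(\<lambda>t. indicator {t1..t2} t *\<^sub>R sq x t) = sq x"
    by (rule ext) (rule sq_supp[OF True t, symmetric])
  ultimately show ?thesis by (simp only:)
next
  case False
  hence "sq x = (\<lambda>t. 0)" by (auto simp: sq_zero)
  thus ?thesis by simp
qed

lemma Vpot_exp: "Vpot \<alpha> (exp (t / 2)) x = exp t * (x - b t)"
proof -
  have "exp (t / 2) powr (2 * \<alpha> + 2) = exp t * exp (\<alpha> * t)"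
    by (simp add: powr_def algebra_simps add_divide_distrib flip: exp_add)
  moreover have "(exp (t / 2))\<^sup>2 = exp t" by (simp flip: exp_double)
  moreover have "exp t * exp (- t) = 1" by (simp flip: exp_add)
  ultimately show ?thesis by (simp add: Vpot_def b_def algebra_simps)
qed

lemma Sact_eq_integral_sq: "Sact \<alpha> x = (LBINT t. sq x t) / (2 * pi)"
proof (cases "x > \<rho>")
  case False
  hence "sq x = (\<lambda>t. 0)" by (auto simp: sq_zero)
  thus ?thesis using False by (simp add: Sact_def)
next
  case True
  obtain t1 t2 where t: "t1 < t0" "t0 < t2" "b t1 = x" "b t2 = x" "\<forall>t. b t < x \<longleftrightarrow> t1 < t \<and> t < t2"
    "\<forall>t. b t = x \<longleftrightarrow> t = t1 \<or> t = t2" by (rule turning_points[OF True]) (rule that)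
  have "{u. 0 < u \<and> Vpot \<alpha> u x = 0} = {exp (t1 / 2), exp (t2 / 2)}"
  proof (intro set_eqI iffI)
    fix u assume "u \<in> {u. 0 < u \<and> Vpot \<alpha> u x = 0}"
    hence u: "0 < u" "Vpot \<alpha> u x = 0" by auto
    define s where "s = 2 * ln u"
    have us: "u = exp (s / 2)" using u by (simp add: s_def)
    hence "b s = x" using u Vpot_exp[of s x] by simp
    thus "u \<in> {exp (t1 / 2), exp (t2 / 2)}" using t(6) us by auto
  next
    fix u assume "u \<in> {exp (t1 / 2), exp (t2 / 2)}"
    thus "u \<in> {u. 0 < u \<and> Vpot \<alpha> u x = 0}" using t by (auto simp: Vpot_exp)
  qed
  hence u12: "u1 \<alpha> x = exp (t1 / 2)" "u2 \<alpha> x = exp (t2 / 2)"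
    using t by (simp_all add: u1_def u2_def cInf_eq_Min cSup_eq_Max)
  have c: "continuous_on {exp (t1 / 2)..exp (t2 / 2)} (\<lambda>u. sqrt (Vpot \<alpha> u x) / u)"
  proof -
    have "u \<noteq> 0" if "u \<in> {exp (t1 / 2)..exp (t2 / 2)}" for u using that exp_gt_zero[of "t1 / 2"] by (force simp del: exp_gt_zero)
    thus ?thesis unfolding Vpot_def by (intro continuous_intros) auto
  qed
  have "((\<lambda>s. (exp (s / 2) / 2) *\<^sub>R (sqrt (Vpot \<alpha> (exp (s / 2)) x) / exp (s / 2))) has_integral
      integral {exp (t1 / 2)..exp (t2 / 2)} (\<lambda>u. sqrt (Vpot \<alpha> u x) / u)) {t1..t2}"
  proof (rule has_integral_substitution[OF _ _ _ c])
    show "((\<lambda>s. exp (s / 2)) has_real_derivative exp (s / 2) / 2) (at s within {t1..t2})" for s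
      by (auto intro!: derivative_eq_intros)
  qed (use t in auto)
  moreover have "(exp (s / 2) / 2) *\<^sub>R (sqrt (Vpot \<alpha> (exp (s / 2)) x) / exp (s / 2)) = sq x s / 2" if "s \<in> {t1..t2}" for s
  proof -
    have "b s \<le> x" using that t by (metis atLeastAtMost_iff le_less)
    moreover have "sqrt (exp s) = exp (s / 2)" by (rule real_sqrt_unique) (simp_all flip: exp_double)
    ultimately show ?thesis unfolding Vpot_exp by (auto simp: real_sqrt_mult sq_def)
  qed
  ultimately have hi: "((\<lambda>s. sq x s / 2) has_integral integral {exp (t1 / 2)..exp (t2 / 2)} (\<lambda>u. sqrt (Vpot \<alpha> u x) / u)) {t1..t2}"
    by (rule has_integral_eq[rotated])
  have "integrable lborel (\<lambda>s. sq x s / 2)" using integrable_sq by simp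
  from has_integral_integral_lborel[OF this]
  have "((\<lambda>s. sq x s / 2) has_integral (LBINT s. sq x s / 2)) UNIV" .
  moreover have "(\<lambda>s. if s \<in> {t1..t2} then sq x s / 2 else 0) = (\<lambda>s. sq x s / 2)"
    using t(5) by (auto simp: sq_def fun_eq_iff)
  ultimately have "((\<lambda>s. sq x s / 2) has_integral (LBINT s. sq x s / 2)) {t1..t2}"
    using has_integral_restrict_UNIV[of "{t1..t2}" "\<lambda>s. sq x s / 2"] by simp
  from has_integral_unique[OF hi this]
  have "integral {exp (t1 / 2)..exp (t2 / 2)} (\<lambda>u. sqrt (Vpot \<alpha> u x) / u) = (LBINT s. sq x s) / 2" by simp
  hence "Sact \<alpha> x = 1 / pi * ((LBINT s. sq x s) / 2)" using True by (simp only: Sact_def u12 if_True)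
  thus ?thesis by simp
qed

lemma Sact_zero: "x \<le> \<rho> \<Longrightarrow> Sact \<alpha> x = 0"
  by (simp add: Sact_def)

lemma Sact_nonneg: "0 \<le> Sact \<alpha> x"
  unfolding Sact_eq_integral_sq by (simp add: sq_nonneg)

text \<open>The candidate for the derivative of the action, from formal differentiation under the
  integral sign.\<close>

definition dens :: "real \<Rightarrow> real" where
  "dens y = (LBINT t. wt 1 y t) / (4 * pi)"

lemma mom_1: "mom 1 y = y * dens y"
  by (simp add: mom_def dens_def)

lemma dens_nonneg: "0 \<le> dens y"
  by (simp add: dens_def wt_nonneg)

lemma dens_measurable [measurable]: "dens \<in> borel_measurable borel"
proof -
  have "dens = (\<lambda>y. if y = 0 then dens 0 else mom 1 y / y)"
    by (rule ext) (simp add: mom_1 del: One_nat_def)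
  also have "\<dots> \<in> borel_measurable borel" by measurable
  finally show ?thesis .
qed

text \<open>Exchange the integrals and use that 1 / sqrt (y - b t) integrates to 2 sqrt (x - b t).
  This avoids differentiating an integral whose endpoints move and whose differentiated integrand is
  singular there.\<close>

lemma
  shows integrable_dens: "integrable lborel (\<lambda>y. indicator {..<x} y * dens y)"
    and integral_dens: "(LBINT y. indicator {..<x} y * dens y) = Sact \<alpha> x"
proof -
  have m: "(\<lambda>(t, y). ennreal (indicator {..<x} y * wt 1 y t / (4 * pi))) \<in> borel_measurable (lborel \<Otimes>\<^sub>M lborel)"
  proof -
    have "(\<lambda>p. ennreal (indicator {..<x} (snd p) * wt 1 (snd p) (fst p) / (4 * pi))) \<in> borel_measurable (borel \<Otimes>\<^sub>M borel)"
      unfolding wt_def by measurable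
    thus ?thesis by (simp add: case_prod_beta cong: measurable_cong_sets sets_pair_measure_cong)
  qed
  have "ennreal (indicator {..<x} y * dens y) = (\<integral>\<^sup>+t. ennreal (indicator {..<x} y * wt 1 y t / (4 * pi)) \<partial>lborel)" for y
  proof -
    have "ennreal (indicator {..<x} y * dens y) = ennreal (indicator {..<x} y / (4 * pi)) * ennreal (LBINT t. wt 1 y t)"
      by (simp add: dens_def wt_nonneg flip: ennreal_mult)
    also have "\<dots> = (\<integral>\<^sup>+t. ennreal (indicator {..<x} y / (4 * pi)) * ennreal (wt 1 y t) \<partial>lborel)"
      unfolding ennreal_integral_wt[OF order_refl] by (subst nn_integral_cmult) (auto simp: wt_def [abs_def])
    also have "\<dots> = (\<integral>\<^sup>+t. ennreal (indicator {..<x} y * wt 1 y t / (4 * pi)) \<partial>lborel)"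
      by (simp add: wt_nonneg flip: ennreal_mult)
    finally show ?thesis .
  qed
  hence "(\<integral>\<^sup>+y. ennreal (indicator {..<x} y * dens y) \<partial>lborel) = (\<integral>\<^sup>+y. \<integral>\<^sup>+t. ennreal (indicator {..<x} y * wt 1 y t / (4 * pi)) \<partial>lborel \<partial>lborel)" by simp
  also have "\<dots> = (\<integral>\<^sup>+t. \<integral>\<^sup>+y. ennreal (indicator {..<x} y * wt 1 y t / (4 * pi)) \<partial>lborel \<partial>lborel)"
    by (rule lborel_pair.Fubini'[OF m])
  also have "\<dots> = (\<integral>\<^sup>+t. ennreal (sq x t / (2 * pi)) \<partial>lborel)"
  proof (rule nn_integral_cong)
    fix t
    show "(\<integral>\<^sup>+y. ennreal (indicator {..<x} y * wt 1 y t / (4 * pi)) \<partial>lborel) = ennreal (sq x t / (2 * pi))"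
    proof (cases "b t < x")
      case True
      define e where "e = exp (t / 2) / (4 * pi)"
      have e: "0 \<le> e" by (simp add: e_def)
      have eq: "indicator {..<x} y * wt 1 y t / (4 * pi) = e * (indicator {b t<..<x} y / sqrt (y - b t))" for y
        using True by (auto simp: indicator_def wt_def e_def)
      have "(\<integral>\<^sup>+y. ennreal (e * (indicator {b t<..<x} y / sqrt (y - b t))) \<partial>lborel) = ennreal (LBINT y. e * (indicator {b t<..<x} y / sqrt (y - b t)))"
        by (rule nn_integral_eq_integral[OF integrable_mult_right[OF integrable_inverse_sqrt[OF True]]])
           (use e in \<open>auto simp: indicator_def\<close>)
      also have "(LBINT y. e * (indicator {b t<..<x} y / sqrt (y - b t))) = e * (2 * sqrt (x - b t))"
        unfolding integral_mult_right_zero integral_inverse_sqrt[OF True] ..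
      also have "\<dots> = sq x t / (2 * pi)" using True by (simp add: sq_def e_def)
      finally show ?thesis unfolding eq .
    next
      case False
      hence z: "indicator {..<x} y * wt 1 y t / (4 * pi) = 0" for y by (auto simp: indicator_def wt_def)
      show ?thesis unfolding z using False by (simp add: sq_def)
    qed
  qed
  also have "\<dots> = ennreal (LBINT t. sq x t / (2 * pi))"
    by (rule nn_integral_eq_integral) (use integrable_sq in \<open>auto simp: sq_nonneg\<close>)
  also have "(LBINT t. sq x t / (2 * pi)) = Sact \<alpha> x" by (simp add: Sact_eq_integral_sq)
  finally have nn: "(\<integral>\<^sup>+y. ennreal (indicator {..<x} y * dens y) \<partial>lborel) = ennreal (Sact \<alpha> x)" .
  show I: "integrable lborel (\<lambda>y. indicator {..<x} y * dens y)"
    by (rule integrableI_nonneg) (auto simp: dens_nonneg nn)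
  show "(LBINT y. indicator {..<x} y * dens y) = Sact \<alpha> x"
    using nn_integral_eq_integral[OF I] nn Sact_nonneg
    by (simp add: dens_nonneg)
qed

text \<open>Read off from the integral equation: the moment equals the image of the operator plus a
  constant, and such images are continuous.\<close>

lemma mom_continuous:
  assumes x: "x > \<rho>" and n: "n \<le> 1" shows "isCont (mom n) x"
proof -
  have xp: "0 < x" using x rho_pos by simp
  have "isCont (\<lambda>x. (LBINT y. ker x (mom n) y) + mshift n) x"
    by (intro continuous_intros ker_integral_continuous[OF integrable_ker_mom[OF x n] xp xp])
  moreover have "\<forall>\<^sub>F y in nhds x. (LBINT z. ker y (mom n) z) + mshift n = mom n y"
  proof -
    have "\<forall>\<^sub>F y in nhds x. y \<in> {\<rho><..}" by (rule eventually_nhds_in_open) (use x in auto)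
    thus ?thesis by eventually_elim (simp add: integral_ker_mom[OF _ n])
  qed
  ultimately show ?thesis using isCont_cong by fastforce
qed

lemma Sact_deriv:
  assumes x: "x > \<rho>" shows "(Sact \<alpha> has_real_derivative mom 1 x / x) (at x)"
proof -
  have xp: "0 < x" using x rho_pos by simp
  \<comment> \<open>Any base point strictly between rho and x would do; it keeps the interval inside
    the region where the density is continuous.\<close>
  define a where "a = (\<rho> + x) / 2"
  have a: "\<rho> < a" "a < x" using x by (auto simp: a_def)
  have dc: "continuous_on {a..x + 1} dens"
  proof (rule continuous_at_imp_continuous_on, rule ballI)
    fix y assume "y \<in> {a..x + 1}"
    hence y: "\<rho> < y" "0 < y" using a rho_pos by auto
    have "isCont (\<lambda>y. mom 1 y / y) y" using mom_continuous[OF y(1), of 1] y by (intro continuous_intros) auto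
    moreover have "\<forall>\<^sub>F z in nhds y. mom 1 z / z = dens z"
    proof -
      have "\<forall>\<^sub>F z in nhds y. z \<in> {0<..}" by (rule eventually_nhds_in_open) (use y in auto)
      thus ?thesis by eventually_elim (simp add: mom_1 del: One_nat_def)
    qed
    ultimately show "isCont dens y" using isCont_cong by fastforce
  qed
  have diff: "Sact \<alpha> y = Sact \<alpha> a + integral {a..y} dens" if y: "y \<in> {a..x + 1}" for y
  proof -
    have c: "continuous_on {a..y} dens" using dc y by (rule_tac continuous_on_subset) auto
    have I: "integrable lborel (\<lambda>z. indicator {a..y} z *\<^sub>R dens z)"
      using borel_integrable_atLeastAtMost'[OF c] by (simp add: set_integrable_def)
    have "Sact \<alpha> y = (LBINT z. indicator {..<a} z * dens z + indicator {a..<y} z * dens z)"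
      unfolding integral_dens[symmetric] by (rule Bochner_Integration.integral_cong) (use y in \<open>auto simp: indicator_def\<close>)
    also have "\<dots> = (LBINT z. indicator {..<a} z * dens z + indicator {a..y} z *\<^sub>R dens z)"
    proof (rule integral_cong_AE)
      have "AE z in lborel. z \<noteq> y" by (simp add: AE_lborel_singleton)
      thus "AE z in lborel. indicator {..<a} z * dens z + indicator {a..<y} z * dens z = indicator {..<a} z * dens z + indicator {a..y} z *\<^sub>R dens z"
        by eventually_elim (auto simp: indicator_def)
    qed auto
    also have "\<dots> = Sact \<alpha> a + (LBINT z. indicator {a..y} z *\<^sub>R dens z)"
      by (simp only: Bochner_Integration.integral_add[OF integrable_dens I] integral_dens)
    also have "(LBINT z. indicator {a..y} z *\<^sub>R dens z) = integral {a..y} dens"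
      using set_borel_integral_eq_integral(2)[OF borel_integrable_atLeastAtMost'[OF c]] by (simp add: set_lebesgue_integral_def)
    finally show ?thesis .
  qed
  have "((\<lambda>y. integral {a..y} dens) has_real_derivative dens x) (at x within {a..x + 1})"
    by (rule integral_has_real_derivative[OF dc]) (use a in auto)
  hence "((\<lambda>y. Sact \<alpha> a + integral {a..y} dens) has_real_derivative 0 + dens x) (at x within {a..x + 1})"
    by (intro DERIV_add DERIV_const)
  hence d: "((\<lambda>y. Sact \<alpha> a + integral {a..y} dens) has_real_derivative dens x) (at x within {a..x + 1})" by simp
  have "(Sact \<alpha> has_real_derivative dens x) (at x within {a..x + 1})"
    by (rule has_field_derivative_transform_within[OF d zero_less_one]) (use a in simp, rule diff[symmetric])
  hence "(Sact \<alpha> has_real_derivative dens x) (at x)"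
    using a by (simp add: at_within_Icc_at)
  thus ?thesis using xp by (simp add: mom_1 del: One_nat_def)
qed

end

section \<open>Euler's relation\<close>

context anharmonic
begin

lemma Euler_relation:
  assumes x: "x > \<rho>"
  shows "Sact \<alpha> x = 2 * \<alpha> / (1 + \<alpha>) * mom 1 x - 2 * mom 0 x"
proof -
  obtain t1 t2 where t: "t1 < t0" "t0 < t2" "b t1 = x" "b t2 = x" "\<forall>t. b t < x \<longleftrightarrow> t1 < t \<and> t < t2"
    by (rule turning_points[OF x]) (rule that)
  define A where "A = (\<lambda>t. exp (t / 2) * sqrt (x - b t))"
  define G where "G = (\<lambda>t. exp (t / 2) * (x - (1 + \<alpha>) * exp (\<alpha> * t)) / (2 * sqrt (x - b t)))"
  \<comment> \<open>The derivative of \<open>A\<close> in terms of the three weights. With w = sqrt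
    (x - b) the relation b' = \<alpha> b - (1+\<alpha>) exp (-t) gives w^2 - b' = (1+\<alpha>) w^2 -
    \<alpha> x + (1+\<alpha>) exp (-t).\<close>
  define ds where "ds = (\<lambda>t. (1 + \<alpha>) / 2 * sq x t - \<alpha> / 2 * x * wt 1 x t + (1 + \<alpha>) / 2 * wt 0 x t)"
  have I: "integrable lborel (wt 1 x)" "integrable lborel (wt 0 x)" "integrable lborel (sq x)"
    using integrable_wt[OF x] integrable_sq by auto
  have Ids: "integrable lborel ds" unfolding ds_def
    by (intro Bochner_Integration.integrable_add Bochner_Integration.integrable_diff integrable_mult_right I)
  have dsG: "ds s = indicator {t1<..<t2} s *\<^sub>R G s" for s
  proof (cases "t1 < s \<and> s < t2")
    case True
    hence bs: "b s < x" using t(5) by blast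
    define w where "w = sqrt (x - b s)"
    have w: "w > 0" "w * w = x - b s" using bs by (auto simp: w_def)
    have e: "exp (- s / 2) = exp (s / 2) * exp (- s)" by (simp flip: exp_add)
    have "ds s = (1 + \<alpha>) / 2 * (exp (s / 2) * w) - \<alpha> / 2 * x * (exp (s / 2) / w) + (1 + \<alpha>) / 2 * (exp (s / 2) * exp (- s) / w)"
      using bs e by (simp add: ds_def sq_def wt_def w_def)
    also have "\<dots> = exp (s / 2) * ((1 + \<alpha>) * (w * w) - \<alpha> * x + (1 + \<alpha>) * exp (- s)) / (2 * w)"
      using w(1) by (simp add: field_simps)
    also have "(1 + \<alpha>) * (w * w) - \<alpha> * x + (1 + \<alpha>) * exp (- s) = x - (1 + \<alpha>) * exp (\<alpha> * s)"
      unfolding w(2) b_def by (simp add: algebra_simps)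
    finally show ?thesis using True by (simp add: G_def w_def)
  next
    case False
    hence "\<not> b s < x" using t(5) by blast
    thus ?thesis using False by (auto simp: ds_def sq_def wt_def indicator_def)
  qed
  have "(LBINT s=ereal t1..ereal t2. G s) = A t2 - A t1"
  proof (rule interval_integral_FTC_integrable)
    show "ereal t1 < ereal t2" using t by simp
    fix s assume "ereal t1 < ereal s" "ereal s < ereal t2"
    hence bs: "b s < x" using t(5) by simp
    define w where "w = sqrt (x - b s)"
    have w: "w > 0" "w * w = x - b s" using bs by (auto simp: w_def)
    have d1: "((\<lambda>t. sqrt (x - b t)) has_real_derivative inverse (sqrt (x - b s)) / 2 * (0 - (\<alpha> * exp (\<alpha> * s) - exp (- s)))) (at s)"
      by (rule DERIV_chain2[OF DERIV_real_sqrt DERIV_diff[OF DERIV_const b_deriv]]) (use bs in simp)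
    have d2: "((\<lambda>t. exp (t / 2)) has_real_derivative exp (s / 2) * (1 / 2)) (at s)"
      by (auto intro!: derivative_eq_intros)
    have "(A has_real_derivative exp (s / 2) * (1 / 2) * sqrt (x - b s) + inverse (sqrt (x - b s)) / 2 * (0 - (\<alpha> * exp (\<alpha> * s) - exp (- s))) * exp (s / 2)) (at s)"
      unfolding A_def by (rule DERIV_mult[OF d2 d1])
    moreover have "exp (s / 2) * (1 / 2) * sqrt (x - b s) + inverse (sqrt (x - b s)) / 2 * (0 - (\<alpha> * exp (\<alpha> * s) - exp (- s))) * exp (s / 2) = G s"
    proof -
      have "exp (s / 2) * (1 / 2) * w + 1 / w / 2 * (0 - (\<alpha> * exp (\<alpha> * s) - exp (- s))) * exp (s / 2)
         = exp (s / 2) * (w * w - (\<alpha> * exp (\<alpha> * s) - exp (- s))) / (2 * w)" using w(1) by (simp add: field_simps)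
      also have "w * w - (\<alpha> * exp (\<alpha> * s) - exp (- s)) = x - (1 + \<alpha>) * exp (\<alpha> * s)"
        unfolding w(2) b_def by (simp add: algebra_simps)
      finally show ?thesis unfolding G_def w_def inverse_eq_divide .
    qed
    ultimately show "(A has_vector_derivative G s) (at s)"
      by (simp only: has_real_derivative_iff_has_vector_derivative)
    have "isCont b s" using b_deriv[of s UNIV] DERIV_isCont by blast
    thus "isCont G s" unfolding G_def using bs by (intro continuous_intros) auto
  next
    show "set_integrable lborel (einterval (ereal t1) (ereal t2)) G"
    proof -
      have "ds = (\<lambda>s. indicator {t1<..<t2} s *\<^sub>R G s)" by (rule ext) (rule dsG)
      thus ?thesis using Ids unfolding set_integrable_def einterval_eq by (simp only:)
    qed
    have c: "isCont A s" for s
      using b_deriv[of s UNIV] DERIV_isCont unfolding A_def by (intro continuous_intros) auto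
    show "((A \<circ> real_of_ereal) \<longlongrightarrow> A t1) (at_right (ereal t1))"
      unfolding ereal_tendsto_simps using c[of t1] by (simp add: isCont_def filterlim_at_split)
    show "((A \<circ> real_of_ereal) \<longlongrightarrow> A t2) (at_left (ereal t2))"
      unfolding ereal_tendsto_simps using c[of t2] by (simp add: isCont_def filterlim_at_split)
  qed
  also have "\<dots> = 0" using t by (simp add: A_def)
  finally have "(LBINT s. ds s) = 0"
    using t dsG by (simp add: interval_lebesgue_integral_def set_lebesgue_integral_def)
  moreover have "(LBINT s. ds s) = (1 + \<alpha>) / 2 * (LBINT s. sq x s) - \<alpha> / 2 * x * (LBINT s. wt 1 x s) + (1 + \<alpha>) / 2 * (LBINT s. wt 0 x s)"
    unfolding ds_def using I by simp
  moreover have "(LBINT s. sq x s) = 2 * pi * Sact \<alpha> x" by (simp add: Sact_eq_integral_sq)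
  moreover have "x * (LBINT s. wt 1 x s) = 4 * pi * mom 1 x" "(LBINT s. wt 0 x s) = 4 * pi * mom 0 x"
    by (simp_all add: mom_def)
  ultimately have "(1 + \<alpha>) / 2 * (2 * pi * Sact \<alpha> x) - \<alpha> / 2 * (4 * pi * mom 1 x) + (1 + \<alpha>) / 2 * (4 * pi * mom 0 x) = 0"
    by (simp only: mult.assoc)
  hence "pi * ((1 + \<alpha>) * Sact \<alpha> x - 2 * \<alpha> * mom 1 x + 2 * (1 + \<alpha>) * mom 0 x) = 0" by (simp add: algebra_simps add_divide_distrib)
  hence "(1 + \<alpha>) * Sact \<alpha> x = 2 * \<alpha> * mom 1 x - 2 * (1 + \<alpha>) * mom 0 x" by simp
  hence "Sact \<alpha> x = (2 * \<alpha> * mom 1 x - 2 * (1 + \<alpha>) * mom 0 x) / (1 + \<alpha>)" using alpha_gt_1 by (simp add: eq_divide_eq mult.commute)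
  also have "\<dots> = 2 * \<alpha> / (1 + \<alpha>) * mom 1 x - 2 * mom 0 x" using alpha_gt_1 by (simp add: field_simps)
  finally show ?thesis .
qed

text \<open>On the top line the integrand is at most a constant times exp (- |ln x + t| / 2), whose
  integral is independent of x by translation. For x exp t > 1 the bound |Q| \<ge> x exp t sin
  \<theta> suffices; otherwise Re Q \<ge> 0 and the smallness of Im Q is used.\<close>

lemma mom_0_bounded: obtains C where "\<forall>x>\<rho>. mom 0 x \<le> C"
proof -
  define c where "c = 1 / sqrt (sin \<theta>)"
  define J :: real where "J = (LBINT r. exp (- (1/2) * \<bar>r\<bar>))"
  have IJ: "integrable lborel (\<lambda>r::real. exp (- (1/2) * \<bar>r\<bar>))" by (rule integrable_exp_neg_abs) simp
  have "mom 0 x \<le> mshift 0 + c * J / (4 * pi)" if x: "x > \<rho>" for x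
  proof -
    have xp: "0 < x" using x rho_pos by simp
    have bd: "Im (F 0 x (Complex t \<theta>)) \<le> c * exp (- (1/2) * \<bar>ln x + 1 * t\<bar>)" for t
    proof -
      define q where "q = Q x (Complex t \<theta>)"
      define A where "A = 1 + exp ((1 + \<alpha>) * t)"
      define B where "B = x * exp t"
      have A: "1 \<le> A" by (simp add: A_def)
      have B: "0 < B" using xp by (simp add: B_def)
      have Be: "B = exp (ln x + t)" using xp by (simp add: B_def exp_add)
      have re: "Re q = A - B * cos \<theta>" and im: "Im q = - (B * sin \<theta>)"
        by (simp_all add: q_def Re_Q Im_Q alpha_theta A_def B_def)
      note sp = sin_theta_pos
      have q1: "B * sin \<theta> \<le> cmod q" using abs_Im_le_cmod[of q] im B sp by simp
      have q2: "sin \<theta> \<le> cmod q"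
      proof -
        \<comment> \<open>Here q = A - B cis \<theta>, and the distance from A to the line spanned
          by cis \<theta> is A sin \<theta>.\<close>
        have "(A * sin \<theta>)\<^sup>2 + (A * cos \<theta> - B)\<^sup>2 = (Re q)\<^sup>2 + (Im q)\<^sup>2"
          unfolding re im using sin_cos_squared_add[of \<theta>] by (simp add: power2_eq_square algebra_simps) (simp add: algebra_simps flip: distrib_left)
        hence "(A * sin \<theta>)\<^sup>2 \<le> (cmod q)\<^sup>2" by (simp add: cmod_power2) (smt (verit) zero_le_power2)
        hence "A * sin \<theta> \<le> cmod q" by (rule power2_le_imp_le) simp
        moreover have "1 * sin \<theta> \<le> A * sin \<theta>" using A sp by (intro mult_right_mono) auto
        ultimately show ?thesis by simp
      qed
      have qp: "0 < cmod q" using q2 sp by linarith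
      have F0: "F 0 x (Complex t \<theta>) = phi x (Complex t \<theta>)" by (simp add: F_def)
      show ?thesis
      proof (cases "B \<le> 1")
        case False
        have "Im (phi x (Complex t \<theta>)) \<le> cmod (phi x (Complex t \<theta>))" using abs_Im_le_cmod abs_le_iff by blast
        also have "\<dots> = 1 / sqrt (cmod q)" by (simp add: norm_phi q_def)
        also have "\<dots> \<le> 1 / sqrt (B * sin \<theta>)" using q1 B sp qp by (intro divide_left_mono) auto
        also have "\<dots> = c * (1 / sqrt B)" by (simp add: c_def real_sqrt_mult)
        also have "sqrt B = exp ((ln x + t) / 2)" unfolding Be by (rule real_sqrt_unique) (simp_all flip: exp_double)
        also have "1 / exp ((ln x + t) / 2) = exp (- (1/2) * \<bar>ln x + 1 * t\<bar>)"
        proof -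
          have "0 < ln x + t" using False Be by simp
          thus ?thesis by (simp add: exp_minus inverse_eq_divide)
        qed
        finally show ?thesis unfolding F0 .
      next
        case True
        have "B * cos \<theta> \<le> 1 * 1" using True B by (intro order_trans[OF mult_left_mono[OF cos_le_one]]) auto
        hence rq: "0 \<le> Re q" using A re by simp
        \<comment> \<open>Since (|q| - Re q)(|q| + Re q) = (Im q)^2, this difference is
          quadratically small in Im q when Re q \<ge> 0.\<close>
        have "(cmod q - Re q) * cmod q \<le> (cmod q - Re q) * (cmod q + Re q)"
          using rq complex_Re_le_cmod[of q] by (intro mult_left_mono) auto
        also have "\<dots> = (Im q)\<^sup>2" using cmod_power2[of q] by (simp add: power2_eq_square algebra_simps)
        finally have "cmod q - Re q \<le> (Im q)\<^sup>2 / cmod q" using qp by (simp add: pos_le_divide_eq)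
        also have "\<dots> \<le> (Im q)\<^sup>2 / sin \<theta>" using q2 sp qp by (intro divide_left_mono) auto
        finally have "cmod q - Re q \<le> (Im q)\<^sup>2 / sin \<theta>" .
        moreover have "(cmod q - Re q) / 2 \<le> cmod q - Re q" using complex_Re_le_cmod[of q] by simp
        ultimately have "(cmod q - Re q) / 2 \<le> (Im q)\<^sup>2 / sin \<theta>" by (rule order_trans[rotated])
        hence "sqrt ((cmod q - Re q) / 2) \<le> sqrt ((Im q)\<^sup>2 / sin \<theta>)" by (rule real_sqrt_le_mono)
        also have "\<dots> = B * sin \<theta> / sqrt (sin \<theta>)" using B sp by (simp add: im real_sqrt_divide)
        finally have "sqrt ((cmod q - Re q) / 2) / cmod q \<le> (B * sin \<theta> / sqrt (sin \<theta>)) / sin \<theta>"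
          using q2 qp sp B by (intro frac_le) auto
        hence "Im (phi x (Complex t \<theta>)) \<le> c * B"
          unfolding Im_phi q_def[symmetric] c_def using sp by simp
        also have "\<dots> \<le> c * exp (- (1/2) * \<bar>ln x + 1 * t\<bar>)"
        proof -
          have "ln x + t \<le> 0" using True Be by simp
          hence "ln x + t \<le> - (1/2) * \<bar>ln x + 1 * t\<bar>" by (simp add: field_simps)
          hence "B \<le> exp (- (1/2) * \<bar>ln x + 1 * t\<bar>)" unfolding Be by (simp only: exp_le_cancel_iff)
          thus ?thesis using sp by (intro mult_left_mono) (auto simp: c_def)
        qed
        finally show ?thesis unfolding F0 .
      qed
    qed
    have I1: "integrable lborel (\<lambda>t. Im (F 0 x (Complex t \<theta>)))"
      using integrable_Im_F[OF x, of 0 \<theta>] theta_bounds by simp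
    have I2: "integrable lborel (\<lambda>t. c * exp (- (1/2) * \<bar>ln x + 1 * t\<bar>))"
      by (rule integrable_mult_right[OF lborel_integrable_real_affine[OF IJ]]) simp
    have "(LBINT t. Im (F 0 x (Complex t \<theta>))) \<le> (LBINT t. c * exp (- (1/2) * \<bar>ln x + 1 * t\<bar>))"
      by (rule integral_mono[OF I1 I2 bd])
    also have "\<dots> = c * J"
      using lborel_integral_real_affine[of 1 "\<lambda>r. exp (- (1/2) * \<bar>r\<bar>)" "ln x"]
      unfolding integral_mult_right_zero J_def by simp
    finally have "(LBINT t. wt 0 x t) - \<theta> \<le> c * J" using integral_F_theta[OF x, of 0] by simp
    hence "((LBINT t. wt 0 x t) - \<theta>) / (4 * pi) \<le> c * J / (4 * pi)" by (intro divide_right_mono) auto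
    thus ?thesis by (simp add: mom_def mshift_def diff_divide_distrib)
  qed
  thus ?thesis by (intro that[of "mshift 0 + c * J / (4 * pi)"]) blast
qed

end

section \<open>Asymptotics at infinity\<close>

lemma Gamma_three_halves: "Gamma (3 / 2 :: real) = sqrt pi / 2"
proof -
  have "(1 / 2 :: real) \<notin> \<int>\<^sub>\<le>\<^sub>0" using nonpos_Ints_nonpos[of "1 / 2 :: real"] by auto
  from Gamma_plus1[OF this] show ?thesis by (simp add: Gamma_one_half_real)
qed

context anharmonic
begin

definition sexp :: real where "sexp = (1 + \<alpha>) / (2 * \<alpha>)"

text \<open>Limit profile of the action integrand, rescaled and centred at ln x / \<alpha>.\<close>

definition limw :: "real \<Rightarrow> real" where
  "limw r = exp (r / 2) * sqrt (max 0 (1 - exp (\<alpha> * r)))"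

definition Sinf :: real where "Sinf = (LBINT r. limw r) / (2 * pi)"

lemma limw_bound: "limw r \<le> exp (- (1/2) * \<bar>r\<bar>)"
proof (cases "r \<le> 0")
  case True
  have "sqrt (max 0 (1 - exp (\<alpha> * r))) \<le> sqrt 1" by (intro real_sqrt_le_mono) auto
  hence "limw r \<le> exp (r / 2) * 1" unfolding limw_def by (intro mult_left_mono) auto
  thus ?thesis using True by simp
next
  case False
  hence "1 - exp (\<alpha> * r) \<le> 0" using alpha_gt_1 by simp
  thus ?thesis by (simp add: limw_def max_def)
qed

lemma limw_measurable [measurable]: "limw \<in> borel_measurable borel"
  unfolding limw_def [abs_def] by measurable

lemma limw_nonneg: "0 \<le> limw r"
  by (simp add: limw_def)

lemma integrable_limw: "integrable lborel limw"
proof (rule Bochner_Integration.integrable_bound)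
  show "integrable lborel (\<lambda>r::real. exp (- (1/2) * \<bar>r\<bar>))" by (rule integrable_exp_neg_abs) simp
qed (use limw_bound limw_nonneg in auto)

text \<open>The centre ln x / \<alpha> solves exp (\<alpha> t) = x, so it approximates the right
  turning point. There the other exponential of \<open>b\<close> carries a vanishing power of
  x.\<close>

lemma sq_scaled:
  assumes x: "0 < x"
  shows "x powr (- sexp) * sq x (ln x / \<alpha> + 1 * r)
    = exp (r / 2) * sqrt (max 0 (1 - exp (\<alpha> * r) - x powr (- (1 + \<alpha>) / \<alpha>) * exp (- r)))"
proof -
  define l where "l = ln x"
  have xe: "x = exp l" using x by (simp add: l_def)
  have a: "\<alpha> \<noteq> 0" using alpha_gt_1 by simp
  have e1: "exp (\<alpha> * (l / \<alpha> + r)) = exp l * exp (\<alpha> * r)" using a by (simp add: distrib_left exp_add)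
  have e2: "exp (- (l / \<alpha> + r)) = exp l * (exp (- (1 + \<alpha>) / \<alpha> * l) * exp (- r))"
    using a by (simp add: field_simps flip: exp_add)
  have m: "max 0 (exp l - b (l / \<alpha> + r)) = exp l * max 0 (1 - exp (\<alpha> * r) - exp (- (1 + \<alpha>) / \<alpha> * l) * exp (- r))"
  proof -
    have "exp l - b (l / \<alpha> + r) = exp l * (1 - exp (\<alpha> * r) - exp (- (1 + \<alpha>) / \<alpha> * l) * exp (- r))"
      unfolding b_def e1 e2 by (simp add: algebra_simps)
    thus ?thesis by (simp add: max_def zero_le_mult_iff)
  qed
  have s: "sqrt (exp l) = exp (l / 2)" by (rule real_sqrt_unique) (simp_all flip: exp_double)
  have e3: "exp (- sexp * l) * (exp ((l / \<alpha> + r) / 2) * exp (l / 2)) = exp (r / 2)"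
  proof -
    have "- sexp * l + ((l / \<alpha> + r) / 2 + l / 2) = r / 2" using a by (simp add: sexp_def field_simps)
    thus ?thesis by (simp only: exp_add[symmetric])
  qed
  have p: "x powr (- sexp) = exp (- sexp * l)" "x powr (- (1 + \<alpha>) / \<alpha>) = exp (- (1 + \<alpha>) / \<alpha> * l)"
    using x by (simp_all add: powr_def l_def)
  have "x powr (- sexp) * sq x (ln x / \<alpha> + 1 * r) = exp (- sexp * l) * (exp ((l / \<alpha> + r) / 2) * exp (l / 2))
     * sqrt (max 0 (1 - exp (\<alpha> * r) - exp (- (1 + \<alpha>) / \<alpha> * l) * exp (- r)))"
    unfolding p sq_alt l_def[symmetric] by (subst (1) xe) (simp add: m real_sqrt_mult s)
  thus ?thesis unfolding e3 p .
qed

text \<open>The limit profile dominates the rescaled integrand, since the term dropped under the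
  root is subtracted and nonnegative.\<close>

lemma Sact_asymp:
  "((\<lambda>x. x powr (- sexp) * Sact \<alpha> x) \<longlongrightarrow> Sinf) at_top"
proof -
  define s where "s = (\<lambda>x r. exp (r / 2) * sqrt (max 0 (1 - exp (\<alpha> * r) - x powr (- (1 + \<alpha>) / \<alpha>) * exp (- r))))"
  have d0: "((\<lambda>x. x powr (- (1 + \<alpha>) / \<alpha>)) \<longlongrightarrow> 0) at_top"
    by (rule tendsto_neg_powr) (use alpha_gt_1 in \<open>auto simp: filterlim_ident field_simps\<close>)
  have "((\<lambda>x. \<integral>r. s x r \<partial>lborel) \<longlongrightarrow> (LBINT r. limw r)) at_top"
  proof (rule integral_dominated_convergence_at_top[where w = limw])
    show "\<forall>\<^sub>F x in at_top. AE r in lborel. norm (s x r) \<le> limw r"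
    proof (rule always_eventually, rule allI, rule AE_I2)
      fix x r
      have "0 \<le> x powr (- (1 + \<alpha>) / \<alpha>) * exp (- r)" by simp
      hence "max 0 (1 - exp (\<alpha> * r) - x powr (- (1 + \<alpha>) / \<alpha>) * exp (- r)) \<le> max 0 (1 - exp (\<alpha> * r))" by linarith
      thus "norm (s x r) \<le> limw r" unfolding s_def limw_def by (simp add: abs_mult)
    qed
    show "AE r in lborel. ((\<lambda>x. s x r) \<longlongrightarrow> limw r) at_top"
    proof (rule AE_I2)
      fix r
      have "((\<lambda>x. s x r) \<longlongrightarrow> exp (r / 2) * sqrt (max 0 (1 - exp (\<alpha> * r) - 0 * exp (- r)))) at_top"
        unfolding s_def by (intro tendsto_intros d0)
      thus "((\<lambda>x. s x r) \<longlongrightarrow> limw r) at_top" by (simp add: limw_def)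
    qed
    show "s x \<in> borel_measurable lborel" for x unfolding s_def by measurable
  qed (auto simp: integrable_limw)
  hence 1: "((\<lambda>x. (LBINT r. s x r) / (2 * pi)) \<longlongrightarrow> Sinf) at_top"
    unfolding Sinf_def by (intro tendsto_intros) auto
  have "\<forall>\<^sub>F x in at_top. (LBINT r. s x r) / (2 * pi) = x powr (- sexp) * Sact \<alpha> x"
    using eventually_gt_at_top[of 0]
  proof eventually_elim
    case (elim x)
    have "(LBINT r. s x r) = (LBINT r. x powr (- sexp) * sq x (ln x / \<alpha> + 1 * r))"
      unfolding s_def sq_scaled[OF elim] ..
    also have "\<dots> = x powr (- sexp) * (LBINT r. sq x (ln x / \<alpha> + 1 * r))" by (rule integral_mult_right_zero)
    also have "(LBINT r. sq x (ln x / \<alpha> + 1 * r)) = (LBINT t. sq x t)"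
      using lborel_integral_real_affine[of 1 "sq x" "ln x / \<alpha>"] by simp
    finally show ?case by (simp add: Sact_eq_integral_sq)
  qed
  from Lim_transform_eventually[OF 1 this] show ?thesis .
qed

text \<open>The substitution q = exp (\<alpha> r) maps the negative half-line onto (0, 1) and
  produces the Beta integrand; the profile vanishes for r \<ge> 0.\<close>

lemma integral_limw: "(LBINT r. limw r) = Beta (1 / (2 * \<alpha>)) (3 / 2) / \<alpha>"
proof -
  define f where "f = (\<lambda>q::real. q powr (1 / (2 * \<alpha>) - 1) * (1 - q) powr (3 / 2 - 1))"
  define S :: "real set" where "S = {..<0}"
  have a: "0 < \<alpha>" using alpha_gt_1 by simp
  have "(f has_integral Beta (1 / (2 * \<alpha>)) (3 / 2)) {0..1}"
    unfolding f_def by (rule has_integral_Beta_real) (use a in auto)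
  hence hi: "(f has_integral Beta (1 / (2 * \<alpha>)) (3 / 2)) {0<..<1}" by (simp add: has_integral_Icc_iff_Ioo)
  have im: "(\<lambda>r. exp (\<alpha> * r)) ` S = {0<..<1}"
  proof (intro set_eqI iffI)
    fix q :: real assume q: "q \<in> {0<..<1}"
    hence "q = exp (\<alpha> * (ln q / \<alpha>))" "ln q / \<alpha> \<in> S" using a by (auto simp: S_def divide_less_0_iff)
    thus "q \<in> (\<lambda>r. exp (\<alpha> * r)) ` S" by blast
  qed (use a in \<open>auto simp: S_def mult_pos_neg\<close>)
  have "f absolutely_integrable_on (\<lambda>r. exp (\<alpha> * r)) ` S \<and> integral ((\<lambda>r. exp (\<alpha> * r)) ` S) f = Beta (1 / (2 * \<alpha>)) (3 / 2)"
    unfolding im using hi by (auto intro!: nonnegative_absolutely_integrable_1 simp: f_def has_integral_iff)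
  moreover have "((\<lambda>r. \<bar>\<alpha> * exp (\<alpha> * r)\<bar> * f (exp (\<alpha> * r))) absolutely_integrable_on S \<and>
      integral S (\<lambda>r. \<bar>\<alpha> * exp (\<alpha> * r)\<bar> * f (exp (\<alpha> * r))) = Beta (1 / (2 * \<alpha>)) (3 / 2)) \<longleftrightarrow>
      (f absolutely_integrable_on (\<lambda>r. exp (\<alpha> * r)) ` S \<and> integral ((\<lambda>r. exp (\<alpha> * r)) ` S) f = Beta (1 / (2 * \<alpha>)) (3 / 2))"
  proof (rule has_absolute_integral_change_of_variables_1')
    show "((\<lambda>r. exp (\<alpha> * r)) has_field_derivative \<alpha> * exp (\<alpha> * r)) (at r within S)" for r
      by (auto intro!: derivative_eq_intros)
  qed (use a in \<open>auto simp: S_def inj_on_def\<close>)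
  ultimately have J: "integral S (\<lambda>r. \<bar>\<alpha> * exp (\<alpha> * r)\<bar> * f (exp (\<alpha> * r))) = Beta (1 / (2 * \<alpha>)) (3 / 2)" by blast
  have eq: "\<bar>\<alpha> * exp (\<alpha> * r)\<bar> * f (exp (\<alpha> * r)) = \<alpha> * limw r" if "r \<in> S" for r
  proof -
    have "exp (\<alpha> * r) < 1" using that a by (simp add: S_def mult_pos_neg)
    hence "(1 - exp (\<alpha> * r)) powr (3 / 2 - 1) = sqrt (max 0 (1 - exp (\<alpha> * r)))"
      by (simp add: powr_half_sqrt max_def)
    moreover have "exp (\<alpha> * r) * exp (\<alpha> * r) powr (1 / (2 * \<alpha>) - 1) = exp (r / 2)"
    proof -
      have "(1 / (2 * \<alpha>) - 1) * (\<alpha> * r) = r / 2 - \<alpha> * r" using a by (simp add: left_diff_distrib)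
      thus ?thesis by (simp add: powr_def flip: exp_add)
    qed
    ultimately show ?thesis using a unfolding f_def limw_def by (simp add: abs_mult)
  qed
  have "integral S (\<lambda>r. \<alpha> * limw r) = Beta (1 / (2 * \<alpha>)) (3 / 2)"
    unfolding J[symmetric] by (rule integral_cong) (simp only: eq)
  moreover have "((\<lambda>r. \<alpha> * limw r) has_integral (LBINT r. \<alpha> * limw r)) S"
  proof -
    have "((\<lambda>r. \<alpha> * limw r) has_integral (LBINT r. \<alpha> * limw r)) UNIV"
      by (rule has_integral_integral_lborel[OF integrable_mult_right[OF integrable_limw]])
    moreover have "(\<lambda>r. if r \<in> S then \<alpha> * limw r else 0) = (\<lambda>r. \<alpha> * limw r)"
      using a by (auto simp: S_def limw_def fun_eq_iff max_def mult_le_0_iff)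
    ultimately show ?thesis using has_integral_restrict_UNIV[of S "\<lambda>r. \<alpha> * limw r"] by simp
  qed
  ultimately have "(LBINT r. \<alpha> * limw r) = Beta (1 / (2 * \<alpha>)) (3 / 2)"
    using integral_unique by metis
  thus ?thesis using a by (simp add: eq_divide_eq mult.commute)
qed

text \<open>Evaluation of the Beta integral by Gamma functions. It identifies \<open>Aconst\<close>
  as the constant for which \<open>tau\<close> grows like (A \<xi>) to the power
  \<open>sexp\<close>.\<close>

lemma Aconst_powr: "Aconst \<alpha> powr sexp = 2 * (1 + \<alpha>) * \<rho> powr sexp * Sinf"
  and Aconst_pos: "0 < Aconst \<alpha>"
proof -
  have a: "0 < \<alpha>" using alpha_gt_1 by simp
  define g1 where "g1 = Gamma (1 / (2 * \<alpha>))"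
  define g2 where "g2 = Gamma ((1 + \<alpha>) / (2 * \<alpha>))"
  have g: "0 < g1" "0 < g2" using a by (auto simp: g1_def g2_def)
  define k where "k = (1 / sqrt (pi * \<alpha>)) * g1 / g2"
  have k: "0 < k" using g a by (simp add: k_def)
  have A: "Aconst \<alpha> = (1 + \<alpha>) * k powr (2 * \<alpha> / (\<alpha> + 1))" by (simp add: Aconst_def k_def g1_def g2_def)
  show "0 < Aconst \<alpha>" unfolding A using a k by simp
  have e1: "(2 * \<alpha> / (\<alpha> + 1)) * sexp = 1" using a by (simp add: sexp_def add.commute)
  have "(k powr (2 * \<alpha> / (\<alpha> + 1))) powr sexp = k"
    unfolding powr_powr e1 using k by simp
  hence Ap: "Aconst \<alpha> powr sexp = (1 + \<alpha>) powr sexp * k"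
    unfolding A using a by (simp add: powr_mult)
  have rp: "\<rho> powr sexp = (1 + \<alpha>) powr sexp / sqrt \<alpha>"
  proof -
    have "\<rho> powr sexp = (1 + \<alpha>) powr sexp / \<alpha> powr sexp * \<alpha> powr (1 / (\<alpha> + 1) * sexp)"
      unfolding rho_def using a by (simp add: powr_mult powr_divide powr_powr add.commute)
    also have "1 / (\<alpha> + 1) * sexp = sexp - 1 / 2" using a by (simp add: sexp_def field_simps)
    also have "\<alpha> powr (sexp - 1 / 2) = \<alpha> powr sexp / sqrt \<alpha>" using a by (simp add: powr_diff powr_half_sqrt)
    finally show ?thesis using a by simp
  qed
  have "Beta (1 / (2 * \<alpha>)) (3 / 2) = g1 * (sqrt pi / 2) / (sexp * g2)"
  proof -
    note h = Gamma_three_halves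
    have "1 / (2 * \<alpha>) + 3 / 2 = (1 + \<alpha>) / (2 * \<alpha>) + 1" using a by (simp add: field_simps)
    moreover have "Gamma ((1 + \<alpha>) / (2 * \<alpha>) + 1) = sexp * g2"
      unfolding sexp_def g2_def by (rule Gamma_plus1) (use a nonpos_Ints_nonpos[of "(1 + \<alpha>) / (2 * \<alpha>)"] in \<open>auto simp: divide_le_0_iff\<close>)
    ultimately show ?thesis unfolding Beta_def g1_def h by (simp only:)
  qed
  hence "2 * (1 + \<alpha>) * \<rho> powr sexp * Sinf
      = 2 * (1 + \<alpha>) * ((1 + \<alpha>) powr sexp / sqrt \<alpha>) * (g1 * (sqrt pi / 2) / (sexp * g2) / \<alpha> / (2 * pi))"
    unfolding Sinf_def integral_limw rp by simp
  also have "\<dots> = (1 + \<alpha>) powr sexp * ((1 / (sqrt pi * sqrt \<alpha>)) * g1 / g2)"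
  proof -
    define z where "z = (1 + \<alpha>) powr sexp"
    define p where "p = sqrt pi"
    have p: "p > 0" "pi = p * p" by (auto simp: p_def)
    have s: "2 * \<alpha> * sexp = 1 + \<alpha>" using a by (simp add: sexp_def)
    have sp: "sexp > 0" using a by (simp add: sexp_def)
    have "2 * (2 * \<alpha> * sexp) * (z / sqrt \<alpha>) * (g1 * (p / 2) / (sexp * g2) / \<alpha> / (2 * (p * p))) = z * ((1 / (p * sqrt \<alpha>)) * g1 / g2)"
      using a g p sp by (simp add: field_simps)
    thus ?thesis unfolding s z_def[symmetric] p_def[symmetric] p(2)[symmetric] .
  qed
  also have "\<dots> = (1 + \<alpha>) powr sexp * k" by (simp add: k_def real_sqrt_mult)
  finally show "Aconst \<alpha> powr sexp = 2 * (1 + \<alpha>) * \<rho> powr sexp * Sinf"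
    using Ap by simp
qed

lemma mom_1_asymp:
  "((\<lambda>x. x powr (- sexp) * mom 1 x) \<longlongrightarrow> sexp * Sinf) at_top"
proof -
  have a: "0 < \<alpha>" using alpha_gt_1 by simp
  have sp: "sexp > 0" using a by (simp add: sexp_def)
  obtain C where C: "\<forall>x>\<rho>. mom 0 x \<le> C" by (rule mom_0_bounded) (rule that)
  have p0: "((\<lambda>x. x powr (- sexp)) \<longlongrightarrow> 0) at_top"
    by (rule tendsto_neg_powr) (use sp in \<open>auto simp: filterlim_ident\<close>)
  have m0: "((\<lambda>x. x powr (- sexp) * mom 0 x) \<longlongrightarrow> 0) at_top"
  proof (rule Lim_null_comparison)
    show "\<forall>\<^sub>F x in at_top. norm (x powr (- sexp) * mom 0 x) \<le> x powr (- sexp) * \<bar>C\<bar>"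
      using eventually_gt_at_top[of "\<rho>"]
    proof eventually_elim
      case (elim x)
      have "0 \<le> mom 0 x" "mom 0 x \<le> C" using C elim mom_nonneg[of x 0] rho_pos by auto
      thus ?case by (auto simp: abs_mult intro!: mult_left_mono)
    qed
    show "((\<lambda>x. x powr (- sexp) * \<bar>C\<bar>) \<longlongrightarrow> 0) at_top" using tendsto_mult_left_zero[OF p0] by simp
  qed
  have "((\<lambda>x. sexp * (x powr (- sexp) * Sact \<alpha> x + 2 * (x powr (- sexp) * mom 0 x))) \<longlongrightarrow>
      sexp * (Sinf + 2 * 0)) at_top"
    by (intro tendsto_intros Sact_asymp m0)
  moreover have "\<forall>\<^sub>F x in at_top. sexp * (x powr (- sexp) * Sact \<alpha> x + 2 * (x powr (- sexp) * mom 0 x)) = x powr (- sexp) * mom 1 x"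
    using eventually_gt_at_top[of "\<rho>"]
  proof eventually_elim
    case (elim x)
    have s: "sexp * (2 * \<alpha> / (1 + \<alpha>)) = 1" using a by (simp add: sexp_def)
    have "sexp * (x powr (- sexp) * Sact \<alpha> x + 2 * (x powr (- sexp) * mom 0 x)) = x powr (- sexp) * (sexp * (2 * \<alpha> / (1 + \<alpha>)) * mom 1 x)"
      unfolding Euler_relation[OF elim] by (simp add: algebra_simps)
    thus ?case unfolding s by simp
  qed
  ultimately have "((\<lambda>x. x powr (- sexp) * mom 1 x) \<longlongrightarrow> sexp * (Sinf + 2 * 0)) at_top"
    by (rule Lim_transform_eventually)
  thus ?thesis by simp
qed

end

section \<open>Behaviour at the endpoint\<close>

text \<open>For k = 1 this is the area of a half-disc, an instance of the integral behind the volume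
  of balls; scaling r by sqrt k gives the rest.\<close>

lemma
  assumes k: "0 < k"
  shows integrable_semicircle: "integrable lborel (\<lambda>r::real. sqrt (max 0 (1 - k * r\<^sup>2)))"
    and integral_semicircle: "(LBINT r. sqrt (max 0 (1 - k * r\<^sup>2))) = pi / (2 * sqrt k)"
proof -
  have B: "Beta (1 / 2) (3 / 2 :: real) = pi / 2"
    using Gamma_fact[of 1, where 'a = real] by (simp add: Beta_def Gamma_one_half_real Gamma_three_halves)
  have e: "indicator {-1..1} x * sqrt (1 - x\<^sup>2) ^ 1 = sqrt (max 0 (1 - x\<^sup>2))" for x :: real
  proof (cases "x \<in> {-1..1}")
    case True
    hence "x\<^sup>2 \<le> 1" by (simp add: abs_square_le_1 abs_le_iff)
    thus ?thesis using True by simp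
  next
    case False
    hence "\<not> x\<^sup>2 \<le> 1" by (auto simp: abs_square_le_1 abs_le_iff)
    thus ?thesis using False by simp
  qed
  have "(\<integral>\<^sup>+x. ennreal (sqrt (max 0 (1 - x\<^sup>2))) \<partial>lborel) = (\<integral>\<^sup>+x. indicator {-1..1} x * sqrt (1 - x\<^sup>2) ^ 1 \<partial>lborel)"
    by (intro nn_integral_cong) (simp add: e[symmetric] ennreal_mult' ennreal_indicator)
  also have "\<dots> = ennreal (pi / 2)" unfolding emeasure_cball_aux_integral by (simp add: B)
  finally have nn: "(\<integral>\<^sup>+x. ennreal (sqrt (max 0 (1 - x\<^sup>2))) \<partial>lborel) = ennreal (pi / 2)" .
  have I: "integrable lborel (\<lambda>x::real. sqrt (max 0 (1 - x\<^sup>2)))"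
    by (rule integrableI_nonneg) (auto simp: nn)
  have v: "(LBINT x. sqrt (max 0 (1 - x\<^sup>2))) = pi / 2"
    using nn_integral_eq_integral[OF I] nn by simp
  have sk: "sqrt k \<noteq> 0" using k by simp
  have eq: "(0 + sqrt k * r)\<^sup>2 = k * r\<^sup>2" for r using k by (simp add: power_mult_distrib)
  show "integrable lborel (\<lambda>r::real. sqrt (max 0 (1 - k * r\<^sup>2)))"
    using lborel_integrable_real_affine[OF I sk, of 0] unfolding eq .
  have "pi / 2 = \<bar>sqrt k\<bar> *\<^sub>R (LBINT r. sqrt (max 0 (1 - (0 + sqrt k * r)\<^sup>2)))"
    unfolding v[symmetric] by (rule lborel_integral_real_affine[OF sk])
  hence "pi / 2 = sqrt k * (LBINT r. sqrt (max 0 (1 - k * r\<^sup>2)))" unfolding eq using k by simp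
  thus "(LBINT r. sqrt (max 0 (1 - k * r\<^sup>2))) = pi / (2 * sqrt k)" using k by (simp add: field_simps)
qed

context anharmonic
begin

text \<open>The limit is half the second derivative at the minimum times r^2; by
  \<open>exp_t0\<close> this derivative is (\<alpha>+1) exp (-t0).\<close>

lemma b_second_order:
  "((\<lambda>X. X\<^sup>2 * (b (t0 + r / X) - \<rho>)) \<longlongrightarrow> (\<alpha> + 1) * exp (- t0) / 2 * r\<^sup>2) at_top"
proof -
  define E where "E = exp (- t0)"
  have a: "\<alpha> > 1" by (rule alpha_gt_1)
  have eq: "X\<^sup>2 * (b (t0 + r / X) - \<rho>) = E * (X\<^sup>2 * ((exp (\<alpha> * (r / X)) - 1) / \<alpha> + (exp (- (r / X)) - 1)))" for X
  proof -
    have "b (t0 + r / X) = exp (\<alpha> * t0) * exp (\<alpha> * (r / X)) + E * exp (- (r / X))"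
      unfolding b_def E_def by (simp only: distrib_left minus_add_distrib exp_add)
    also have "exp (\<alpha> * t0) = E / \<alpha>" unfolding E_def by (rule exp_t0)
    finally have "b (t0 + r / X) - \<rho> = E * ((exp (\<alpha> * (r / X)) - 1) / \<alpha> + (exp (- (r / X)) - 1))"
      unfolding b_t0[symmetric] using a by (simp add: b_def exp_t0 E_def[symmetric] algebra_simps diff_divide_distrib)
    thus ?thesis by simp
  qed
  have "((\<lambda>X. X\<^sup>2 * ((exp (\<alpha> * (r / X)) - 1) / \<alpha> + (exp (- (r / X)) - 1))) \<longlongrightarrow> (\<alpha> + 1) / 2 * r\<^sup>2) at_top"
  proof -
    consider "r = 0" | "r > 0" | "r < 0" by linarith
    thus ?thesis
    proof cases
      case 2
      thus ?thesis using a by (real_asymp simp: field_simps power2_eq_square)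
    next
      case 3
      thus ?thesis using a by (real_asymp simp: field_simps power2_eq_square)
    qed simp
  qed
  from tendsto_mult_left[OF this, of E] show ?thesis unfolding eq E_def by (simp add: algebra_simps)
qed

text \<open>Harmonic approximation: t = t0 + r sqrt (x - rho) turns the action over x - rho into an
  integral that converges to a semicircle integral. Below, X stands for 1 / sqrt (x - rho).\<close>

lemma Sact_near_rho:
  "((\<lambda>x. Sact \<alpha> x / (x - \<rho>)) \<longlongrightarrow> sqrt (2 / (1 + \<alpha>)) * exp t0 / 4) (at_right (\<rho>))"
proof -
  define k where "k = (\<alpha> + 1) * exp (- t0) / 2"
  have k: "0 < k" using alpha_gt_1 by (simp add: k_def)
  define s where "s = (\<lambda>X r. exp ((t0 + r / X) / 2) * sqrt (max 0 (1 - X\<^sup>2 * (b (t0 + r / X) - \<rho>))))"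
  \<comment> \<open>\<open>b_lower\<close> replaces the rescaled potential by r^2 / 2. The root then
    vanishes for r > 2, and for r \<le> 2 and X \<ge> 1 the exponential is at most exp ((t0 + 2) /
    2).\<close>
  define w where "w = (\<lambda>r. exp ((t0 + 2) / 2) * sqrt (max 0 (1 - 1 / 2 * r\<^sup>2)))"
  define f where "f = (\<lambda>r. exp (t0 / 2) * sqrt (max 0 (1 - k * r\<^sup>2)))"
  have "((\<lambda>X. \<integral>r. s X r \<partial>lborel) \<longlongrightarrow> (LBINT r. f r)) at_top"
  proof (rule integral_dominated_convergence_at_top[where w = w])
    show "\<forall>\<^sub>F X in at_top. AE r in lborel. norm (s X r) \<le> w r"
      using eventually_ge_at_top[of "1 :: real"]
    proof eventually_elim
      case (elim X)
      show ?case
      proof (rule AE_I2)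
        fix r :: real
        have "(r / X)\<^sup>2 / 2 \<le> b (t0 + r / X) - \<rho>" using b_lower[of "t0 + r / X"] by simp
        hence "X\<^sup>2 * ((r / X)\<^sup>2 / 2) \<le> X\<^sup>2 * (b (t0 + r / X) - \<rho>)" by (intro mult_left_mono) auto
        moreover have "X\<^sup>2 * ((r / X)\<^sup>2 / 2) = 1 / 2 * r\<^sup>2" using elim by (simp add: power_divide)
        ultimately have le: "max 0 (1 - X\<^sup>2 * (b (t0 + r / X) - \<rho>)) \<le> max 0 (1 - 1 / 2 * r\<^sup>2)" by linarith
        show "norm (s X r) \<le> w r"
        proof (cases "r \<le> 2")
          case True
          have "r / X \<le> 2" using True elim by (cases "r \<ge> 0") (auto simp: field_simps divide_nonpos_pos intro: order_trans)
          hence "exp ((t0 + r / X) / 2) \<le> exp ((t0 + 2) / 2)" by (subst exp_le_cancel_iff) (intro divide_right_mono add_left_mono, auto)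
          moreover have "sqrt (max 0 (1 - X\<^sup>2 * (b (t0 + r / X) - \<rho>))) \<le> sqrt (max 0 (1 - 1 / 2 * r\<^sup>2))"
            using le by (rule real_sqrt_le_mono)
          ultimately have "s X r \<le> w r" unfolding s_def w_def by (intro mult_mono) auto
          thus ?thesis by (simp add: s_def)
        next
          case False
          hence "2 * 2 < r * r" by (intro mult_strict_mono) auto
          hence "max 0 (1 - 1 / 2 * r\<^sup>2) = 0" by (simp add: power2_eq_square)
          hence "max 0 (1 - X\<^sup>2 * (b (t0 + r / X) - \<rho>)) = 0" using le by linarith
          hence "s X r = 0" unfolding s_def by (simp only: real_sqrt_zero mult_zero_right)
          thus ?thesis by (simp add: w_def)
        qed
      qed
    qed
    show "AE r in lborel. ((\<lambda>X. s X r) \<longlongrightarrow> f r) at_top"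
    proof (rule AE_I2)
      fix r :: real
      have "((\<lambda>X. r / X) \<longlongrightarrow> 0) at_top" by (intro tendsto_divide_0[OF tendsto_const] filterlim_at_top_imp_at_infinity filterlim_ident)
      hence "((\<lambda>X. s X r) \<longlongrightarrow> exp ((t0 + 0) / 2) * sqrt (max 0 (1 - (\<alpha> + 1) * exp (- t0) / 2 * r\<^sup>2))) at_top"
        unfolding s_def by (intro tendsto_intros b_second_order) auto
      thus "((\<lambda>X. s X r) \<longlongrightarrow> f r) at_top" by (simp add: f_def k_def)
    qed
    show "integrable lborel w" unfolding w_def by (rule integrable_mult_right[OF integrable_semicircle]) simp
    show "f \<in> borel_measurable lborel" unfolding f_def by measurable
    show "s X \<in> borel_measurable lborel" for X unfolding s_def by measurable
  qed
  moreover have "(LBINT r. f r) = exp (t0 / 2) * (pi / (2 * sqrt k))"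
    unfolding f_def integral_mult_right_zero integral_semicircle[OF k] ..
  ultimately have lim: "((\<lambda>X. (LBINT r. s X r) / (2 * pi)) \<longlongrightarrow> exp (t0 / 2) * (pi / (2 * sqrt k)) / (2 * pi)) at_top"
    by (intro tendsto_intros) auto
  have Xlim: "filterlim (\<lambda>x. 1 / sqrt (x - \<rho>)) at_top (at_right (\<rho>))" by real_asymp
  have "((\<lambda>x. (LBINT r. s (1 / sqrt (x - \<rho>)) r) / (2 * pi)) \<longlongrightarrow> exp (t0 / 2) * (pi / (2 * sqrt k)) / (2 * pi)) (at_right (\<rho>))"
    by (rule filterlim_compose[OF lim Xlim])
  moreover have "\<forall>\<^sub>F x in at_right (\<rho>). (LBINT r. s (1 / sqrt (x - \<rho>)) r) / (2 * pi) = Sact \<alpha> x / (x - \<rho>)"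
    using eventually_at_right_less[of "\<rho>"]
  proof eventually_elim
    case (elim x)
    define e where "e = sqrt (x - \<rho>)"
    have e: "e > 0" "e\<^sup>2 = x - \<rho>" using elim by (auto simp: e_def)
    have sx: "s (1 / e) r = (1 / e) * sq x (t0 + e * r)" for r
    proof -
      have arg: "t0 + r / (1 / e) = t0 + e * r" by simp
      have "1 - (1 / e)\<^sup>2 * (b (t0 + e * r) - \<rho>) = (1 / e)\<^sup>2 * (e\<^sup>2 - (b (t0 + e * r) - \<rho>))"
        using e(1) by (simp add: right_diff_distrib power_divide)
      also have "e\<^sup>2 - (b (t0 + e * r) - \<rho>) = x - b (t0 + e * r)" using e(2) by simp
      finally have "max 0 (1 - (1 / e)\<^sup>2 * (b (t0 + e * r) - \<rho>)) = (1 / e)\<^sup>2 * max 0 (x - b (t0 + e * r))"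
        by (simp add: max_def zero_le_mult_iff)
      hence "sqrt (max 0 (1 - (1 / e)\<^sup>2 * (b (t0 + e * r) - \<rho>))) = (1 / e) * sqrt (max 0 (x - b (t0 + e * r)))"
        using e(1) by (simp add: real_sqrt_mult)
      thus ?thesis unfolding s_def arg sq_alt by simp
    qed
    have "(LBINT t. sq x t) = \<bar>e\<bar> *\<^sub>R (LBINT r. sq x (t0 + e * r))"
      by (rule lborel_integral_real_affine) (use e in simp)
    hence "(LBINT r. sq x (t0 + e * r)) = (LBINT t. sq x t) / e" using e by simp
    hence "(LBINT r. s (1 / e) r) = (LBINT t. sq x t) / e\<^sup>2"
      unfolding sx integral_mult_right_zero by (simp add: power2_eq_square)
    hence "(LBINT r. s (1 / e) r) = (LBINT t. sq x t) / (x - \<rho>)" by (simp only: e(2))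
    hence "(LBINT r. s (1 / e) r) / (2 * pi) = Sact \<alpha> x / (x - \<rho>)" by (simp add: Sact_eq_integral_sq)
    thus ?case by (simp only: e_def)
  qed
  ultimately have "((\<lambda>x. Sact \<alpha> x / (x - \<rho>)) \<longlongrightarrow> exp (t0 / 2) * (pi / (2 * sqrt k)) / (2 * pi)) (at_right (\<rho>))"
    by (rule Lim_transform_eventually)
  moreover have "exp (t0 / 2) * (pi / (2 * sqrt k)) / (2 * pi) = sqrt (2 / (1 + \<alpha>)) * exp t0 / 4"
  proof -
    define h where "h = exp (t0 / 2)"
    have h: "h > 0" "exp t0 = h * h" by (auto simp: h_def simp flip: exp_add)
    have "k = (\<alpha> + 1) / 2 / (h * h)" by (simp add: k_def exp_minus h(2) inverse_eq_divide)
    moreover define v where "v = sqrt ((1 + \<alpha>) / 2)"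
    ultimately have sk: "sqrt k = v / h" using h(1) by (simp add: real_sqrt_divide real_sqrt_mult add.commute)
    have sv: "sqrt (2 / (1 + \<alpha>)) = 1 / v" by (simp add: real_sqrt_divide v_def)
    have "v > 0" using alpha_gt_1 by (simp add: v_def)
    thus ?thesis unfolding h(2) h_def[symmetric] sk sv using h(1) by (simp add: field_simps)
  qed
  ultimately show ?thesis by (simp only:)
qed

lemma Sact_tendsto_rho: "(Sact \<alpha> \<longlongrightarrow> 0) (at_right (\<rho>))"
proof -
  have x0: "((\<lambda>x. x - \<rho>) \<longlongrightarrow> 0) (at_right (\<rho>))" by (rule tendsto_eq_rhs[OF tendsto_diff[OF tendsto_ident_at tendsto_const]]) simp
  have "((\<lambda>x. (x - \<rho>) * (Sact \<alpha> x / (x - \<rho>))) \<longlongrightarrow> 0 * (sqrt (2 / (1 + \<alpha>)) * exp t0 / 4)) (at_right (\<rho>))"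
    by (intro tendsto_mult x0 Sact_near_rho)
  moreover have "\<forall>\<^sub>F x in at_right (\<rho>). (x - \<rho>) * (Sact \<alpha> x / (x - \<rho>)) = Sact \<alpha> x"
    using eventually_at_right_less[of "\<rho>"] by eventually_elim simp
  ultimately have "(Sact \<alpha> \<longlongrightarrow> 0 * (sqrt (2 / (1 + \<alpha>)) * exp t0 / 4)) (at_right (\<rho>))"
    by (rule Lim_transform_eventually)
  thus ?thesis by simp
qed

text \<open>A right limit L exists by continuity of the integral operator at rho. By l'Hopital's
  rule, S / (x - rho) tends to L / rho, and comparison with \<open>Sact_near_rho\<close> gives
  L.\<close>

lemma mom_1_near_rho: "(mom 1 \<longlongrightarrow> sqrt (2 * (1 + \<alpha>)) / (4 * \<alpha>)) (at_right (\<rho>))"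
proof -
  define L where "L = (LBINT y. ker (\<rho>) (mom 1) y)"
  have r1: "\<rho> + 1 > \<rho>" "0 < \<rho> + 1" using rho_pos by auto
  have "isCont (\<lambda>x. \<integral>y. ker x (mom 1) y \<partial>lborel) (\<rho>)"
    by (rule ker_integral_continuous[OF integrable_ker_mom[OF r1(1) order_refl] r1(2) rho_pos])
  hence "((\<lambda>x. \<integral>y. ker x (mom 1) y \<partial>lborel) \<longlongrightarrow> L) (at_right (\<rho>))"
    unfolding L_def isCont_def by (simp add: filterlim_at_split)
  moreover have "\<forall>\<^sub>F x in at_right (\<rho>). (LBINT y. ker x (mom 1) y) = mom 1 x"
    using eventually_at_right_less[of "\<rho>"]
    by eventually_elim (use integral_ker_mom[OF _ order_refl] in \<open>simp add: mshift_def\<close>)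
  ultimately have m: "(mom 1 \<longlongrightarrow> L) (at_right (\<rho>))" by (rule Lim_transform_eventually)
  have x0: "((\<lambda>x. x - \<rho>) \<longlongrightarrow> 0) (at_right (\<rho>))" by (rule tendsto_eq_rhs[OF tendsto_diff[OF tendsto_ident_at tendsto_const]]) simp
  have "((\<lambda>x. Sact \<alpha> x / (x - \<rho>)) \<longlongrightarrow> L / \<rho>) (at_right (\<rho>))"
  proof (rule lhopital_right[OF Sact_tendsto_rho x0])
    show "\<forall>\<^sub>F x in at_right (\<rho>). (Sact \<alpha> has_real_derivative mom 1 x / x) (at x)"
      using eventually_at_right_less[of "\<rho>"] by eventually_elim (rule Sact_deriv)
    show "\<forall>\<^sub>F x in at_right (\<rho>). ((\<lambda>x. x - \<rho>) has_real_derivative 1) (at x)"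
      by (rule always_eventually) (auto intro!: derivative_eq_intros)
    show "\<forall>\<^sub>F x in at_right (\<rho>). x - \<rho> \<noteq> 0"
      using eventually_at_right_less[of "\<rho>"] by eventually_elim simp
    have "((\<lambda>x. mom 1 x / x / 1) \<longlongrightarrow> L / \<rho> / 1) (at_right (\<rho>))"
      by (intro tendsto_intros m) (use rho_pos in auto)
    thus "((\<lambda>x. mom 1 x / x / 1) \<longlongrightarrow> L / \<rho>) (at_right (\<rho>))" by simp
  qed simp
  hence "L / \<rho> = sqrt (2 / (1 + \<alpha>)) * exp t0 / 4"
    using Sact_near_rho by (rule tendsto_unique[rotated]) simp
  hence "L = sqrt (2 / (1 + \<alpha>)) * exp t0 / 4 * \<rho>" using rho_pos by (simp add: divide_eq_eq)
  also have "\<dots> = sqrt (2 / (1 + \<alpha>)) / 4 * ((1 + \<alpha>) / \<alpha>)" by (simp add: rho_eq exp_minus add.commute)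
  also have "sqrt (2 / (1 + \<alpha>)) = sqrt (2 * (1 + \<alpha>)) / (1 + \<alpha>)"
  proof -
    have "2 / q = 2 * q / q\<^sup>2" for q :: real by (simp add: power2_eq_square)
    from this[of "1 + \<alpha>"]
    have "sqrt (2 / (1 + \<alpha>)) = sqrt (2 * (1 + \<alpha>)) / sqrt ((1 + \<alpha>)\<^sup>2)" by (simp only: real_sqrt_divide)
    thus ?thesis using alpha_gt_1 by simp
  qed
  also have "sqrt (2 * (1 + \<alpha>)) / (1 + \<alpha>) / 4 * ((1 + \<alpha>) / \<alpha>) = sqrt (2 * (1 + \<alpha>)) / (4 * \<alpha>)"
  proof -
    have "z / q / 4 * (q / \<alpha>) = z / (4 * \<alpha>)" if "q \<noteq> 0" for z q :: real using that by simp
    note * = this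
    show ?thesis by (rule *) (use alpha_gt_1 in simp)
  qed
  finally show ?thesis using m by simp
qed

end

section \<open>Uniqueness\<close>

context anharmonic
begin

section \<open>Linearity, scaling and restriction of the operator\<close>

lemma ker_add: "ker x (\<lambda>y. f y + g y) = (\<lambda>y. ker x f y + ker x g y)"
  by (auto simp: ker_def fun_eq_iff algebra_simps add_divide_distrib)

lemma ker_cmult: "ker x (\<lambda>y. k * f y) = (\<lambda>y. k * ker x f y)"
  by (auto simp: ker_def fun_eq_iff)

lemma ker_scale:
  assumes "0 < c" shows "ker x (\<lambda>y. v (c * y)) y = c * ker (c * x) v (0 + c * y)"
  using assms by (auto simp: ker_def indicator_def zero_less_mult_iff)

text \<open>The kernel depends on x / y only and dy / y is scale invariant. With c = rho / omega the
  equation on [omega, infinity) becomes the one satisfied by the moments.\<close>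

lemma
  assumes c: "0 < c" and I: "integrable lborel (ker (c * x) v)"
  shows integrable_ker_scale: "integrable lborel (ker x (\<lambda>y. v (c * y)))"
    and integral_ker_scale: "(LBINT y. ker x (\<lambda>y. v (c * y)) y) = (LBINT y. ker (c * x) v y)"
proof -
  have e: "ker x (\<lambda>y. v (c * y)) = (\<lambda>y. c * ker (c * x) v (0 + c * y))" by (rule ext) (rule ker_scale[OF c])
  show "integrable lborel (ker x (\<lambda>y. v (c * y)))"
    unfolding e by (rule integrable_mult_right[OF lborel_integrable_real_affine[OF I]]) (use c in simp)
  show "(LBINT y. ker x (\<lambda>y. v (c * y)) y) = (LBINT y. ker (c * x) v y)"
    unfolding e integral_mult_right_zero
    using lborel_integral_real_affine[of c "ker (c * x) v" 0] c by simp
qed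

text \<open>One exceptional point is allowed because the moments vanish at rho while a solution
  takes its right limit at the corresponding endpoint.\<close>

lemma
  assumes w: "0 < w" and eq: "\<And>y. 0 < y \<Longrightarrow> y \<noteq> w \<Longrightarrow> f y = g y"
  shows ker_integrable_cong: "integrable lborel (ker x f) \<longleftrightarrow> integrable lborel (ker x g)"
    and ker_integral_cong: "(LBINT y. ker x f y) = (LBINT y. ker x g y)"
proof -
  have *: "ker x f y = ker x g y" if "y \<notin> {w}" for y using eq[of y] that by (auto simp: ker_def indicator_def)
  show "integrable lborel (ker x f) \<longleftrightarrow> integrable lborel (ker x g)"
    by (rule integrable_discrete_difference[where X = "{w}"]) (use * in auto)
  show "(LBINT y. ker x f y) = (LBINT y. ker x g y)"
    by (rule integral_discrete_difference[where X = "{w}"]) (use * in auto)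
qed

definition restr :: "real \<Rightarrow> (real \<Rightarrow> real) \<Rightarrow> real \<Rightarrow> real" where
  "restr w l y = indicator {w..} y * l y"

lemma
  assumes w: "0 < w"
  shows set_integrable_iff_ker: "set_integrable lborel {w..} (\<lambda>y. Kalpha \<alpha> (x / y) * l y / y) \<longleftrightarrow> integrable lborel (ker x (restr w l))"
    and set_integral_eq_ker: "(\<integral>y\<in>{w..}. Kalpha \<alpha> (x / y) * l y / y \<partial>lborel) = (LBINT y. ker x (restr w l) y)"
proof -
  have e: "ker x (restr w l) = (\<lambda>y. indicator {w..} y *\<^sub>R (Kalpha \<alpha> (x / y) * l y / y))"
    using w by (auto simp: ker_def restr_def indicator_def fun_eq_iff)
  show "set_integrable lborel {w..} (\<lambda>y. Kalpha \<alpha> (x / y) * l y / y) \<longleftrightarrow> integrable lborel (ker x (restr w l))"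
    unfolding e set_integrable_def ..
  show "(\<integral>y\<in>{w..}. Kalpha \<alpha> (x / y) * l y / y \<partial>lborel) = (LBINT y. ker x (restr w l) y)"
    unfolding e set_lebesgue_integral_def ..
qed

lemma mom_1_scaled_asymp:
  assumes c: "0 < c"
  shows "((\<lambda>x. x powr (- sexp) * mom 1 (c * x)) \<longlongrightarrow> c powr sexp * (sexp * Sinf)) at_top"
    and "((\<lambda>x. x powr (- sexp) * Sact \<alpha> (c * x)) \<longlongrightarrow> c powr sexp * Sinf) at_top"
proof -
  have cx: "filterlim (\<lambda>x. c * x) at_top at_top" using c by real_asymp
  have p: "\<forall>\<^sub>F x in at_top. c powr sexp * ((c * x) powr (- sexp) * f (c * x)) = x powr (- sexp) * f (c * x)" for f :: "real \<Rightarrow> real"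
    using eventually_gt_at_top[of 0] by eventually_elim (use c in \<open>simp add: powr_mult powr_minus field_simps\<close>)
  show "((\<lambda>x. x powr (- sexp) * mom 1 (c * x)) \<longlongrightarrow> c powr sexp * (sexp * Sinf)) at_top"
    by (rule Lim_transform_eventually[OF tendsto_mult_left[OF filterlim_compose[OF mom_1_asymp cx]] p])
  show "((\<lambda>x. x powr (- sexp) * Sact \<alpha> (c * x)) \<longlongrightarrow> c powr sexp * Sinf) at_top"
    by (rule Lim_transform_eventually[OF tendsto_mult_left[OF filterlim_compose[OF Sact_asymp cx]] p])
qed

lemma Sinf_pos: "0 < Sinf"
proof -
  have "0 < Aconst \<alpha> powr sexp" using Aconst_pos by simp
  hence "0 < 2 * (1 + \<alpha>) * \<rho> powr sexp * Sinf" by (simp only: Aconst_powr)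
  thus ?thesis by (rule zero_less_mult_pos) (use alpha_gt_1 rho_pos in simp)
qed

text \<open>Compare d with a positive H that exceeds its own image under the operator by \<kappa> >
  0. If the supremum M of |d| / H were positive, the equation would improve the bound by a fixed
  factor on bounded intervals, and the growth condition would do so far out.\<close>

lemma homogeneous_unique:
  assumes w: "0 < w"
    and I: "\<And>x. w \<le> x \<Longrightarrow> integrable lborel (ker x (restr w d))"
    and E: "\<And>x. w \<le> x \<Longrightarrow> d x = (LBINT y. ker x (restr w d) y)"
    and Z: "((\<lambda>x. x powr (- sexp) * d x) \<longlongrightarrow> 0) at_top"
    and x: "w \<le> x"
  shows "d x = 0"
proof -
  define c where "c = \<rho> / w"
  have c: "0 < c" "c * w = \<rho>" using w rho_pos by (auto simp: c_def)
  have cx: "0 < c * x" if "w \<le> x" for x using c(1) w that by simp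
  have cgt: "\<rho> < c * x" if "w < x" for x using c that by (metis mult_less_cancel_left_pos)
  have cle: "c * x \<le> \<rho>" if "x \<le> w" for x using c that by (metis mult_left_mono less_imp_le)
  define m where "m = (\<lambda>y. mom 0 y + mom 1 y)"
  define \<kappa> where "\<kappa> = mshift 0"
  have k: "0 < \<kappa>" using theta_bounds by (simp add: \<kappa>_def mshift_def)
  \<comment> \<open>Defined through the operator and not as m (c x), which is 0 at x = w; this keeps
    H \<ge> \<kappa> at the left endpoint.\<close>
  define H where "H = (\<lambda>x. (LBINT y. ker (c * x) m y) + \<kappa>)"
  have r1: "\<rho> + 1 > \<rho>" "0 < \<rho> + 1" using rho_pos by auto
  have Im: "integrable lborel (ker z m)" if "0 < z" for z
    unfolding m_def ker_add
    by (intro Bochner_Integration.integrable_add ker_integrable_transfer[OF integrable_ker_mom[OF r1(1)] r1(2) that]) auto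
  have mn: "0 \<le> m y" if "0 < y" for y using mom_nonneg that by (simp add: m_def)
  have Hk: "\<kappa> \<le> H x" if "w \<le> x" for x
    unfolding H_def using ker_nonneg[OF cx[OF that] mn] by (simp add: integral_nonneg_AE)
  have Hm: "H y = m (c * y)" if "w < y" for y
  proof -
    have "(LBINT z. ker (c * y) m z) = (mom 0 (c * y) - mshift 0) + (mom 1 (c * y) - mshift 1)"
      unfolding m_def ker_add
      using integrable_ker_mom[OF cgt[OF that]] integral_ker_mom[OF cgt[OF that]] by simp
    thus ?thesis by (simp add: H_def m_def \<kappa>_def mshift_def)
  qed
  have Heq: "restr w H y = m (c * y)" if "0 < y" "y \<noteq> w" for y
  proof (cases "w < y")
    case False
    hence "c * y \<le> \<rho>" using cle that by simp
    thus ?thesis using False that by (simp add: restr_def m_def mom_zero)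
  qed (simp add: restr_def Hm)
  have IH: "integrable lborel (ker x (restr w H))" if "w \<le> x" for x
    using ker_integrable_cong[OF w Heq, where x = x] integrable_ker_scale[OF c(1) Im[OF cx[OF that]]] by simp
  have EH: "(LBINT y. ker x (restr w H) y) = H x - \<kappa>" if "w \<le> x" for x
    using ker_integral_cong[OF w Heq, where x = x] integral_ker_scale[OF c(1) Im[OF cx[OF that]]] by (simp add: H_def)
  have Hp: "0 < H x" if "w \<le> x" for x using Hk[OF that] k by linarith
  \<comment> \<open>By \<open>Z\<close>, d is of smaller order than x powr sexp, whereas H is at
    least mom 1 (c x), which has exactly this order.\<close>
  have far: "\<exists>R\<ge>w. \<forall>x\<ge>R. \<bar>d x\<bar> \<le> e * H x" if e: "0 < e" for e
  proof -
    define c2 where "c2 = c powr sexp * (sexp * Sinf)"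
    have c2: "0 < c2" unfolding c2_def
      by (intro mult_pos_pos Sinf_pos) (use c alpha_gt_1 in \<open>auto simp: sexp_def\<close>)
    have "\<forall>\<^sub>F x in at_top. c2 / 2 < x powr (- sexp) * mom 1 (c * x)"
      by (rule order_tendstoD(1)[OF mom_1_scaled_asymp(1)[OF c(1), folded c2_def]]) (use c2 in simp)
    moreover have "\<forall>\<^sub>F x in at_top. \<bar>x powr (- sexp) * d x\<bar> < e * c2 / 2"
      using order_tendstoD(2)[OF tendsto_rabs[OF Z], of "e * c2 / 2"] c2 e by simp
    ultimately have "\<forall>\<^sub>F x in at_top. \<bar>d x\<bar> \<le> e * H x"
      using eventually_gt_at_top[of w]
    proof eventually_elim
      case (elim x)
      have xp: "0 < x powr (- sexp)" using elim w by simp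
      have "x powr (- sexp) * \<bar>d x\<bar> < e * (c2 / 2)" using elim xp by (simp add: abs_mult)
      also have "\<dots> \<le> e * (x powr (- sexp) * mom 1 (c * x))" using elim e by (intro mult_left_mono) auto
      also have "\<dots> \<le> e * (x powr (- sexp) * H x)"
        using Hm[OF elim(3)] mom_nonneg[of "c * x" 0] cx[of x] elim e by (intro mult_left_mono) (auto simp: m_def)
      finally have "x powr (- sexp) * \<bar>d x\<bar> < x powr (- sexp) * (e * H x)" by (simp add: mult_ac)
      thus ?case using xp by (simp only: mult_less_cancel_left_pos)
    qed
    then obtain R where "\<forall>x\<ge>R. \<bar>d x\<bar> \<le> e * H x" by (auto simp: eventually_at_top_linorder)
    thus ?thesis by (intro exI[of _ "max R w"]) auto
  qed
  \<comment> \<open>Boundedness on compact intervals comes from the equation itself: the Harnack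
    majorant reduces it to an integral at the left endpoint.\<close>
  have near: "\<exists>B. \<forall>x. w \<le> x \<and> x \<le> R \<longrightarrow> \<bar>d x\<bar> \<le> B \<and> H x \<le> B" for R
  proof -
    have cw: "0 < c * w" unfolding c(2) by (rule rho_pos)
    obtain C1 where C1: "0 < C1" "\<forall>x u y. w \<le> x \<and> x \<le> R \<longrightarrow> \<bar>ker x u y\<bar> \<le> C1 * \<bar>ker w u y\<bar>"
      by (rule ker_dominated[OF w w]) (rule that)
    obtain C2 where C2: "0 < C2" "\<forall>x u y. c * w \<le> x \<and> x \<le> c * R \<longrightarrow> \<bar>ker x u y\<bar> \<le> C2 * \<bar>ker (c * w) u y\<bar>"
      by (rule ker_dominated[OF cw cw]) (rule that)
    define B1 where "B1 = (LBINT y. C1 * \<bar>ker w (restr w d) y\<bar>)"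
    define B2 where "B2 = (LBINT y. C2 * \<bar>ker (c * w) m y\<bar>)"
    have "\<bar>d x\<bar> \<le> max B1 (B2 + \<kappa>) \<and> H x \<le> max B1 (B2 + \<kappa>)" if xr: "w \<le> x" "x \<le> R" for x
    proof -
      have "\<bar>d x\<bar> \<le> (LBINT y. \<bar>ker x (restr w d) y\<bar>)"
        unfolding E[OF xr(1)] using integral_norm_bound[of lborel "ker x (restr w d)"] by simp
      also have "\<dots> \<le> B1" unfolding B1_def
        by (rule integral_mono) (use I[OF xr(1)] I[OF order_refl] C1 xr in auto)
      finally have 1: "\<bar>d x\<bar> \<le> B1" .
      have cxr: "c * w \<le> c * x" "c * x \<le> c * R" using xr c(1) by auto
      have "(LBINT y. ker (c * x) m y) \<le> B2" unfolding B2_def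
      proof (rule integral_mono)
        show "ker (c * x) m y \<le> C2 * \<bar>ker (c * w) m y\<bar>" for y
          using C2(2) cxr abs_ge_self[of "ker (c * x) m y"] by (meson order_trans)
      qed (use Im[OF cx[OF xr(1)]] Im[OF cw] in auto)
      thus ?thesis using 1 by (auto simp: H_def)
    qed
    thus ?thesis by blast
  qed
  define M where "M = (SUP x\<in>{w..}. \<bar>d x\<bar> / H x)"
  have bdd: "bdd_above ((\<lambda>x. \<bar>d x\<bar> / H x) ` {w..})"
  proof -
    obtain R where R: "R \<ge> w" "\<forall>x\<ge>R. \<bar>d x\<bar> \<le> 1 * H x" using far[of 1] by auto
    obtain B where B: "\<forall>x. w \<le> x \<and> x \<le> R \<longrightarrow> \<bar>d x\<bar> \<le> B \<and> H x \<le> B" using near by blast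
    have "\<bar>d x\<bar> / H x \<le> max 1 (B / \<kappa>)" if xw: "w \<le> x" for x
    proof (cases "x \<le> R")
      case True
      hence "\<bar>d x\<bar> / H x \<le> B / \<kappa>" using B xw Hk[OF xw] k by (intro frac_le) auto
      thus ?thesis by simp
    next
      case False
      hence "\<bar>d x\<bar> / H x \<le> 1" using R Hp[OF xw] by (simp add: divide_le_eq)
      thus ?thesis by simp
    qed
    thus ?thesis by (intro bdd_aboveI[of _ "max 1 (B / \<kappa>)"]) auto
  qed
  have le: "\<bar>d x\<bar> \<le> M * H x" if xw: "w \<le> x" for x
  proof -
    have "\<bar>d x\<bar> / H x \<le> M" unfolding M_def by (rule cSUP_upper[OF _ bdd]) (use xw in simp)
    thus ?thesis using Hp[OF xw] by (simp add: divide_le_eq)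
  qed
  have M0: "0 \<le> M"
  proof -
    have "\<bar>d w\<bar> / H w \<le> M" unfolding M_def by (rule cSUP_upper[OF _ bdd]) simp
    moreover have "0 \<le> \<bar>d w\<bar> / H w" using Hp[OF order_refl] by simp
    ultimately show ?thesis by linarith
  qed
  have "M = 0"
  proof (rule ccontr)
    assume "M \<noteq> 0"
    hence Mp: "0 < M" using M0 by simp
    obtain R where R: "R \<ge> w" "\<forall>x\<ge>R. \<bar>d x\<bar> \<le> (M / 2) * H x" using far[of "M / 2"] Mp by auto
    obtain B where B: "\<forall>x. w \<le> x \<and> x \<le> R \<longrightarrow> \<bar>d x\<bar> \<le> B \<and> H x \<le> B" using near by blast
    have Bk: "\<kappa> \<le> B" using B R Hk[of w] by force
    \<comment> \<open>The worse of two factors: 1/2 beyond R, and 1 - \<kappa> / B up to R, where H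
      \<le> B makes the gain \<kappa> / H at least \<kappa> / B.\<close>
    define q where "q = max (1 / 2) (1 - \<kappa> / B)"
    have q: "q < 1" using k Bk by (simp add: q_def)
    have "\<bar>d x\<bar> / H x \<le> M * q" if xw: "w \<le> x" for x
    proof (cases "x \<le> R")
      case True
      have "\<bar>d x\<bar> \<le> (LBINT y. \<bar>ker x (restr w d) y\<bar>)"
        unfolding E[OF xw] using integral_norm_bound[of lborel "ker x (restr w d)"] by simp
      also have "\<dots> \<le> (LBINT y. M * ker x (restr w H) y)"
      proof (rule integral_mono)
        fix y
        show "\<bar>ker x (restr w d) y\<bar> \<le> M * ker x (restr w H) y"
        proof (cases "w \<le> y")
          case True
          have K0: "0 \<le> Kalpha \<alpha> (x / y)" using kernel_nonneg[of "x / y"] xw w True by simp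
          hence K: "0 \<le> Kalpha \<alpha> (x / y) / y" using w True by simp
          have "(Kalpha \<alpha> (x / y) / y) * \<bar>d y\<bar> \<le> (Kalpha \<alpha> (x / y) / y) * (M * H y)"
            using le[OF True] K by (intro mult_left_mono)
          thus ?thesis using True w K0 by (simp add: ker_def restr_def abs_mult mult_ac)
        qed (simp add: ker_def restr_def)
      qed (use I[OF xw] IH[OF xw] in auto)
      also have "\<dots> = M * (H x - \<kappa>)" unfolding integral_mult_right_zero EH[OF xw] ..
      finally have "\<bar>d x\<bar> / H x \<le> M * (H x - \<kappa>) / H x" using Hp[OF xw] by (intro divide_right_mono) auto
      also have "\<dots> = M * (1 - \<kappa> / H x)" using Hp[OF xw] by (simp add: diff_divide_distrib right_diff_distrib)
      also have "\<dots> \<le> M * (1 - \<kappa> / B)"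
      proof -
        have "\<kappa> / B \<le> \<kappa> / H x" using B True xw Hp[OF xw] k Bk by (intro divide_left_mono) auto
        thus ?thesis using M0 by (intro mult_left_mono) auto
      qed
      also have "\<dots> \<le> M * q" using M0 by (intro mult_left_mono) (auto simp: q_def)
      finally show ?thesis .
    next
      case False
      hence "\<bar>d x\<bar> / H x \<le> M / 2" using R Hp[OF xw] by (simp add: divide_le_eq)
      also have "\<dots> = M * (1 / 2)" by simp
      also have "\<dots> \<le> M * q" using M0 by (intro mult_left_mono) (auto simp: q_def)
      finally show ?thesis .
    qed
    hence "M \<le> M * q" unfolding M_def[symmetric] by (subst M_def, intro cSUP_least) auto
    moreover have "M * q < M * 1" using Mp q by (intro mult_strict_left_mono)
    ultimately show False by simp
  qed
  thus ?thesis using le[OF x] by simp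
qed

end

section \<open>The solution\<close>

context anharmonic
begin

lemma tau_deriv:
  assumes "1 < \<xi>"
  shows "(tau \<alpha> has_real_derivative 2 * (1 + \<alpha>) * (mom 1 (\<rho> * \<xi>) / \<xi>)) (at \<xi>)"
proof -
  have r: "\<rho> < \<rho> * \<xi>" using assms rho_pos by simp
  have "((\<lambda>\<xi>. Sact \<alpha> (\<rho> * \<xi>)) has_real_derivative mom 1 (\<rho> * \<xi>) / (\<rho> * \<xi>) * \<rho>) (at \<xi>)"
    by (rule DERIV_chain2[where f = "Sact \<alpha>" and g = "\<lambda>\<xi>. \<rho> * \<xi>"], rule Sact_deriv[OF r])
       (auto intro!: derivative_eq_intros)
  from DERIV_cmult[OF this, of "2 * (1 + \<alpha>)"] show ?thesis
    unfolding tau_def [abs_def] using rho_pos by simp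
qed

section \<open>The solution for fixed omega and p\<close>

context
  fixes \<omega> p :: real
  assumes omega: "0 < \<omega>"
begin

definition amp :: real where "amp = (\<omega> / Aconst \<alpha>) powr sexp"

text \<open>\<open>lbar\<close> in the variable y = rho \<xi>, with \<open>mom 1\<close> in place of
  the logarithmic derivative of the action. It vanishes for y \<le> rho and needs no derivative at
  the threshold.\<close>

definition v :: "real \<Rightarrow> real" where
  "v y = 2 * (1 + \<alpha>) * (p * Sact \<alpha> y - 2 * \<alpha> / (1 + \<alpha>) * (p - amp) * mom 1 y)"

definition lval :: real where "lval = sqrt (2 * (1 + \<alpha>)) * (amp - p)"

lemma lbar_eq_v:
  assumes "1 < \<xi>" shows "lbar \<alpha> \<omega> p \<xi> = v (\<rho> * \<xi>)"
proof -
  have "deriv (tau \<alpha>) \<xi> = 2 * (1 + \<alpha>) * (mom 1 (\<rho> * \<xi>) / \<xi>)" by (rule DERIV_imp_deriv[OF tau_deriv[OF assms]])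
  hence D: "\<xi> * deriv (tau \<alpha>) \<xi> = 2 * (1 + \<alpha>) * mom 1 (\<rho> * \<xi>)" using assms by simp
  have gen: "p * (K * S) - q * r * (K * m) = K * (p * S - q * r * m)" for K S q r m :: real
    by (simp add: algebra_simps)
  show ?thesis by (simp only: lbar_def D tau_def v_def amp_def sexp_def gen)
qed

lemma v_zero: "y \<le> \<rho> \<Longrightarrow> v y = 0"
  by (simp add: v_def Sact_zero mom_zero del: One_nat_def)

text \<open>Euler's relation eliminates the action, leaving a combination of functions whose
  integral equations are known. The p-part of \<open>mom 1\<close> cancels.\<close>

lemma v_moments: "v y = 4 * \<alpha> * amp * mom 1 y + (- 4 * (1 + \<alpha>) * p) * mom 0 y"
proof (cases "y > \<rho>")
  case True
  define q where "q = 2 * \<alpha> / (1 + \<alpha>)"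
  have q: "(1 + \<alpha>) * q = 2 * \<alpha>" using alpha_gt_1 by (simp add: q_def)
  have "v y = 2 * (1 + \<alpha>) * (p * (q * mom 1 y - 2 * mom 0 y) - q * (p - amp) * mom 1 y)"
    unfolding v_def Euler_relation[OF True] q_def[symmetric] ..
  also have "\<dots> = 2 * ((1 + \<alpha>) * q) * amp * mom 1 y + (- 4 * (1 + \<alpha>) * p) * mom 0 y" by (simp add: algebra_simps)
  finally show ?thesis unfolding q by simp
qed (simp add: v_zero mom_zero del: One_nat_def)

lemma v_tendsto_rho: "(v \<longlongrightarrow> lval) (at_right (\<rho>))"
proof -
  have "(v \<longlongrightarrow> 2 * (1 + \<alpha>) * (p * 0 - 2 * \<alpha> / (1 + \<alpha>) * (p - amp) * (sqrt (2 * (1 + \<alpha>)) / (4 * \<alpha>)))) (at_right (\<rho>))"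
    unfolding v_def [abs_def] by (intro tendsto_intros Sact_tendsto_rho mom_1_near_rho)
  moreover have "2 * (1 + \<alpha>) * (p * 0 - 2 * \<alpha> / (1 + \<alpha>) * (p - amp) * (sqrt (2 * (1 + \<alpha>)) / (4 * \<alpha>))) = lval"
  proof -
    have "2 * q * (p * 0 - 2 * \<alpha> / q * (p - amp) * (z / (4 * \<alpha>))) = z * (amp - p)" if "q \<noteq> 0" for q z :: real
      using that alpha_gt_1 by (simp add: field_simps)
    note * = this
    show ?thesis unfolding lval_def by (rule *) (use alpha_gt_1 in simp)
  qed
  ultimately show ?thesis by (simp only:)
qed

lemma lbar_tendsto: "(lbar \<alpha> \<omega> p \<longlongrightarrow> lval) (at_right 1)"
proof -
  have "filterlim (\<lambda>\<xi>. \<rho> * \<xi>) (at_right (\<rho>)) (at_right 1)"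
    unfolding filterlim_at
  proof
    show "\<forall>\<^sub>F \<xi> in at_right 1. \<rho> * \<xi> \<in> {\<rho><..} \<and> \<rho> * \<xi> \<noteq> \<rho>"
      using eventually_at_right_less[of "1::real"] by eventually_elim (use rho_pos in simp)
    have "((\<lambda>\<xi>. \<rho> * \<xi>) \<longlongrightarrow> \<rho> * 1) (at_right 1)" by (intro tendsto_intros)
    thus "((\<lambda>\<xi>. \<rho> * \<xi>) \<longlongrightarrow> \<rho>) (at_right 1)" by simp
  qed
  from filterlim_compose[OF v_tendsto_rho this]
  have "((\<lambda>\<xi>. v (\<rho> * \<xi>)) \<longlongrightarrow> lval) (at_right 1)" .
  moreover have "\<forall>\<^sub>F \<xi> in at_right 1. v (\<rho> * \<xi>) = lbar \<alpha> \<omega> p \<xi>"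
    using eventually_at_right_less[of "1::real"] by eventually_elim (simp add: lbar_eq_v)
  ultimately show ?thesis by (rule Lim_transform_eventually)
qed

lemma integrable_ker_v:
  assumes "0 < z" shows "integrable lborel (ker z v)"
proof -
  have r1: "\<rho> + 1 > \<rho>" "0 < \<rho> + 1" using rho_pos by auto
  have "integrable lborel (ker z (mom n))" if "n \<le> 1" for n
    by (rule ker_integrable_transfer[OF integrable_ker_mom[OF r1(1) that] r1(2) assms])
  from this[of 1] this[of 0] show ?thesis
    unfolding v_moments [abs_def] ker_add ker_cmult
    by (intro Bochner_Integration.integrable_add integrable_mult_right) auto
qed

lemma integral_ker_v:
  assumes z: "\<rho> < z" shows "(LBINT y. ker z v y) = v z + 2 * p"
proof -
  have "(LBINT y. ker z v y) = 4 * \<alpha> * amp * (mom 1 z - mshift 1) + (- 4 * (1 + \<alpha>) * p) * (mom 0 z - mshift 0)"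
    unfolding v_moments [abs_def] ker_add ker_cmult
    using integrable_ker_mom[OF z] integral_ker_mom[OF z] by simp
  also have "\<dots> = v z + 4 * (1 + \<alpha>) * p * mshift 0"
    unfolding v_moments by (simp add: mshift_def algebra_simps)
  \<comment> \<open>The origin of the inhomogeneous term: the shift of \<open>mom 0\<close>,
    combined with (1+\<alpha>) \<theta> = 2 pi.\<close>
  also have "4 * (1 + \<alpha>) * p * mshift 0 = 2 * p"
  proof -
    have "(1 + \<alpha>) * \<theta> = 2 * pi" by (rule alpha_theta)
    hence "4 * ((1 + \<alpha>) * \<theta>) * p / (4 * pi) = 2 * p" by simp
    thus ?thesis by (simp add: mshift_def mult_ac)
  qed
  finally show ?thesis .
qed

text \<open>Given by the right-hand side of the rescaled equation, so that x = omega receives the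
  continuous value and not v \<rho> = 0.\<close>

definition lsol :: "real \<Rightarrow> real" where
  "lsol x = - 2 * p + (LBINT y. ker (\<rho> / \<omega> * x) v y)"

lemma lsol_eq:
  assumes "\<omega> < x" shows "lsol x = v (\<rho> / \<omega> * x)" "lsol x = lbar \<alpha> \<omega> p (x / \<omega>)"
proof -
  have "\<rho> * 1 < \<rho> * (x / \<omega>)" by (rule mult_strict_left_mono) (use assms omega rho_pos in auto)
  hence "\<rho> < \<rho> / \<omega> * x" by simp
  from integral_ker_v[OF this] show 1: "lsol x = v (\<rho> / \<omega> * x)" by (simp add: lsol_def)
  show "lsol x = lbar \<alpha> \<omega> p (x / \<omega>)"
    unfolding 1 by (subst lbar_eq_v) (use assms omega in auto)
qed

lemma restr_lsol: "0 < y \<Longrightarrow> y \<noteq> \<omega> \<Longrightarrow> restr \<omega> lsol y = v (\<rho> / \<omega> * y)"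
proof (cases "\<omega> < y")
  case False
  assume y: "0 < y" "y \<noteq> \<omega>"
  have "\<rho> * (y / \<omega>) \<le> \<rho> * 1" by (rule mult_left_mono) (use False omega rho_pos in auto)
  hence "v (\<rho> / \<omega> * y) = 0" by (intro v_zero) simp
  thus ?thesis using False y by (simp add: restr_def)
qed (simp add: restr_def lsol_eq)

text \<open>Both sides are the right limit of \<open>v\<close> at rho, once by continuity of the
  integral operator and once by the explicit endpoint limits.\<close>

lemma lsol_omega: "lsol \<omega> = lval"
proof -
  have "isCont (\<lambda>x. \<integral>y. ker x v y \<partial>lborel) (\<rho>)"
    by (rule ker_integral_continuous[OF integrable_ker_v[OF rho_pos] rho_pos rho_pos])
  hence "((\<lambda>x. - 2 * p + (LBINT y. ker x v y)) \<longlongrightarrow> - 2 * p + (LBINT y. ker (\<rho>) v y)) (at_right (\<rho>))"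
    unfolding isCont_def by (intro tendsto_intros) (simp add: filterlim_at_split)
  moreover have "\<forall>\<^sub>F x in at_right (\<rho>). - 2 * p + (LBINT y. ker x v y) = v x"
    using eventually_at_right_less[of "\<rho>"] by eventually_elim (simp add: integral_ker_v)
  ultimately have "(v \<longlongrightarrow> - 2 * p + (LBINT y. ker (\<rho>) v y)) (at_right (\<rho>))"
    by (rule Lim_transform_eventually)
  with v_tendsto_rho have "lval = - 2 * p + (LBINT y. ker (\<rho>) v y)"
    by (rule tendsto_unique[rotated]) simp
  thus ?thesis using omega by (simp add: lsol_def)
qed

lemma
  assumes "\<omega> \<le> x"
  shows lsol_integrable: "integrable lborel (ker x (restr \<omega> lsol))"
    and lsol_equation: "lsol x = - 2 * p + (LBINT y. ker x (restr \<omega> lsol) y)"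
proof -
  have c: "0 < \<rho> / \<omega>" using omega rho_pos by simp
  have z: "0 < \<rho> / \<omega> * x" using c assms omega by (intro mult_pos_pos) auto
  show "integrable lborel (ker x (restr \<omega> lsol))"
    using ker_integrable_cong[OF omega restr_lsol, where x = x] integrable_ker_scale[OF c integrable_ker_v[OF z]] by simp
  show "lsol x = - 2 * p + (LBINT y. ker x (restr \<omega> lsol) y)"
    using ker_integral_cong[OF omega restr_lsol, where x = x] integral_ker_scale[OF c integrable_ker_v[OF z]]
    by (simp add: lsol_def)
qed

text \<open>Since 2\<alpha>/(1+\<alpha>) is the reciprocal of \<open>sexp\<close>, the p-terms of
  the action and of \<open>mom 1\<close> cancel to leading order. What remains is proportional to
  \<open>amp\<close>, and \<open>Aconst_powr\<close> normalises it to 1.\<close>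

lemma lsol_asymp: "((\<lambda>x. x powr (- sexp) * lsol x) \<longlongrightarrow> 1) at_top"
proof -
  define c where "c = \<rho> / \<omega>"
  have c: "0 < c" using omega rho_pos by (simp add: c_def)
  have a: "2 * \<alpha> / (1 + \<alpha>) * sexp = 1" using alpha_gt_1 by (simp add: sexp_def)
  have "((\<lambda>x. 2 * (1 + \<alpha>) * (p * (x powr (- sexp) * Sact \<alpha> (c * x)) - 2 * \<alpha> / (1 + \<alpha>) * (p - amp) * (x powr (- sexp) * mom 1 (c * x)))) \<longlongrightarrow>
      2 * (1 + \<alpha>) * (p * (c powr sexp * Sinf) - 2 * \<alpha> / (1 + \<alpha>) * (p - amp) * (c powr sexp * (sexp * Sinf)))) at_top"
    by (intro tendsto_intros mom_1_scaled_asymp c)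
  moreover have "2 * (1 + \<alpha>) * (p * (c powr sexp * Sinf) - 2 * \<alpha> / (1 + \<alpha>) * (p - amp) * (c powr sexp * (sexp * Sinf))) = 1"
  proof -
    have "2 * \<alpha> / (1 + \<alpha>) * (p - amp) * (c powr sexp * (sexp * Sinf)) = (2 * \<alpha> / (1 + \<alpha>) * sexp) * ((p - amp) * (c powr sexp * Sinf))"
      by simp
    also have "\<dots> = (p - amp) * (c powr sexp * Sinf)" by (simp only: a mult_1_left)
    finally have "2 * (1 + \<alpha>) * (p * (c powr sexp * Sinf) - 2 * \<alpha> / (1 + \<alpha>) * (p - amp) * (c powr sexp * (sexp * Sinf)))
        = 2 * (1 + \<alpha>) * (p * (c powr sexp * Sinf) - (p - amp) * (c powr sexp * Sinf))" by (simp only:)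
    also have "\<dots> = 2 * (1 + \<alpha>) * c powr sexp * Sinf * amp" by (simp add: algebra_simps)
    also have "\<dots> = 1"
    proof -
      have c1: "c powr sexp = \<rho> powr sexp / \<omega> powr sexp" using omega rho_pos by (simp add: c_def powr_divide)
      have a1: "amp = \<omega> powr sexp / Aconst \<alpha> powr sexp" using omega Aconst_pos by (simp add: amp_def powr_divide)
      have "2 * (1 + \<alpha>) * c powr sexp * Sinf * amp = (2 * (1 + \<alpha>) * \<rho> powr sexp * Sinf) / Aconst \<alpha> powr sexp"
        unfolding c1 a1 using omega by simp
      also have "2 * (1 + \<alpha>) * \<rho> powr sexp * Sinf = Aconst \<alpha> powr sexp" by (rule Aconst_powr[symmetric])
      finally show ?thesis using Aconst_pos by simp
    qed
    finally show ?thesis .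
  qed
  moreover have "\<forall>\<^sub>F x in at_top. 2 * (1 + \<alpha>) * (p * (x powr (- sexp) * Sact \<alpha> (c * x)) - 2 * \<alpha> / (1 + \<alpha>) * (p - amp) * (x powr (- sexp) * mom 1 (c * x)))
      = x powr (- sexp) * lsol x"
    using eventually_gt_at_top[of \<omega>]
  proof eventually_elim
    case (elim x)
    have "lsol x = v (c * x)" unfolding c_def by (rule lsol_eq(1)[OF elim])
    moreover have "K * (p * (z * S) - q * (z * m)) = z * (K * (p * S - q * m))" for K z S q m :: real
      by (simp add: algebra_simps)
    ultimately show ?case by (simp only: v_def)
  qed
  ultimately show ?thesis by (simp only: Lim_transform_eventually)
qed

lemma solves_lin_iff:
  "solves_lin \<alpha> \<omega> p l \<longleftrightarrow> (\<forall>x\<ge>\<omega>. integrable lborel (ker x (restr \<omega> l)) \<and>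
      l x = - 2 * p + (LBINT y. ker x (restr \<omega> l) y)) \<and> ((\<lambda>x. x powr (- sexp) * l x) \<longlongrightarrow> 1) at_top"
proof -
  have "- (1 + \<alpha>) / (2 * \<alpha>) = - sexp" by (simp only: sexp_def minus_divide_left)
  thus ?thesis unfolding solves_lin_def set_integrable_iff_ker[OF omega] set_integral_eq_ker[OF omega] by (simp only:)
qed

lemma solves_lin_lsol: "solves_lin \<alpha> \<omega> p lsol"
  unfolding solves_lin_iff using lsol_integrable lsol_equation lsol_asymp by blast

lemma solves_lin_unique:
  assumes l: "solves_lin \<alpha> \<omega> p l" and x: "\<omega> \<le> x"
  shows "l x = lsol x"
proof -
  define d where "d = (\<lambda>x. l x - lsol x)"
  have kd: "ker x (restr \<omega> d) = (\<lambda>y. ker x (restr \<omega> l) y - ker x (restr \<omega> lsol) y)" for x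
    by (auto simp: d_def ker_def restr_def fun_eq_iff algebra_simps diff_divide_distrib)
  have L: "integrable lborel (ker x (restr \<omega> l))" "l x = - 2 * p + (LBINT y. ker x (restr \<omega> l) y)" if "\<omega> \<le> x" for x
    using l that unfolding solves_lin_iff by blast+
  have "d x = 0"
  proof (rule homogeneous_unique[OF omega _ _ _ x])
    fix x assume x: "\<omega> \<le> x"
    show "integrable lborel (ker x (restr \<omega> d))" unfolding kd
      by (rule Bochner_Integration.integrable_diff[OF L(1)[OF x] lsol_integrable[OF x]])
    have "(LBINT y. ker x (restr \<omega> d) y) = (LBINT y. ker x (restr \<omega> l) y) - (LBINT y. ker x (restr \<omega> lsol) y)"
      unfolding kd by (rule Bochner_Integration.integral_diff[OF L(1)[OF x] lsol_integrable[OF x]])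
    thus "d x = (LBINT y. ker x (restr \<omega> d) y)" using L(2)[OF x] lsol_equation[OF x] by (simp add: d_def)
  next
    have "((\<lambda>x. x powr (- sexp) * l x) \<longlongrightarrow> 1) at_top" using l unfolding solves_lin_iff by blast
    from tendsto_diff[OF this lsol_asymp]
    show "((\<lambda>x. x powr (- sexp) * d x) \<longlongrightarrow> 0) at_top" by (simp add: d_def right_diff_distrib)
  qed
  thus ?thesis by (simp add: d_def)
qed

end

end

theorem theorem2p8:
  fixes \<alpha> \<omega> p :: real
  assumes "\<alpha> > 1" and "\<omega> > 0" and "p \<ge> 0"
  shows "(\<forall>\<xi>>1. tau \<alpha> differentiable (at \<xi>))
    \<and> (lbar \<alpha> \<omega> p \<longlongrightarrow>
         sqrt (2 * (1 + \<alpha>)) * ((\<omega> / Aconst \<alpha>) powr ((1 + \<alpha>) / (2 * \<alpha>)) - p)) (at_right 1)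
    \<and> (\<exists>l. solves_lin \<alpha> \<omega> p l)
    \<and> (\<forall>l. solves_lin \<alpha> \<omega> p l \<longrightarrow>
          (\<forall>x>\<omega>. l x = lbar \<alpha> \<omega> p (x / \<omega>)) \<and>
          l \<omega> = sqrt (2 * (1 + \<alpha>)) * ((\<omega> / Aconst \<alpha>) powr ((1 + \<alpha>) / (2 * \<alpha>)) - p))"
proof -
  interpret anharmonic \<alpha> by unfold_locales (rule assms(1))
  note om = assms(2)
  have val: "sqrt (2 * (1 + \<alpha>)) * ((\<omega> / Aconst \<alpha>) powr ((1 + \<alpha>) / (2 * \<alpha>)) - p) = lval \<omega> p"
    by (simp add: lval_def[OF om] amp_def[OF om] sexp_def)
  show ?thesis unfolding val
  proof (intro conjI allI impI)
    show "tau \<alpha> differentiable (at \<xi>)" if "1 < \<xi>" for \<xi>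
      using tau_deriv[OF that] by (auto simp: real_differentiable_def)
    show "(lbar \<alpha> \<omega> p \<longlongrightarrow> lval \<omega> p) (at_right 1)" by (rule lbar_tendsto[OF om])
    show "\<exists>l. solves_lin \<alpha> \<omega> p l" using solves_lin_lsol[OF om] by blast
  next
    fix l x assume l: "solves_lin \<alpha> \<omega> p l" and x: "\<omega> < x"
    have "l x = lsol \<omega> p x" by (rule solves_lin_unique[OF om l]) (use x in simp)
    thus "l x = lbar \<alpha> \<omega> p (x / \<omega>)" using lsol_eq(2)[OF om x] by simp
  next
    fix l assume l: "solves_lin \<alpha> \<omega> p l"
    show "l \<omega> = lval \<omega> p" using solves_lin_unique[OF om l order_refl] lsol_omega[OF om] by simp
  qed
qed

end
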